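(* Let $\mathcal A(G,\{k_n\})$ and $\mathcal A(\mathfrak G,\{l_n\})$ be tree-refinement subalgebras of the $2^\infty$-UHF $\mathrm C^*$-algebra; that is, $G,\mathfrak G$ are out-trees and $(k_n),(l_n)$ are sequences of powers of $2$ tending to infinity, with $k_1=|G^0|$, $l_1=|\mathfrak G^0|$, $k_n\mid k_{n+1}$ and $l_n\mid l_{n+1}$ for all $n$. Then $\mathcal A(G,\{k_n\})$ and $\mathcal A(\mathfrak G,\{l_n\})$ are isometrically isomorphic if and only if the out-trees $G$ and $\mathfrak G$ are isomorphic, perhaps after an ampliation; that is, if and only if there exist integers $a,b\ge0$ such that the ampliations $G^{(2^a)}$ and $\mathfrak G^{(2^b)}$ are isomorphic as directed graphs.
   Context: An out-tree is a finite connected directed graph having a root vertex $p$ such that for every other vertex $q$ there is exactly one directed path from $p$ to $q$. For an out-tree $G$ with vertex set $G^0$ identified with $\{1,\dots,k\}$, an edge from $j$ to $i$ is identified with the matrix unit $e_{ij}\in M_k(\mathbb C)$, and $\mathcal T_G^+\subseteq M_k(\mathbb C)$ is the span of all $e_{ij}$ such that there is a directed path (possibly of length $0$) from $j$ to $i$ in $G$. Ampliation. For $m\ge1$, the ampliation $G^{(m)}$ of $G$ of multiplicity $m$ is the out-tree with vertices $(i,s)$, $1\le i\le k$, $1\le s\le m$, where $(i,s)$ is identified with the index $(i-1)m+s\in\{1,\dots,km\}$, and with edges: from $(i,s)$ to $(i,s+1)$ for $1\le i\le k$, $1\le s\le m-1$; and from $(j,m)$ to $(i,1)$ whenever there is an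 edge of $G$ from $j$ to $i$. ($G^{(1)}=G$.) Tree-refinement algebra. Let $G$ be an out-tree and $(k_n)$ positive integers with $k_1=|G^0|$ and $k_n\mid k_{n+1}$. Put $G_1=G$ and $G_{n+1}=G_n^{(k_{n+1}/k_n)}$. Let $\sigma_n:M_{k_n}(\mathbb C)\to M_{k_{n+1}}(\mathbb C)$ be the refinement embedding $\sigma_n(e_{ij})=\sum_{s=1}^{m}e_{(i-1)m+s,\,(j-1)m+s}$ with $m=k_{n+1}/k_n$. Then $\sigma_n(\mathcal T_{G_n}^+)\subseteq\mathcal T_{G_{n+1}}^+$ and $\mathcal A(G,\{k_n\})=\varinjlim(\mathcal T_{G_n}^+,\sigma_n)$, the norm-closed union inside the UHF algebra $\varinjlim(M_{k_n}(\mathbb C),\sigma_n)$. *)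

theory Defs
  imports
    "HOL-Analysis.L2_Norm"
    "HOL-Algebra.QuotRing"
    "Jordan_Normal_Form.Matrix"
    "Graph_Theory.Pair_Digraph"
    "Graph_Theory.Digraph_Component"
    "Graph_Theory.Digraph_Isomorphism"
begin

section \<open>Out-trees and their ampliations\<close>

text \<open>
  A directed path is any finite sequence of consecutive arcs (\<open>awalk\<close>), with no condition that
  vertices be distinct; uniqueness of walks is what excludes a directed cycle or a back edge.
  Loops have to be excluded separately (by \<open>pair_digraph\<close>) only in the one-vertex case.
\<close>

definition out_tree :: "'a pair_pre_digraph \<Rightarrow> bool" where
  "out_tree G \<longleftrightarrow> pair_digraph G \<and> Digraph_Component.connected (with_proj G) \<and>
     (\<exists>p \<in> pverts G. \<forall>q \<in> pverts G. q \<noteq> p \<longrightarrow> (\<exists>!w. pre_digraph.awalk (with_proj G) p w q))"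

text \<open>
  All indices start from \<open>0\<close>: a graph on \<open>k\<close> vertices has vertex set \<open>{..<k}\<close>, and the vertex
  \<open>(i, s)\<close> of the ampliation, with \<open>s < m\<close>, is the number \<open>i * m + s\<close>.  An arc \<open>(j, i)\<close> leads from
  \<open>j\<close> to \<open>i\<close>.
\<close>

definition ampliation :: "nat \<Rightarrow> nat pair_pre_digraph \<Rightarrow> nat pair_pre_digraph" where
  "ampliation m G =
     \<lparr> pverts = {i * m + s | i s. i \<in> pverts G \<and> s < m},
       parcs = {(i * m + s, i * m + Suc s) | i s. i \<in> pverts G \<and> Suc s < m} \<union>
               {(j * m + (m - 1), i * m) | j i. (j, i) \<in> parcs G} \<rparr>"

section \<open>The matrix algebras\<close>

definition matrix_unit :: "nat \<Rightarrow> nat \<Rightarrow> nat \<Rightarrow> complex mat" where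
  "matrix_unit k i j = mat k k (\<lambda>(p, q). if p = i \<and> q = j then 1 else 0)"

inductive_set mat_span :: "nat \<Rightarrow> complex mat set \<Rightarrow> complex mat set" for k S where
  zero: "0\<^sub>m k k \<in> mat_span k S"
| base: "A \<in> S \<Longrightarrow> A \<in> mat_span k S"
| add: "A \<in> mat_span k S \<Longrightarrow> B \<in> mat_span k S \<Longrightarrow> A + B \<in> mat_span k S"
| smult: "A \<in> mat_span k S \<Longrightarrow> c \<cdot>\<^sub>m A \<in> mat_span k S"

definition tree_mats :: "nat \<Rightarrow> nat pair_pre_digraph \<Rightarrow> complex mat set" where
  "tree_mats k G = mat_span k {matrix_unit k i j | i j. j \<rightarrow>\<^sup>*\<^bsub>with_proj G\<^esub> i}"

definition vec_norm2 :: "complex vec \<Rightarrow> real" where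
  "vec_norm2 v = L2_set (\<lambda>i. cmod (v $ i)) {..<dim_vec v}"

definition op_norm :: "complex mat \<Rightarrow> real" where
  "op_norm A = Sup {vec_norm2 (A *\<^sub>v v) | v. v \<in> carrier_vec (dim_col A) \<and> vec_norm2 v \<le> 1}"

text \<open>
  The linear extension of \<open>e\<^sub>i\<^sub>j \<mapsto> \<Sum>s<m. e\<^bsub>i m + s, j m + s\<^esub>\<close>; see \<open>refine_matrix_unit\<close> below.
\<close>

definition refine :: "nat \<Rightarrow> complex mat \<Rightarrow> complex mat" where
  "refine m A = mat (dim_row A * m) (dim_col A * m)
     (\<lambda>(p, q). if p mod m = q mod m then A $$ (p div m, q div m) else 0)"

lemma refine_matrix_unit:
  assumes "i < k" "j < k"
  shows "refine m (matrix_unit k i j) =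
    mat (k * m) (k * m) (\<lambda>pq. \<Sum>s<m. matrix_unit (k * m) (i * m + s) (j * m + s) $$ pq)"
proof (rule eq_matI)
  fix p q
  assume "p < dim_row (mat (k * m) (k * m)
      (\<lambda>pq. \<Sum>s<m. matrix_unit (k * m) (i * m + s) (j * m + s) $$ pq))"
    and "q < dim_col (mat (k * m) (k * m)
      (\<lambda>pq. \<Sum>s<m. matrix_unit (k * m) (i * m + s) (j * m + s) $$ pq))"
  then have pq: "p < k * m" "q < k * m" by auto
  then have m: "0 < m" by (cases m) auto
  have dv: "p div m < k" "q div m < k"
    using pq by (auto simp: less_mult_imp_div_less)
  have eq: "p = i * m + s \<and> q = j * m + s \<longleftrightarrow>
      s = p mod m \<and> p div m = i \<and> q div m = j \<and> p mod m = q mod m" if "s < m" for s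
  proof
    assume "p = i * m + s \<and> q = j * m + s"
    then show "s = p mod m \<and> p div m = i \<and> q div m = j \<and> p mod m = q mod m"
      using that by simp
  next
    assume h: "s = p mod m \<and> p div m = i \<and> q div m = j \<and> p mod m = q mod m"
    have "p = p div m * m + p mod m" "q = q div m * m + q mod m" by simp_all
    with h show "p = i * m + s \<and> q = j * m + s" by simp
  qed
  have "(\<Sum>s<m. matrix_unit (k * m) (i * m + s) (j * m + s) $$ (p, q)) =
      (\<Sum>s<m. if s = p mod m then
         if p div m = i \<and> q div m = j \<and> p mod m = q mod m then 1 else 0 else 0)"
    by (rule sum.cong) (use pq eq in \<open>auto simp: matrix_unit_def\<close>)
  also have "\<dots> = (if p div m = i \<and> q div m = j \<and> p mod m = q mod m then 1 else 0)"
    using m by simp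
  finally show "refine m (matrix_unit k i j) $$ (p, q) = mat (k * m) (k * m)
      (\<lambda>pq. \<Sum>s<m. matrix_unit (k * m) (i * m + s) (j * m + s) $$ pq) $$ (p, q)"
    using pq dv by (simp add: refine_def matrix_unit_def)
qed (auto simp: refine_def matrix_unit_def)

text \<open>
  \<open>connecting k m n\<close>, for \<open>m \<le> n\<close>, is the composite of the refinement embeddings from
  \<open>M\<^bsub>k m\<^esub>\<close> to \<open>M\<^bsub>k n\<^esub>\<close> along the sequence \<open>k\<close>; the embedding at stage \<open>m\<close> is applied first.
\<close>

definition connecting :: "(nat \<Rightarrow> nat) \<Rightarrow> nat \<Rightarrow> nat \<Rightarrow> complex mat \<Rightarrow> complex mat" where
  "connecting k m n = fold (\<lambda>i. refine (k (Suc i) div k i)) [m..<n]"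

section \<open>The UHF algebra of a divisibility chain\<close>

text \<open>
  The UHF algebra is the completion of the algebraic direct limit.  Since the stages increase, each
  of its elements is the limit of a Cauchy sequence whose \<open>n\<close>-th term lies in the \<open>n\<close>-th stage,
  so the completion consists of such sequences modulo those that tend to zero in norm.
\<close>

definition uhf_seqs :: "(nat \<Rightarrow> nat) \<Rightarrow> (nat \<Rightarrow> complex mat) set" where
  "uhf_seqs k = {X. (\<forall>n. X n \<in> carrier_mat (k n) (k n)) \<and>
     (\<forall>\<epsilon>>0. \<exists>N. \<forall>m\<ge>N. \<forall>n\<ge>m. op_norm (X n - connecting k m n (X m)) < \<epsilon>)}"

definition uhf_eq :: "(nat \<Rightarrow> nat) \<Rightarrow> ((nat \<Rightarrow> complex mat) \<times> (nat \<Rightarrow> complex mat)) set" where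
  "uhf_eq k = {(X, Y). X \<in> uhf_seqs k \<and> Y \<in> uhf_seqs k \<and>
     (\<lambda>n. op_norm (X n - Y n)) \<longlonglongrightarrow> 0}"

record 'x normed_alg = "(complex, 'x) module" +
  alg_norm :: "'x \<Rightarrow> real"

type_synonym uhf_element = "(nat \<Rightarrow> complex mat) set"

definition uhf_algebra :: "(nat \<Rightarrow> nat) \<Rightarrow> uhf_element normed_alg" where
  "uhf_algebra k =
     \<lparr> carrier = uhf_seqs k // uhf_eq k,
       monoid.mult = (\<lambda>x y. \<Union>X\<in>x. \<Union>Y\<in>y. uhf_eq k `` {\<lambda>n. X n * Y n}),
       one = uhf_eq k `` {\<lambda>n. 1\<^sub>m (k n)},
       zero = uhf_eq k `` {\<lambda>n. 0\<^sub>m (k n) (k n)},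
       add = (\<lambda>x y. \<Union>X\<in>x. \<Union>Y\<in>y. uhf_eq k `` {\<lambda>n. X n + Y n}),
       smult = (\<lambda>c x. \<Union>X\<in>x. uhf_eq k `` {\<lambda>n. c \<cdot>\<^sub>m X n}),
       alg_norm = (\<lambda>x. THE r. \<forall>X\<in>x. (\<lambda>n. op_norm (X n)) \<longlonglongrightarrow> r) \<rparr>"

definition uhf_embed :: "(nat \<Rightarrow> nat) \<Rightarrow> nat \<Rightarrow> complex mat \<Rightarrow> uhf_element" where
  "uhf_embed k n A =
     uhf_eq k `` {\<lambda>j. if j < n then 0\<^sub>m (k j) (k j) else connecting k n j A}"

section \<open>Tree-refinement algebras\<close>

primrec tree_tower :: "nat pair_pre_digraph \<Rightarrow> (nat \<Rightarrow> nat) \<Rightarrow> nat \<Rightarrow> nat pair_pre_digraph" where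
  "tree_tower G k 0 = G"
| "tree_tower G k (Suc n) = ampliation (k (Suc n) div k n) (tree_tower G k n)"

definition tree_refinement_algebra ::
    "nat pair_pre_digraph \<Rightarrow> (nat \<Rightarrow> nat) \<Rightarrow> uhf_element normed_alg" where
  "tree_refinement_algebra G k = (uhf_algebra k)
     \<lparr> carrier := {x \<in> carrier (uhf_algebra k). \<forall>\<epsilon>>0. \<exists>n. \<exists>A \<in> tree_mats (k n) (tree_tower G k n).
         alg_norm (uhf_algebra k) (x \<ominus>\<^bsub>uhf_algebra k\<^esub> uhf_embed k n A) < \<epsilon>} \<rparr>"

text \<open>
  The algebras above are unital, and a surjective homomorphism preserves the unit automatically, so
  the unit condition that is part of \<open>ring_iso\<close> is no restriction for them.
\<close>

definition isometrically_isomorphic :: "'x normed_alg \<Rightarrow> 'y normed_alg \<Rightarrow> bool" where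
  "isometrically_isomorphic A B \<longleftrightarrow>
     (\<exists>\<phi> \<in> ring_iso A B.
        (\<forall>c. \<forall>x \<in> carrier A. \<phi> (c \<odot>\<^bsub>A\<^esub> x) = c \<odot>\<^bsub>B\<^esub> \<phi> x) \<and>
        (\<forall>x \<in> carrier A. alg_norm B (\<phi> x) = alg_norm A x))"

end

theory Submission
  imports Defs "HOL-Computational_Algebra.Primes"
begin

text \<open>
  If two ampliations are isomorphic, permuting the matrix units accordingly at all late stages is an
  isometric isomorphism of the limit algebras.

  Conversely, an isometric isomorphism \<open>\<Phi>\<close> preserves contractive idempotents.  Such an idempotent is
  self-adjoint, so by triangularity it is a diagonal projection of some finite stage.  Hence \<open>\<Phi>\<close>
  preserves the diagonal projections and the relation \<open>p A q \<noteq> 0\<close> between them, which encodes the tree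
  order.  The image of a matrix unit intertwines the corners of the diagonal at its two ends, so the
  projections of all vertices of \<open>G\<close> have images of the same trace.  Therefore \<open>\<Phi>\<close> matches the leaves
  of \<open>G\<close> with those of the other tree and preserves, relative to the number of vertices, the number of
  common ancestors of two distinct leaves (the number of ancestors of a single leaf can only grow).
  These numbers determine an out-tree up to ampliation.
\<close>

section \<open>Tree orders\<close>

text \<open>An isomorphism of the limit algebras is not given by maps between finite stages, and it
  is not known in advance to respect adjoints or traces. What it yields for a vertex
  \<open>v\<close> of \<open>G\<close> is a set \<open>S v\<close> of indices at some stage
  \<open>N\<close> of the other tower. This set may be scattered over the tree: the transported
  relation only tells whether some index of \<open>S v\<close> lies above a given index. This is why
  the trees are compared through cardinalities and not through an order isomorphism read off from
  \<open>\<Phi>\<close>.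

  That all \<open>S v\<close> have the same size rests on the form of the refinement embeddings: a
  matrix of stage \<open>N\<close>, refined by a factor \<open>r\<close>, joins only indices with
  equal residue modulo \<open>r\<close>. Matching atoms residue by residue compares sizes at stage
  \<open>N\<close>, although the matched projections live at a later stage over which there is no
  control.

  Powers of 2 enter twice. Of two sizes the smaller divides the larger, so that the two towers
  interleave when an isomorphism is built; and a divisor of a power of 2 is again one, which
  produces the exponents \<open>a\<close> and \<open>b\<close>.\<close>

definition covers :: "('a \<Rightarrow> 'a \<Rightarrow> bool) \<Rightarrow> 'a \<Rightarrow> 'a \<Rightarrow> bool" where
  "covers leq x y \<longleftrightarrow> leq x y \<and> x \<noteq> y \<and> (\<forall>z. leq x z \<longrightarrow> leq z y \<longrightarrow> z = x \<or> z = y)"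

text \<open>\<open>leq x y\<close> is to be read as "\<open>x\<close> is an ancestor of
  \<open>y\<close>". By \<open>le_in\<close> the relation is false outside \<open>V\<close>, so that
  down-sets and covers need no relativisation; \<open>le_chain\<close> and \<open>root\<close>
  single out the orders of rooted trees.\<close>

locale tree_order =
  fixes V :: "'a set" and leq :: "'a \<Rightarrow> 'a \<Rightarrow> bool"
  assumes fin: "finite V"
    and le_in: "leq x y \<Longrightarrow> x \<in> V \<and> y \<in> V"
    and le_refl: "x \<in> V \<Longrightarrow> leq x x"
    and le_trans: "leq x y \<Longrightarrow> leq y z \<Longrightarrow> leq x z"
    and le_antisym: "leq x y \<Longrightarrow> leq y x \<Longrightarrow> x = y"
    and le_chain: "leq x z \<Longrightarrow> leq y z \<Longrightarrow> leq x y \<or> leq y x"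
    and root: "\<exists>p\<in>V. \<forall>q\<in>V. leq p q"
begin

text \<open>A chain by \<open>le_chain\<close>. Its cardinality serves as the height of
  \<open>x\<close>, the root having height 1.\<close>

definition down :: "'a \<Rightarrow> 'a set" where
  "down x = {y. leq y x}"

definition leaves :: "'a set" where
  "leaves = {x\<in>V. \<forall>y. leq x y \<longrightarrow> y = x}"

lemma finite_down [simp]: "finite (down x)"
  by (rule finite_subset[OF _ fin]) (auto simp: down_def dest: le_in)

lemma finite_leaves [simp]: "finite leaves"
  using fin by (auto simp: leaves_def)

lemma down_mono: "leq x y \<Longrightarrow> down x \<subseteq> down y"
  by (auto simp: down_def intro: le_trans)

lemma down_mono_strict: "leq x y \<Longrightarrow> x \<noteq> y \<Longrightarrow> down x \<subset> down y"
  using down_mono[of x y] le_refl[of y] le_antisym[of x y] le_in[of x y] by (auto simp: down_def)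

lemma card_down_mono: "leq x y \<Longrightarrow> card (down x) \<le> card (down y)"
  by (intro card_mono down_mono finite_down)

lemma card_down_mono_strict: "leq x y \<Longrightarrow> x \<noteq> y \<Longrightarrow> card (down x) < card (down y)"
  by (rule psubset_card_mono[OF finite_down down_mono_strict])

text \<open>Ancestors of \<open>z\<close> are comparable and the height is strictly monotone, so on
  such a chain the order can be recovered from heights alone.\<close>

lemma le_iff_card_down:
  assumes "leq x z" "leq y z"
  shows "leq x y \<longleftrightarrow> card (down x) \<le> card (down y)"
  using le_chain[OF assms] card_down_mono_strict[of y x] card_down_mono[of x y] le_refl[of x]
    le_in[OF assms(1)] by (cases "x = y") force+

lemma inj_on_card_down: "inj_on (\<lambda>y. card (down y)) (down x)"
proof (rule inj_onI)
  fix y z assume "y \<in> down x" "z \<in> down x" "card (down y) = card (down z)"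
  then show "y = z"
    using le_iff_card_down[of y x z] le_iff_card_down[of z x y] le_antisym[of y z] by (auto simp: down_def)
qed

text \<open>Ancestors of \<open>x\<close> have distinct heights between 1 and the height of
  \<open>x\<close>; there are as many ancestors as such numbers, so every height occurs.\<close>

lemma card_down_image: "(\<lambda>y. card (down y)) ` down x = {1..card (down x)}"
proof (rule card_seteq)
  show "(\<lambda>y. card (down y)) ` down x \<subseteq> {1..card (down x)}"
  proof clarify
    fix y assume "y \<in> down x"
    then have "leq y x" by (simp add: down_def)
    then have "y \<in> down y" using le_refl le_in by (auto simp: down_def)
    then have "1 \<le> card (down y)" using finite_down[of y] by (auto simp: Suc_le_eq card_gt_0_iff simp del: finite_down)
    with card_down_mono[OF \<open>leq y x\<close>] show "card (down y) \<in> {1..card (down x)}" by auto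
  qed
qed (simp_all add: card_image inj_on_card_down)

lemma exists_card_down:
  assumes "1 \<le> t" "t \<le> card (down x)"
  obtains y where "leq y x" "card (down y) = t"
proof -
  have "t \<in> (\<lambda>y. card (down y)) ` down x" using assms card_down_image by auto
  then show thesis using that by (auto simp: down_def)
qed

lemma card_down_pos: "x \<in> V \<Longrightarrow> 1 \<le> card (down x)"
  using card_down_image[of x] le_refl[of x] by (auto simp: down_def)

text \<open>Common ancestors of \<open>a\<close> and \<open>b\<close> form an initial segment of the
  chain below \<open>a\<close>. If \<open>x\<close> were not in it, the segment would lie strictly
  below \<open>x\<close> and be smaller than the height of \<open>x\<close>. Together with
  \<open>card_down_le_common\<close>, the size of the segment decides which ancestors of
  \<open>a\<close> are ancestors of \<open>b\<close>.\<close>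

lemma le_of_card_common:
  assumes "leq x a" "card (down x) \<le> card (down a \<inter> down b)"
  shows "leq x b"
proof (rule ccontr)
  assume "\<not> leq x b"
  have "down a \<inter> down b \<subseteq> down x - {x}"
  proof
    fix y assume y: "y \<in> down a \<inter> down b"
    then have "leq y x \<or> leq x y" using le_chain[of y a x] assms by (auto simp: down_def)
    moreover have "\<not> leq x y" using y le_trans[of x y b] \<open>\<not> leq x b\<close> by (auto simp: down_def)
    ultimately show "y \<in> down x - {x}" by (auto simp: down_def)
  qed
  then have "card (down a \<inter> down b) \<le> card (down x - {x})" by (intro card_mono) auto
  also have "\<dots> < card (down x)"
    using le_refl[of x] le_in[OF assms(1)] finite_down[of x]
    by (intro psubset_card_mono) (auto simp: down_def simp del: finite_down)
  finally show False using assms by simp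
qed

lemma card_down_le_common:
  assumes "leq x a" "leq x b"
  shows "card (down x) \<le> card (down a \<inter> down b)"
  using down_mono[OF assms(1)] down_mono[OF assms(2)] by (intro card_mono) auto

text \<open>Climbing strictly increases the height, which is bounded by the size of
  \<open>V\<close>.\<close>

lemma below_leaf:
  assumes "x \<in> V" obtains a where "a \<in> leaves" "leq x a"
proof -
  have "\<exists>a\<in>leaves. leq x a"
    using assms
  proof (induction "card V - card (down x)" arbitrary: x rule: less_induct)
    case less
    show ?case
    proof (cases "x \<in> leaves")
      case True then show ?thesis using le_refl less.prems by auto
    next
      case False
      then obtain y where y: "leq x y" "y \<noteq> x" using less.prems by (auto simp: leaves_def)
      have "card (down x) < card (down y)" using card_down_mono_strict y by blast
      moreover have "card (down y) \<le> card V"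
        by (rule card_mono[OF fin]) (auto simp: down_def dest: le_in)
      ultimately have "\<exists>a\<in>leaves. leq y a" using less.hyps[of y] le_in[OF y(1)] by auto
      then show ?thesis using y le_trans by blast
    qed
  qed
  with that show thesis by blast
qed

text \<open>By finiteness every interval is filled by covering steps; this is what lets arcs and
  reachability determine each other.\<close>

lemma rtrancl_covers: "leq x y \<longleftrightarrow> x \<in> V \<and> (covers leq)\<^sup>*\<^sup>* x y"
proof
  assume "leq x y"
  then have "(covers leq)\<^sup>*\<^sup>* x y"
  proof (induction "card (down y)" arbitrary: y rule: less_induct)
    case less
    show ?case
    proof (cases "x = y \<or> covers leq x y")
      case False
      then obtain z where z: "leq x z" "leq z y" "z \<noteq> x" "z \<noteq> y"
        using less.prems by (auto simp: covers_def)
      define S where "S = {w. leq x w \<and> leq w y \<and> w \<noteq> y}"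
      have "finite S" by (rule finite_subset[OF _ fin]) (auto simp: S_def dest: le_in)
      moreover have "z \<in> S" using z by (simp add: S_def)
      \<comment> \<open>A highest point of the interval from \<open>x\<close> up to, but excluding,
        \<open>y\<close> is covered by \<open>y\<close>, and the induction hypothesis reaches
        it.\<close>
      ultimately obtain w where w: "w \<in> S" "\<And>u. u \<in> S \<Longrightarrow> card (down u) \<le> card (down w)"
        using finite_has_maximal[of "(\<lambda>u. card (down u)) ` S"]
        by (metis (no_types, lifting) empty_iff finite_imageI imageE image_eqI linorder_le_cases)
      have "covers leq w y" unfolding covers_def
      proof (intro conjI allI impI)
        fix u assume u: "leq w u" "leq u y"
        show "u = w \<or> u = y"
          using w u card_down_mono_strict[of w u] le_trans[of x w u] by (force simp: S_def)
      qed (use w in \<open>auto simp: S_def\<close>)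
      moreover have "(covers leq)\<^sup>*\<^sup>* x w"
        using w card_down_mono_strict[of w y] by (intro less.hyps) (auto simp: S_def)
      ultimately show ?thesis by simp
    qed auto
  qed
  then show "x \<in> V \<and> (covers leq)\<^sup>*\<^sup>* x y" using \<open>leq x y\<close> le_in by blast
next
  assume "x \<in> V \<and> (covers leq)\<^sup>*\<^sup>* x y"
  then have "(covers leq)\<^sup>*\<^sup>* x y" "x \<in> V" by auto
  then show "leq x y"
    by (induction rule: rtranclp_induct) (auto simp: covers_def intro: le_refl le_trans)
qed

end

text \<open>
  The point at height \<open>t\<close> below \<open>a \<in> L\<close> has to go to the point at height \<open>t\<close> below \<open>\<beta> a\<close>.  This map is
  an embedding, hence by cardinality onto, although \<open>\<beta>\<close> is not assumed to preserve heights.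
\<close>

lemma tree_order_iso:
  assumes "tree_order V leq" "tree_order V' leq'"
    and L: "L \<subseteq> V" "\<And>x. x \<in> V \<Longrightarrow> \<exists>a\<in>L. leq x a"
    and \<beta>: "\<beta> ` L \<subseteq> V'"
    and meets: "\<And>a b. a \<in> L \<Longrightarrow> b \<in> L \<Longrightarrow> a \<noteq> b \<Longrightarrow>
      card (tree_order.down leq a \<inter> tree_order.down leq b) =
      card (tree_order.down leq' (\<beta> a) \<inter> tree_order.down leq' (\<beta> b))"
    and heights: "\<And>a. a \<in> L \<Longrightarrow> card (tree_order.down leq a) \<le> card (tree_order.down leq' (\<beta> a))"
    and card: "card V = card V'"
  obtains f where "bij_betw f V V'" "\<And>x y. x \<in> V \<Longrightarrow> y \<in> V \<Longrightarrow> leq x y \<longleftrightarrow> leq' (f x) (f y)"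
proof -
  interpret A: tree_order V leq by fact
  interpret B: tree_order V' leq' by fact
  obtain a where a: "\<And>x. x \<in> V \<Longrightarrow> a x \<in> L" "\<And>x. x \<in> V \<Longrightarrow> leq x (a x)"
    using L(2) by metis
  have "\<exists>z. leq' z (\<beta> (a x)) \<and> card (B.down z) = card (A.down x)" if "x \<in> V" for x
  proof -
    \<comment> \<open>The height inequality enters here: the chain below
      \<open>\<beta> (a x)\<close> is long enough to contain a point at the height of
      \<open>x\<close>.\<close>
    have "card (A.down x) \<le> card (B.down (\<beta> (a x)))"
      using A.card_down_mono[OF a(2)[OF that]] heights[OF a(1)[OF that]] by simp
    then show ?thesis using B.exists_card_down[OF A.card_down_pos[OF that]] by metis
  qed
  then obtain f where f: "\<And>x. x \<in> V \<Longrightarrow> leq' (f x) (\<beta> (a x))"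
      "\<And>x. x \<in> V \<Longrightarrow> card (B.down (f x)) = card (A.down x)"
    by metis
  \<comment> \<open>The choice of \<open>a x\<close> is irrelevant. If \<open>x\<close> is also
    below \<open>b\<close>, the common ancestors of \<open>a x\<close> and \<open>b\<close> reach
    the height of \<open>x\<close>, hence so do those of their images, and \<open>f x\<close> is one
    of the latter.\<close>
  have below: "leq' (f x) (\<beta> b)" if "b \<in> L" "leq x b" for x b
  proof (cases "b = a x")
    case False
    have x: "x \<in> V" using that A.le_in by blast
    show ?thesis
      using B.le_of_card_common[OF f(1)[OF x]] f(2)[OF x] meets[OF a(1)[OF x] that(1)] False
        A.card_down_le_common[OF a(2)[OF x] that(2)] by simp
  qed (use f A.le_in that in blast)
  have iff: "leq x y \<longleftrightarrow> leq' (f x) (f y)" if xy: "x \<in> V" "y \<in> V" for x y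
  proof
    assume "leq x y"
    then have "leq x (a y)" using a(2)[OF xy(2)] A.le_trans by blast
    then show "leq' (f x) (f y)"
      using B.le_iff_card_down[OF below[OF a(1)[OF xy(2)]] f(1)[OF xy(2)]] f(2) xy
        A.card_down_mono[OF \<open>leq x y\<close>] by simp
  next
    assume fxy: "leq' (f x) (f y)"
    have "leq x (a y)"
    proof (cases "a x = a y")
      case False
      have "leq' (f x) (\<beta> (a y))" using fxy f(1)[OF xy(2)] B.le_trans by blast
      then have "card (A.down x) \<le> card (A.down (a x) \<inter> A.down (a y))"
        using B.card_down_le_common[OF f(1)[OF xy(1)]] f(2) xy meets[OF a(1) a(1) False] by simp
      then show ?thesis using A.le_of_card_common[OF a(2)[OF xy(1)]] by blast
    qed (use a(2)[OF xy(1)] in simp)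
    then show "leq x y"
      using A.le_iff_card_down[OF _ a(2)[OF xy(2)]] B.card_down_mono[OF fxy] f(2) xy by simp
  qed
  have inj: "inj_on f V"
    by (rule inj_onI) (metis iff A.le_antisym A.le_refl)
  moreover have "f ` V \<subseteq> V'" using f(1) B.le_in by blast
  ultimately have "f ` V = V'"
    using card by (metis B.fin card_image card_subset_eq)
  then show thesis using that inj iff by (auto simp: bij_betw_def)
qed

section \<open>Out-trees and their ampliations as Hasse diagrams of tree orders\<close>

definition hasse :: "'a pair_pre_digraph \<Rightarrow> ('a \<Rightarrow> 'a \<Rightarrow> bool) \<Rightarrow> bool" where
  "hasse G leq \<longleftrightarrow> tree_order (pverts G) leq \<and> parcs G = {(u, v). covers leq u v}"

lemma hasse_wf: "hasse G leq \<Longrightarrow> wf_digraph (with_proj G)"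
  by (auto simp: hasse_def wf_digraph_def covers_def dest: tree_order.le_in)

text \<open>Reachability is the reflexive transitive closure of the covering relation, except that
  it is reflexive on vertices only; the order has the same restriction.\<close>

lemma hasse_reachable:
  assumes "hasse G leq"
  shows "u \<rightarrow>\<^sup>*\<^bsub>with_proj G\<^esub> v \<longleftrightarrow> leq u v"
proof -
  interpret tree_order "pverts G" leq using assms by (simp add: hasse_def)
  interpret W: wf_digraph "with_proj G" by (rule hasse_wf[OF assms])
  have "u \<rightarrow>\<^sup>*\<^bsub>with_proj G\<^esub> v \<longleftrightarrow> u \<in> pverts G \<and> (covers leq)\<^sup>*\<^sup>* u v"
  proof
    assume r: "u \<rightarrow>\<^sup>*\<^bsub>with_proj G\<^esub> v"
    then have "(u, v) \<in> (arcs_ends (with_proj G))\<^sup>*" by (rule reachable_rtranclI)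
    then have "(covers leq)\<^sup>*\<^sup>* u v"
      using assms by (simp add: hasse_def arcs_ends_def rtrancl_def arc_to_ends_def)
    then show "u \<in> pverts G \<and> (covers leq)\<^sup>*\<^sup>* u v" using W.reachable_in_verts[OF r] by simp
  next
    assume h: "u \<in> pverts G \<and> (covers leq)\<^sup>*\<^sup>* u v"
    then have "(covers leq)\<^sup>*\<^sup>* u v" by simp
    then show "u \<rightarrow>\<^sup>*\<^bsub>with_proj G\<^esub> v"
    proof (induction rule: rtranclp_induct)
      case base then show ?case using h by (simp add: reachable_def)
    next
      case (step y z)
      then have "(y, z) \<in> arcs_ends (with_proj G)"
        using assms by (auto simp: hasse_def arcs_ends_def arc_to_ends_def)
      then show ?case using step W.reachable_adj_trans by blast
    qed
  qed
  then show ?thesis using rtrancl_covers by simp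
qed

text \<open>Everything follows from uniqueness of walks from the root: a cycle could be appended to
  a walk, two ancestors of a vertex lie on the one walk leading to it, and an arc that skips an
  intermediate vertex would give a second walk.\<close>

lemma out_tree_hasse:
  assumes "out_tree G"
  shows "hasse G (\<lambda>u v. u \<rightarrow>\<^sup>*\<^bsub>with_proj G\<^esub> v)"
proof -
  interpret pair_digraph G using assms by (simp add: out_tree_def)
  obtain p where p: "p \<in> pverts G" and ex1: "\<And>q. q \<in> pverts G \<Longrightarrow> q \<noteq> p \<Longrightarrow> \<exists>!w. awalk p w q"
    using assms by (auto simp: out_tree_def)
  have uniq: "w = w'" if "awalk p w q" "awalk p w' q" "q \<noteq> p" for q w w'
    using ex1[of q] that awalk_last_in_verts[of p w q] by auto
  have root: "p \<rightarrow>\<^sup>*\<^bsub>with_proj G\<^esub> q" if "q \<in> pverts G" for q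
    using ex1[of q] that p by (cases "q = p") (auto simp: reachable_awalk awalk_Nil_iff intro: exI[of _ "[]"])
  have no_cycle: "False" if c: "awalk u c u" "c \<noteq> []" "u \<noteq> p" for u c
  proof -
    obtain w where w: "awalk p w u"
      using root[of u] awalk_last_in_verts[OF c(1)] by (auto simp: reachable_awalk)
    have "awalk p (w @ c) u" using w c by auto
    from uniq[OF this w c(3)] c(2) show False by simp
  qed
  have antisym: "u = v" if uv: "u \<rightarrow>\<^sup>*\<^bsub>with_proj G\<^esub> v" "v \<rightarrow>\<^sup>*\<^bsub>with_proj G\<^esub> u" for u v
  proof (rule ccontr)
    assume ne: "u \<noteq> v"
    obtain c d where cd: "awalk u c v" "awalk v d u" using uv by (auto simp: reachable_awalk)
    then have "c \<noteq> []" "d \<noteq> []" using ne by (auto simp: awalk_Nil_iff)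
    \<comment> \<open>Uniqueness is assumed for endpoints other than the root only, so a cycle
      through \<open>p\<close> is started at its other vertex.\<close>
    then show False
      using no_cycle[of u "c @ d"] no_cycle[of v "d @ c"] cd ne by (cases "u = p") auto
  qed
  have chain: "x \<rightarrow>\<^sup>*\<^bsub>with_proj G\<^esub> y \<or> y \<rightarrow>\<^sup>*\<^bsub>with_proj G\<^esub> x" if xy: "x \<rightarrow>\<^sup>*\<^bsub>with_proj G\<^esub> z" "y \<rightarrow>\<^sup>*\<^bsub>with_proj G\<^esub> z" for x y z
  proof (cases "z = p")
    case True
    then have "x = p" using xy root[of x] antisym[of x p] reachable_in_verts by auto
    then show ?thesis using root[of y] xy reachable_in_verts by auto
  next
    case False
    obtain w1 w2 w3 w4 where w: "awalk p w1 x" "awalk x w2 z" "awalk p w3 y" "awalk y w4 z"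
      using xy root[OF reachable_in_verts(1)[OF xy(1), simplified]]
        root[OF reachable_in_verts(1)[OF xy(2), simplified]] unfolding reachable_awalk by blast
    \<comment> \<open>Both walks from the root to \<open>z\<close> are the same list, so one of
      \<open>w1\<close> and \<open>w3\<close> is a prefix of the other, and the remainder joins
      \<open>x\<close> and \<open>y\<close>.\<close>
    then have "w1 @ w2 = w3 @ w4" using uniq[of "w1 @ w2" z "w3 @ w4"] False by auto
    then obtain us where "w1 = w3 @ us \<or> w3 = w1 @ us"
      by (auto simp: append_eq_append_conv2)
    then show ?thesis
    proof
      assume us: "w1 = w3 @ us"
      have "awlast p w3 = y" using w(3) by simp
      moreover have "awalk p (w3 @ us) x" using w(1) unfolding us .
      ultimately have "awalk y us x" by simp
      then show ?thesis by (auto simp: reachable_awalk)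
    next
      assume us: "w3 = w1 @ us"
      have "awlast p w1 = x" using w(1) by simp
      moreover have "awalk p (w1 @ us) y" using w(3) unfolding us .
      ultimately have "awalk x us y" by simp
      then show ?thesis by (auto simp: reachable_awalk)
    qed
  qed
  have arcs_iff: "(u, v) \<in> parcs G \<longleftrightarrow> covers (\<lambda>u v. u \<rightarrow>\<^sup>*\<^bsub>with_proj G\<^esub> v) u v" for u v
    proof
      assume e: "(u, v) \<in> parcs G"
      then have uv: "u \<rightarrow>\<^sup>*\<^bsub>with_proj G\<^esub> v" "u \<noteq> v" using no_loops[OF e] by auto
      have arc: "awalk u [(u, v)] v" using e by (auto simp: awalk_def dest: wellformed)
      have "z = u \<or> z = v" if z: "u \<rightarrow>\<^sup>*\<^bsub>with_proj G\<^esub> z" "z \<rightarrow>\<^sup>*\<^bsub>with_proj G\<^esub> v" for z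
      proof (cases "v = p")
        case True
        then show ?thesis using uv root[of u] antisym[of u v] reachable_in_verts by auto
      next
        case False
        obtain w1 w2 w3 where w: "awalk p w1 u" "awalk u w2 z" "awalk z w3 v"
          using z root[OF reachable_in_verts(1)[OF uv(1), simplified]] unfolding reachable_awalk by blast
        \<comment> \<open>The detour through \<open>z\<close> has the length of a single arc, so one
          of its two pieces is empty.\<close>
        then have "w1 @ w2 @ w3 = w1 @ [(u, v)]"
          using uniq[of "w1 @ w2 @ w3" v "w1 @ [(u,v)]"] arc False by auto
        then have "w2 = [] \<or> w3 = []" by (cases w2) auto
        then show ?thesis using w by (auto simp: awalk_Nil_iff)
      qed
      then show "covers (\<lambda>u v. u \<rightarrow>\<^sup>*\<^bsub>with_proj G\<^esub> v) u v" using uv by (auto simp: covers_def)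
    next
      assume c: "covers (\<lambda>u v. u \<rightarrow>\<^sup>*\<^bsub>with_proj G\<^esub> v) u v"
      then obtain w where w: "awalk u w v" unfolding covers_def reachable_awalk by blast
      have "w \<noteq> []" using w c unfolding covers_def by (metis awalk_Nil_iff)
      then obtain e w' where e: "awalk u (e # w') v" using w by (metis list.exhaust)
      \<comment> \<open>The first arc of a nonempty walk ends between \<open>u\<close> and
        \<open>v\<close>; since it is no loop, the covering condition makes it end at
        \<open>v\<close>.\<close>
      obtain z where z: "(u, z) \<in> parcs G" "awalk z w' v"
        using e unfolding awalk_Cons_iff by (cases e) force
      have "u \<noteq> z" using no_loops[OF z(1)] by simp
      moreover have "u \<rightarrow>\<^sup>*\<^bsub>with_proj G\<^esub> z" using z(1) by auto
      moreover have "z \<rightarrow>\<^sup>*\<^bsub>with_proj G\<^esub> v" using z(2) by (rule reachable_awalkI)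
      moreover have "\<forall>z. u \<rightarrow>\<^sup>*\<^bsub>with_proj G\<^esub> z \<longrightarrow> z \<rightarrow>\<^sup>*\<^bsub>with_proj G\<^esub> v \<longrightarrow> z = u \<or> z = v"
        by (rule c[unfolded covers_def, THEN conjunct2, THEN conjunct2])
      ultimately have "z = v" by iprover
      then show "(u, v) \<in> parcs G" using z(1) by simp
    qed
  have "parcs G = {(u, v). covers (\<lambda>u v. u \<rightarrow>\<^sup>*\<^bsub>with_proj G\<^esub> v) u v}"
    using arcs_iff by auto
  moreover have "tree_order (pverts G) (\<lambda>u v. u \<rightarrow>\<^sup>*\<^bsub>with_proj G\<^esub> v)"
  proof (unfold tree_order_def, intro conjI allI impI)
    show "\<exists>p\<in>pverts G. \<forall>q\<in>pverts G. p \<rightarrow>\<^sup>*\<^bsub>with_proj G\<^esub> q" using p root by (intro bexI[of _ p] ballI)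
  next
    fix x y z assume "x \<rightarrow>\<^sup>*\<^bsub>with_proj G\<^esub> y" "y \<rightarrow>\<^sup>*\<^bsub>with_proj G\<^esub> z" then show "x \<rightarrow>\<^sup>*\<^bsub>with_proj G\<^esub> z" by (rule reachable_trans)
  next
    fix x y assume "x \<rightarrow>\<^sup>*\<^bsub>with_proj G\<^esub> y" "y \<rightarrow>\<^sup>*\<^bsub>with_proj G\<^esub> x" then show "x = y" by (rule antisym)
  next
    fix x y z assume "x \<rightarrow>\<^sup>*\<^bsub>with_proj G\<^esub> z" "y \<rightarrow>\<^sup>*\<^bsub>with_proj G\<^esub> z" then show "x \<rightarrow>\<^sup>*\<^bsub>with_proj G\<^esub> y \<or> y \<rightarrow>\<^sup>*\<^bsub>with_proj G\<^esub> x" by (rule chain)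
  next
    fix x y assume "x \<rightarrow>\<^sup>*\<^bsub>with_proj G\<^esub> y"
    from reachable_in_verts[OF this] show "x \<in> pverts G" "y \<in> pverts G" by simp_all
  qed simp_all
  ultimately show ?thesis by (simp add: hasse_def)
qed

text \<open>Each vertex becomes a block of \<open>m\<close> consecutive indices, which is a chain in
  the numerical order; distinct blocks compare as their vertices do. In this lexicographic form
  iterated ampliations compose to one.\<close>

definition amp_le :: "nat \<Rightarrow> (nat \<Rightarrow> nat \<Rightarrow> bool) \<Rightarrow> nat \<Rightarrow> nat \<Rightarrow> bool" where
  "amp_le m leq x y \<longleftrightarrow> leq (x div m) (y div m) \<and> (x div m = y div m \<longrightarrow> x \<le> y)"

lemma amp_le_1 [simp]: "amp_le (Suc 0) leq = leq"
  by (auto simp: amp_le_def fun_eq_iff)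

lemma amp_le_amp_le: "amp_le m' (amp_le m leq) = amp_le (m * m') leq"
proof (intro ext)
  fix x y
  have "x div m' \<le> y div m'" if "x \<le> y" using that by (rule div_le_mono)
  moreover have "x div m' < y div m' \<Longrightarrow> x \<le> y" using div_le_mono[of y x m'] by linarith
  ultimately show "amp_le m' (amp_le m leq) x y = amp_le (m * m') leq x y"
    by (auto simp: amp_le_def div_mult2_eq mult.commute[of m] le_less)
qed

lemma tree_order_amp_le:
  assumes "tree_order V leq" "0 < m"
  shows "tree_order {x. x div m \<in> V} (amp_le m leq)"
proof -
  interpret tree_order V leq by fact
  have "{x. x div m \<in> V} \<subseteq> (\<Union>i\<in>V. {i * m..<i * m + m})"
  proof
    fix x assume "x \<in> {x. x div m \<in> V}"
    moreover have "x \<in> {x div m * m..<x div m * m + m}"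
      using div_times_less_eq_dividend[of x m] dividend_less_div_times[OF \<open>0 < m\<close>, of x]
      by (simp add: add.commute)
    ultimately show "x \<in> (\<Union>i\<in>V. {i * m..<i * m + m})" by blast
  qed
  then have "finite {x. x div m \<in> V}" by (rule finite_subset) (use fin in auto)
  moreover obtain p where p: "p \<in> V" "\<And>q. q \<in> V \<Longrightarrow> leq p q" using root by blast
  have "amp_le m leq (p * m) x" if "x div m \<in> V" for x
    using p \<open>0 < m\<close> that by (auto simp: amp_le_def)
  then have "\<exists>p\<in>{x. x div m \<in> V}. \<forall>q\<in>{x. x div m \<in> V}. amp_le m leq p q"
    using p \<open>0 < m\<close> by (intro bexI[of _ "p * m"]) auto
  ultimately show ?thesis
  proof unfold_locales
    fix x y z
    show "amp_le m leq x y \<Longrightarrow> x \<in> {x. x div m \<in> V} \<and> y \<in> {x. x div m \<in> V}"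
      using le_in by (auto simp: amp_le_def)
    show "x \<in> {x. x div m \<in> V} \<Longrightarrow> amp_le m leq x x" by (simp add: amp_le_def le_refl)
    show "amp_le m leq x y \<Longrightarrow> amp_le m leq y z \<Longrightarrow> amp_le m leq x z"
      unfolding amp_le_def by (metis le_antisym le_trans order_trans)
    show "amp_le m leq x y \<Longrightarrow> amp_le m leq y x \<Longrightarrow> x = y"
      unfolding amp_le_def by (metis le_antisym order_antisym)
    show "amp_le m leq x z \<Longrightarrow> amp_le m leq y z \<Longrightarrow> amp_le m leq x y \<or> amp_le m leq y x"
      unfolding amp_le_def by (metis le_chain nat_le_linear)
  qed
qed

lemma pverts_ampliation:
  assumes "0 < m"
  shows "pverts (ampliation m G) = {x. x div m \<in> pverts G}"
proof -
  have "\<exists>i s. x = i * m + s \<and> i \<in> pverts G \<and> s < m" if "x div m \<in> pverts G" for x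
    using that assms by (intro exI[of _ "x div m"] exI[of _ "x mod m"]) simp
  then show ?thesis by (auto simp: ampliation_def)
qed

lemma mult_add_div [simp]: "(s::nat) < m \<Longrightarrow> (i * m + s) div m = i"
  by simp

text \<open>The lexicographic order has two kinds of covering pairs, neighbours within a block, and
  the last index of a block with the first index of a block covering it. These are the two sets of
  arcs of \<open>ampliation\<close>.\<close>

lemma hasse_ampliation:
  assumes G: "hasse G leq" and m: "0 < m"
  shows "hasse (ampliation m G) (amp_le m leq)"
proof -
  interpret tree_order "pverts G" leq using G by (simp add: hasse_def)
  have arc: "(j, i) \<in> parcs G \<longleftrightarrow> covers leq j i" for i j using G by (simp add: hasse_def)
  interpret A: tree_order "pverts (ampliation m G)" "amp_le m leq"
    unfolding pverts_ampliation[OF m] by (rule tree_order_amp_le[OF _ m]) unfold_locales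
  have "covers (amp_le m leq) x y" if xy: "(x, y) \<in> parcs (ampliation m G)" for x y
  proof -
    consider i s where "x = i * m + s" "y = i * m + Suc s" "i \<in> pverts G" "Suc s < m"
      | i j where "x = j * m + (m - 1)" "y = i * m" "covers leq j i"
      using xy arc by (auto simp: ampliation_def)
    then show ?thesis
    proof cases
      case 1
      then have dv: "x div m = i" "y div m = i" "y = Suc x"
        using mult_add_div[of s m i] mult_add_div[of "Suc s" m i] by simp_all
      show ?thesis unfolding covers_def
      proof (intro conjI allI impI)
        fix z assume z: "amp_le m leq x z" "amp_le m leq z y"
        then have "leq i (z div m)" "leq (z div m) i" using dv by (simp_all add: amp_le_def)
        then have "i = z div m" by (rule le_antisym)
        then show "z = x \<or> z = y" using z dv by (auto simp: amp_le_def)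
      qed (use dv 1 le_refl in \<open>auto simp: amp_le_def\<close>)
    next
      case 2
      then have dv: "x div m = j" "y div m = i" using m mult_add_div[of "m - 1" m j] by simp_all
      have ji: "leq j i" "j \<noteq> i" using 2 by (auto simp: covers_def)
      show ?thesis unfolding covers_def
      proof (intro conjI allI impI)
        fix z assume z: "amp_le m leq x z" "amp_le m leq z y"
        \<comment> \<open>No block lies strictly between \<open>j\<close> and \<open>i\<close>. In
          block \<open>j\<close> nothing follows \<open>x\<close>, and in block \<open>i\<close>
          nothing precedes \<open>y\<close>.\<close>
        then have "z div m = j \<or> z div m = i" using dv 2 by (auto simp: amp_le_def covers_def)
        then show "z = x \<or> z = y"
        proof
          assume zj: "z div m = j"
          then have "x \<le> z" using z dv by (simp add: amp_le_def)
          moreover have "z < j * m + m" using zj m by (metis dividend_less_div_times add.commute)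
          ultimately show ?thesis using 2 m by auto
        next
          assume zi: "z div m = i"
          then have "z \<le> y" using z dv by (simp add: amp_le_def)
          moreover have "i * m \<le> z" using zi by (metis div_times_less_eq_dividend)
          ultimately show ?thesis using 2 by auto
        qed
      qed (use dv ji in \<open>auto simp: amp_le_def\<close>)
    qed
  qed
  moreover have "(x, y) \<in> parcs (ampliation m G)" if c: "covers (amp_le m leq) x y" for x y
  proof -
    have xy: "amp_le m leq x y" "x \<noteq> y"
      and cov: "\<And>z. amp_le m leq x z \<Longrightarrow> amp_le m leq z y \<Longrightarrow> z = x \<or> z = y"
      using c by (auto simp: covers_def)
    define j i where "j = x div m" and "i = y div m"
    have ji: "leq j i" using xy by (simp add: amp_le_def j_def i_def)
    have V: "i \<in> pverts G" "j \<in> pverts G" using ji le_in by auto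
    have x: "x = j * m + x mod m" and y: "y = i * m + y mod m" by (simp_all add: j_def i_def)
    have sm: "x mod m < m" "y mod m < m" using m by auto
    show ?thesis
    proof (cases "j = i")
      case True
      then have "x < y" using xy by (simp add: amp_le_def j_def i_def)
      have "y = j * m + y mod m" using y True by simp
      then have less: "Suc (x mod m) < m" using x \<open>x < y\<close> sm by linarith
      have "Suc x = j * m + Suc (x mod m)" using x by linarith
      then have "Suc x div m = j" using less by (metis mult_add_div)
      then have "amp_le m leq x (Suc x)" "amp_le m leq (Suc x) y"
        using \<open>x < y\<close> V True le_refl by (simp_all add: amp_le_def j_def[symmetric] i_def[symmetric])
      then have "Suc x = x \<or> Suc x = y" by (rule cov)
      then have "Suc x = y" by simp
      then have "(x, y) = (j * m + x mod m, j * m + Suc (x mod m))" using x by auto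
      then show ?thesis using less V by (auto simp: ampliation_def)
    next
      case False
      have "x mod m = m - 1"
      proof (rule ccontr)
        assume "x mod m \<noteq> m - 1"
        \<comment> \<open>If \<open>x\<close> were not the last index of its block, its successor
          would lie strictly between \<open>x\<close> and \<open>y\<close>; the predecessor of
          \<open>y\<close> plays the same part below.\<close>
        then have less: "Suc (x mod m) < m" using sm by linarith
        have "Suc x = j * m + Suc (x mod m)" using x by linarith
        then have "Suc x div m = j" using less by (metis mult_add_div)
        then have "amp_le m leq x (Suc x)" "amp_le m leq (Suc x) y"
          using ji V False le_refl by (simp_all add: amp_le_def j_def[symmetric] i_def[symmetric])
        then have "Suc x = x \<or> Suc x = y" by (rule cov)
        then show False using \<open>Suc x div m = j\<close> False i_def by auto
      qed
      moreover have "y mod m = 0"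
      proof (rule ccontr)
        assume "y mod m \<noteq> 0"
        then have "y - 1 = i * m + (y mod m - 1)" using y by linarith
        then have "(y - 1) div m = i" using sm by (metis mult_add_div less_imp_diff_less)
        then have "amp_le m leq x (y - 1)" "amp_le m leq (y - 1) y"
          using ji V False le_refl by (simp_all add: amp_le_def j_def[symmetric] i_def[symmetric])
        then have "y - 1 = x \<or> y - 1 = y" by (rule cov)
        moreover have "y \<noteq> 0" using \<open>y mod m \<noteq> 0\<close> by (cases y) simp_all
        ultimately show False using \<open>(y - 1) div m = i\<close> False j_def by auto
      qed
      moreover have "covers leq j i" unfolding covers_def
      proof (intro conjI allI impI)
        fix z assume z: "leq j z" "leq z i"
        show "z = j \<or> z = i"
        proof (rule ccontr)
          assume h: "\<not> (z = j \<or> z = i)"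
          \<comment> \<open>A vertex strictly between \<open>j\<close> and \<open>i\<close> would
            put the first index of its block strictly between \<open>x\<close> and
            \<open>y\<close>.\<close>
          have "(z * m) div m = z" using m by simp
          then have "z * m = x \<or> z * m = y"
            using z h by (intro cov) (auto simp: amp_le_def j_def[symmetric] i_def[symmetric])
          then show False using \<open>z * m div m = z\<close> h j_def i_def by auto
        qed
      qed (use ji False in auto)
      ultimately show ?thesis using x y arc by (auto simp: ampliation_def)
    qed
  qed
  ultimately have "parcs (ampliation m G) = {(x, y). covers (amp_le m leq) x y}" by auto
  then show ?thesis by (simp add: hasse_def A.tree_order_axioms)
qed

lemma div_mem_lessThan: "0 < m \<Longrightarrow> {x. x div m \<in> {..<k}} = {..<k * m}" for k :: nat
  by (auto simp: less_mult_imp_div_less div_less_iff_less_mult)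

text \<open>Since ampliations compose, the order at stage \<open>n\<close> is a single ampliation of
  the original order, which replaces the recursion of \<open>tree_tower\<close> by a
  formula.\<close>

lemma hasse_tree_tower:
  assumes "hasse G leq" "pverts G = {..<k 0}" "\<And>n. 0 < k n" "\<And>n. k n dvd k (Suc n)"
  shows "hasse (tree_tower G k n) (amp_le (k n div k 0) leq) \<and> pverts (tree_tower G k n) = {..<k n} \<and> k 0 dvd k n"
proof (induction n)
  case 0
  have "k 0 div k 0 = Suc 0" using assms(3)[of 0] by simp
  then show ?case using assms by simp
next
  case (Suc n)
  define m where "m = k (Suc n) div k n"
  have km: "k (Suc n) = k n * m" using assms(4)[of n] by (simp add: m_def)
  have m: "0 < m" using assms(3)[of "Suc n"] km by (cases m) auto
  have "k (Suc n) div k 0 = k n div k 0 * m" using Suc.IH by (simp add: km div_mult_swap mult.commute)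
  then have "amp_le m (amp_le (k n div k 0) leq) = amp_le (k (Suc n) div k 0) leq"
    by (simp add: amp_le_amp_le)
  moreover have "hasse (ampliation m (tree_tower G k n)) (amp_le m (amp_le (k n div k 0) leq))"
    using hasse_ampliation[OF _ m] Suc.IH by blast
  moreover have "pverts (ampliation m (tree_tower G k n)) = {..<k n * m}"
    using Suc.IH by (simp only: pverts_ampliation[OF m] div_mem_lessThan[OF m])
  ultimately show ?case
    using Suc.IH by (simp add: m_def[symmetric]) (simp add: km)
qed

section \<open>Digraph isomorphisms as order isomorphisms\<close>

lemma digraph_iso_imp_order_iso:
  fixes G :: "'a pair_pre_digraph" and H :: "'b pair_pre_digraph"
  assumes "hasse G leq" "hasse H leq'" "digraph_iso (with_proj G) (with_proj H)"
  obtains f where "bij_betw f (pverts G) (pverts H)"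
    "\<And>x y. x \<in> pverts G \<Longrightarrow> y \<in> pverts G \<Longrightarrow> leq x y \<longleftrightarrow> leq' (f x) (f y)"
proof -
  interpret wf_digraph "with_proj G" by (rule hasse_wf[OF assms(1)])
  obtain h where h: "digraph_isomorphism h" "with_proj H = app_iso h (with_proj G)"
    using assms(3) by (auto simp: digraph_iso_def)
  have "pverts H = iso_verts h ` pverts G" using h(2) by (metis verts_app_iso with_proj_simps(1))
  then have "bij_betw (iso_verts h) (pverts G) (pverts H)"
    using digraph_isomorphism_inj_on_verts[OF h(1)] by (simp add: bij_betw_def)
  moreover have "leq x y \<longleftrightarrow> leq' (iso_verts h x) (iso_verts h y)"
    if "x \<in> pverts G" "y \<in> pverts G" for x y
    using reachable_app_iso_eq[OF h(1), of "iso_verts h x" "iso_verts h y"] that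
    by (simp add: iso_verts_inv_iso[OF h(1)] h(2)[symmetric] hasse_reachable[OF assms(1)] hasse_reachable[OF assms(2)])
  ultimately show thesis by (rule that)
qed

text \<open>An order isomorphism preserves covering pairs, and these are the arcs; as arcs are pairs
  of vertices, the vertex map dictates the arc map.\<close>

lemma order_iso_imp_digraph_iso:
  fixes G :: "'a pair_pre_digraph" and H :: "'b pair_pre_digraph"
  assumes "hasse G leq" "hasse H leq'" "bij_betw f (pverts G) (pverts H)"
    and iff: "\<And>x y. x \<in> pverts G \<Longrightarrow> y \<in> pverts G \<Longrightarrow> leq x y \<longleftrightarrow> leq' (f x) (f y)"
  shows "digraph_iso (with_proj G) (with_proj H)"
proof -
  interpret A: tree_order "pverts G" leq using assms(1) by (simp add: hasse_def)
  interpret B: tree_order "pverts H" leq' using assms(2) by (simp add: hasse_def)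
  define h where "h = \<lparr>iso_verts = f, iso_arcs = map_prod f f, iso_head = snd, iso_tail = fst\<rparr>"
  have inj: "inj_on f (pverts G)" and im: "f ` pverts G = pverts H"
    using assms(3) by (auto simp: bij_betw_def)
  have covers_iff: "covers leq x y \<longleftrightarrow> covers leq' (f x) (f y)" if "x \<in> pverts G" "y \<in> pverts G" for x y
  proof -
    have "(\<forall>z. leq x z \<longrightarrow> leq z y \<longrightarrow> z = x \<or> z = y) \<longleftrightarrow>
        (\<forall>z\<in>pverts G. leq x z \<longrightarrow> leq z y \<longrightarrow> z = x \<or> z = y)" using A.le_in by blast
    also have "\<dots> \<longleftrightarrow> (\<forall>z\<in>pverts G. leq' (f x) (f z) \<longrightarrow> leq' (f z) (f y) \<longrightarrow> f z = f x \<or> f z = f y)"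
      using that iff inj by (intro ball_cong refl) (auto simp: inj_on_eq_iff)
    also have "\<dots> \<longleftrightarrow> (\<forall>z\<in>f ` pverts G. leq' (f x) z \<longrightarrow> leq' z (f y) \<longrightarrow> z = f x \<or> z = f y)"
      by simp
    also have "\<dots> \<longleftrightarrow> (\<forall>z. leq' (f x) z \<longrightarrow> leq' z (f y) \<longrightarrow> z = f x \<or> z = f y)"
      unfolding im using B.le_in by blast
    finally show ?thesis using that iff inj by (simp add: covers_def inj_on_eq_iff)
  qed
  have sub: "parcs G \<subseteq> pverts G \<times> pverts G"
    using assms(1) A.le_in by (auto simp: hasse_def covers_def)
  have arcs: "parcs H = map_prod f f ` parcs G"
  proof (intro equalityI subsetI)
    fix e assume e: "e \<in> parcs H"
    obtain u v where uv: "e = (u, v)" by (cases e)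
    then have c: "covers leq' u v" using e assms(2) by (auto simp: hasse_def)
    then have "u \<in> f ` pverts G" "v \<in> f ` pverts G" using B.le_in im by (auto simp: covers_def)
    then obtain x y where xy: "x \<in> pverts G" "y \<in> pverts G" "u = f x" "v = f y" by blast
    then have "(x, y) \<in> parcs G" using c covers_iff assms(1) by (simp add: hasse_def)
    then show "e \<in> map_prod f f ` parcs G" using uv xy by force
  next
    fix e assume "e \<in> map_prod f f ` parcs G"
    then obtain x y where xy: "(x, y) \<in> parcs G" "e = (f x, f y)" by auto
    then show "e \<in> parcs H" using covers_iff[of x y] sub assms(1,2) by (auto simp: hasse_def)
  qed
  have "pre_digraph.digraph_isomorphism (with_proj G) h"
    using inj hasse_wf[OF assms(1)] sub map_prod_inj_on[OF inj inj]
    by (auto simp: pre_digraph.digraph_isomorphism_def h_def intro: inj_on_subset)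
  moreover have "with_proj H = app_iso h (with_proj G)"
    using im arcs by (simp add: app_iso_def h_def with_proj_def)
  ultimately show ?thesis by (auto simp: digraph_iso_def)
qed

section \<open>Operator norm of complex matrices\<close>

lemma sum_lessThan_mult: "(\<Sum>r<K * m. f r) = (\<Sum>t<K. \<Sum>s<m. f (t * m + s :: nat))" for f :: "nat \<Rightarrow> 'a :: comm_monoid_add"
proof (induction K)
  case (Suc K)
  have "{..<Suc K * m} = {..<K * m} \<union> {K * m..<K * m + m}" by auto
  then have "(\<Sum>r<Suc K * m. f r) = (\<Sum>r<K * m. f r) + (\<Sum>r=K * m..<K * m + m. f r)"
    by (simp add: sum.union_disjoint ivl_disj_int)
  also have "(\<Sum>r=K * m..<K * m + m. f r) = (\<Sum>s<m. f (K * m + s))"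
    by (rule sum.reindex_bij_witness[of _ "\<lambda>s. K * m + s" "\<lambda>r. r - K * m"]) auto
  finally show ?case using Suc by simp
qed simp

lemma vec_norm2_nonneg [simp]: "0 \<le> vec_norm2 v"
  by (simp add: vec_norm2_def)

lemma vec_norm2_sq: "(vec_norm2 v)\<^sup>2 = (\<Sum>i<dim_vec v. (cmod (v $ i))\<^sup>2)"
  by (simp add: vec_norm2_def L2_set_def sum_nonneg)

lemma vec_norm2_smult [simp]: "vec_norm2 (c \<cdot>\<^sub>v v) = cmod c * vec_norm2 v"
proof -
  have "(vec_norm2 (c \<cdot>\<^sub>v v))\<^sup>2 = (cmod c * vec_norm2 v)\<^sup>2"
    by (simp add: vec_norm2_sq norm_mult power_mult_distrib sum_distrib_left)
  then show ?thesis by (simp add: power2_eq_iff_nonneg)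
qed

lemma vec_norm2_triangle:
  assumes "v \<in> carrier_vec n" "w \<in> carrier_vec n"
  shows "vec_norm2 (v + w) \<le> vec_norm2 v + vec_norm2 w"
proof -
  have "vec_norm2 (v + w) \<le> L2_set (\<lambda>i. cmod (v $ i) + cmod (w $ i)) {..<n}"
    using assms by (auto simp: vec_norm2_def intro!: L2_set_mono norm_triangle_ineq)
  also have "\<dots> \<le> vec_norm2 v + vec_norm2 w"
    using assms L2_set_triangle_ineq[of "\<lambda>i. cmod (v $ i)" "\<lambda>i. cmod (w $ i)" "{..<n}"] by (simp add: vec_norm2_def)
  finally show ?thesis .
qed

lemma cmod_le_vec_norm2: "i < dim_vec v \<Longrightarrow> cmod (v $ i) \<le> vec_norm2 v"
  unfolding vec_norm2_def by (rule member_le_L2_set) auto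

lemma vec_norm2_zero [simp]: "vec_norm2 (0\<^sub>v n) = 0"
  by (simp add: vec_norm2_def L2_set_def)

lemma vec_norm2_unit [simp]: "i < n \<Longrightarrow> vec_norm2 (unit_vec n i) = 1"
proof -
  assume "i < n"
  have "(vec_norm2 (unit_vec n i))\<^sup>2 = (\<Sum>j<n. if j = i then 1 else 0)"
    unfolding vec_norm2_sq using \<open>i < n\<close> by (intro sum.cong) auto
  also have "\<dots> = 1" using \<open>i < n\<close> by simp
  finally show ?thesis using vec_norm2_nonneg[of "unit_vec n i"] by (simp add: power2_eq_1_iff)
qed

lemma mult_mat_vec_nth:
  "A \<in> carrier_mat n m \<Longrightarrow> v \<in> carrier_vec m \<Longrightarrow> i < n \<Longrightarrow> (A *\<^sub>v v) $ i = (\<Sum>j<m. A $$ (i, j) * v $ j)"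
  by (auto simp: scalar_prod_def lessThan_atLeast0 intro!: sum.cong)

lemma mult_mat_nth:
  "A \<in> carrier_mat n m \<Longrightarrow> B \<in> carrier_mat m k \<Longrightarrow> i < n \<Longrightarrow> j < k \<Longrightarrow>
    (A * B) $$ (i, j) = (\<Sum>t<m. A $$ (i, t) * B $$ (t, j))"
  by (auto simp: scalar_prod_def lessThan_atLeast0 intro!: sum.cong)

text \<open>Makes the supremum in \<open>op_norm\<close> meaningful. The sum of the moduli of all
  entries is a crude bound that suffices.\<close>

lemma op_norm_bdd:
  assumes "A \<in> carrier_mat n m"
  shows "bdd_above {vec_norm2 (A *\<^sub>v v) | v. v \<in> carrier_vec m \<and> vec_norm2 v \<le> 1}"
proof (rule bdd_aboveI)
  fix x assume "x \<in> {vec_norm2 (A *\<^sub>v v) | v. v \<in> carrier_vec m \<and> vec_norm2 v \<le> 1}"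
  then obtain v where v: "x = vec_norm2 (A *\<^sub>v v)" "v \<in> carrier_vec m" "vec_norm2 v \<le> 1" by blast
  have "x \<le> (\<Sum>i<n. \<bar>cmod ((A *\<^sub>v v) $ i)\<bar>)"
    using L2_set_le_sum_abs[of "\<lambda>i. cmod ((A *\<^sub>v v) $ i)" "{..<n}"] assms v(1) by (simp add: vec_norm2_def)
  also have "\<dots> \<le> (\<Sum>i<n. \<Sum>j<m. cmod (A $$ (i, j)))"
  proof (rule sum_mono)
    fix i assume "i \<in> {..<n}"
    then have "\<bar>cmod ((A *\<^sub>v v) $ i)\<bar> \<le> (\<Sum>j<m. cmod (A $$ (i, j) * v $ j))"
      using assms v by (simp only: mult_mat_vec_nth lessThan_iff abs_norm_cancel norm_sum)
    also have "\<dots> \<le> (\<Sum>j<m. cmod (A $$ (i, j)))"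
    proof (rule sum_mono)
      fix j assume "j \<in> {..<m}"
      then have "cmod (v $ j) \<le> 1" using cmod_le_vec_norm2[of j v] v by auto
      then show "cmod (A $$ (i, j) * v $ j) \<le> cmod (A $$ (i, j))"
        by (simp add: norm_mult mult_left_le)
    qed
    finally show "\<bar>cmod ((A *\<^sub>v v) $ i)\<bar> \<le> (\<Sum>j<m. cmod (A $$ (i, j)))" .
  qed
  finally show "x \<le> (\<Sum>i<n. \<Sum>j<m. cmod (A $$ (i, j)))" .
qed

lemma vec_norm2_eq_0: "v \<in> carrier_vec n \<Longrightarrow> vec_norm2 v = 0 \<Longrightarrow> v = 0\<^sub>v n"
  using cmod_le_vec_norm2[of _ v] by (intro eq_vecI) auto

lemma op_norm_bound:
  assumes A: "A \<in> carrier_mat n m" and v: "v \<in> carrier_vec m"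
  shows "vec_norm2 (A *\<^sub>v v) \<le> op_norm A * vec_norm2 v"
proof (cases "vec_norm2 v = 0")
  case True
  then have "v = 0\<^sub>v m" using vec_norm2_eq_0 v by blast
  moreover have "A *\<^sub>v 0\<^sub>v m = 0\<^sub>v n" using A by (intro eq_vecI) auto
  ultimately show ?thesis by simp
next
  case False
  define c where "c = inverse (vec_norm2 v)"
  have "vec_norm2 (A *\<^sub>v (complex_of_real c \<cdot>\<^sub>v v)) \<le> op_norm A"
    unfolding op_norm_def using op_norm_bdd[OF A] A v False
    by (intro cSup_upper) (auto simp: c_def norm_inverse intro!: exI[of _ "complex_of_real (inverse (vec_norm2 v)) \<cdot>\<^sub>v v"])
  moreover have "A *\<^sub>v (complex_of_real c \<cdot>\<^sub>v v) = complex_of_real c \<cdot>\<^sub>v (A *\<^sub>v v)"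
    using A v by (rule mult_mat_vec)
  moreover have "0 < vec_norm2 v" using False vec_norm2_nonneg[of v] by linarith
  ultimately have "vec_norm2 (A *\<^sub>v v) * inverse (vec_norm2 v) \<le> op_norm A" "0 < vec_norm2 v"
    by (simp_all add: c_def norm_inverse mult.commute)
  then show ?thesis by (simp add: field_simps)
qed

lemma op_norm_le:
  assumes "A \<in> carrier_mat n m" "0 \<le> c" "\<And>v. v \<in> carrier_vec m \<Longrightarrow> vec_norm2 (A *\<^sub>v v) \<le> c * vec_norm2 v"
  shows "op_norm A \<le> c"
  unfolding op_norm_def
proof (rule cSup_least)
  show "{vec_norm2 (A *\<^sub>v v) | v. v \<in> carrier_vec (dim_col A) \<and> vec_norm2 v \<le> 1} \<noteq> {}"
    using vec_norm2_zero[of "dim_col A"] by (auto intro!: exI[of _ "0\<^sub>v (dim_col A)"])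
  fix x assume "x \<in> {vec_norm2 (A *\<^sub>v v) | v. v \<in> carrier_vec (dim_col A) \<and> vec_norm2 v \<le> 1}"
  then obtain v where v: "x = vec_norm2 (A *\<^sub>v v)" "v \<in> carrier_vec m" "vec_norm2 v \<le> 1" using assms(1) by auto
  have "x \<le> c * vec_norm2 v" using assms(3)[OF v(2)] v(1) by simp
  also have "\<dots> \<le> c * 1" using v(3) assms(2) by (rule mult_left_mono)
  finally show "x \<le> c" by simp
qed

lemma op_norm_nonneg [simp]: "0 \<le> op_norm A"
proof -
  have "vec_norm2 (A *\<^sub>v 0\<^sub>v (dim_col A)) \<le> op_norm A"
    unfolding op_norm_def using op_norm_bdd[of A "dim_row A" "dim_col A"]
    by (intro cSup_upper) (auto intro!: exI[of _ "0\<^sub>v (dim_col A)"])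
  then show ?thesis using vec_norm2_nonneg order_trans by blast
qed

lemma op_norm_triangle:
  assumes A: "A \<in> carrier_mat n m" and B: "B \<in> carrier_mat n m"
  shows "op_norm (A + B) \<le> op_norm A + op_norm B"
proof (rule op_norm_le)
  fix v :: "complex vec" assume v: "v \<in> carrier_vec m"
  have "vec_norm2 ((A + B) *\<^sub>v v) = vec_norm2 (A *\<^sub>v v + B *\<^sub>v v)"
    using A B v by (simp add: add_mult_distrib_mat_vec)
  also have "\<dots> \<le> vec_norm2 (A *\<^sub>v v) + vec_norm2 (B *\<^sub>v v)"
    using A B v by (intro vec_norm2_triangle[of _ n]) auto
  also have "\<dots> \<le> (op_norm A + op_norm B) * vec_norm2 v"
    using op_norm_bound[OF A v] op_norm_bound[OF B v] by (simp add: algebra_simps)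
  finally show "vec_norm2 ((A + B) *\<^sub>v v) \<le> (op_norm A + op_norm B) * vec_norm2 v" .
qed (use A B in auto)

lemma op_norm_mult:
  assumes A: "A \<in> carrier_mat n m" and B: "B \<in> carrier_mat m k"
  shows "op_norm (A * B) \<le> op_norm A * op_norm B"
proof (rule op_norm_le)
  fix v :: "complex vec" assume v: "v \<in> carrier_vec k"
  have "vec_norm2 ((A * B) *\<^sub>v v) = vec_norm2 (A *\<^sub>v (B *\<^sub>v v))"
    using A B v by (simp add: assoc_mult_mat_vec)
  also have "\<dots> \<le> op_norm A * vec_norm2 (B *\<^sub>v v)"
    using A B v by (intro op_norm_bound) auto
  also have "\<dots> \<le> op_norm A * (op_norm B * vec_norm2 v)"
    using op_norm_bound[OF B v] by (intro mult_left_mono) auto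
  finally show "vec_norm2 ((A * B) *\<^sub>v v) \<le> op_norm A * op_norm B * vec_norm2 v"
    by (simp add: mult.assoc)
qed (use A B in auto)

lemma smult_mat_mult_vec:
  fixes A :: "'a :: comm_semiring_1 mat"
  shows "A \<in> carrier_mat n m \<Longrightarrow> v \<in> carrier_vec m \<Longrightarrow> (c \<cdot>\<^sub>m A) *\<^sub>v v = c \<cdot>\<^sub>v (A *\<^sub>v v)"
  by (intro eq_vecI) (auto simp: scalar_prod_def sum_distrib_left mult.assoc)

lemma op_norm_smult_le:
  assumes A: "A \<in> carrier_mat n m"
  shows "op_norm (c \<cdot>\<^sub>m A) \<le> cmod c * op_norm A"
proof (rule op_norm_le)
  fix v :: "complex vec" assume v: "v \<in> carrier_vec m"
  have "vec_norm2 ((c \<cdot>\<^sub>m A) *\<^sub>v v) = cmod c * vec_norm2 (A *\<^sub>v v)"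
    using A v by (simp add: smult_mat_mult_vec)
  also have "\<dots> \<le> cmod c * (op_norm A * vec_norm2 v)"
    using op_norm_bound[OF A v] by (intro mult_left_mono) auto
  finally show "vec_norm2 ((c \<cdot>\<^sub>m A) *\<^sub>v v) \<le> cmod c * op_norm A * vec_norm2 v" by (simp add: mult.assoc)
qed (use A in auto)

lemma op_norm_zero [simp]: "op_norm (0\<^sub>m n m) = 0"
proof -
  have "op_norm (0\<^sub>m n m) \<le> 0"
  proof (rule op_norm_le)
    fix v :: "complex vec" assume "v \<in> carrier_vec m"
    then have "0\<^sub>m n m *\<^sub>v v = 0\<^sub>v n" by (intro eq_vecI) auto
    then show "vec_norm2 (0\<^sub>m n m *\<^sub>v v) \<le> 0 * vec_norm2 v" by simp
  qed auto
  then show ?thesis using op_norm_nonneg[of "0\<^sub>m n m"] by linarith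
qed

lemma op_norm_minus_commute:
  assumes "A \<in> carrier_mat n m" "B \<in> carrier_mat n m"
  shows "op_norm (A - B) = op_norm (B - A)"
proof -
  have "op_norm (A - B) \<le> op_norm (B - A)"
    if "A \<in> carrier_mat n m" "B \<in> carrier_mat n m" for A B :: "complex mat"
  proof -
    have "A - B = (- 1) \<cdot>\<^sub>m (B - A)" using that by (intro eq_matI) auto
    then show ?thesis using op_norm_smult_le[of "B - A" n m "- 1"] minus_carrier_mat[OF that(1), of B] by simp
  qed
  then show ?thesis using assms by (intro antisym) auto
qed

lemma op_norm_triangle_minus:
  assumes "A \<in> carrier_mat n m" "B \<in> carrier_mat n m" "C \<in> carrier_mat n m"
  shows "op_norm (A - C) \<le> op_norm (A - B) + op_norm (B - C)"
proof -
  have "A - C = (A - B) + (B - C)" using assms by (intro eq_matI) auto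
  then show ?thesis
    using op_norm_triangle[of "A - B" n m "B - C"] minus_carrier_mat[OF assms(2), of A]
      minus_carrier_mat[OF assms(3), of B] by simp
qed

lemma op_norm_entry:
  assumes A: "A \<in> carrier_mat n m" and "i < n" "j < m"
  shows "cmod (A $$ (i, j)) \<le> op_norm A"
proof -
  have u: "unit_vec m j \<in> carrier_vec m" by simp
  have "(A *\<^sub>v unit_vec m j) $ i = A $$ (i, j)"
    using assms by simp
  then have "cmod (A $$ (i, j)) \<le> vec_norm2 (A *\<^sub>v unit_vec m j)"
    using cmod_le_vec_norm2[of i "A *\<^sub>v unit_vec m j"] assms by simp
  also have "\<dots> \<le> op_norm A" using op_norm_bound[OF A u] assms by simp
  finally show ?thesis .
qed

text \<open>The diagonal projection onto the coordinates in \<open>S\<close>. Only the part of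
  \<open>S\<close> below \<open>K\<close> counts, so complements, preimages under division and
  \<open>UNIV\<close> can be used as they are.\<close>

definition dg :: "nat \<Rightarrow> nat set \<Rightarrow> complex mat" where
  "dg K S = mat K K (\<lambda>(i, j). if i = j \<and> i \<in> S then 1 else 0)"

lemma dg_carrier [simp]: "dg K S \<in> carrier_mat K K" "dim_row (dg K S) = K" "dim_col (dg K S) = K"
  by (auto simp: dg_def)

lemma dg_mult: 
  assumes "A \<in> carrier_mat K n"
  shows "dg K S * A = mat K n (\<lambda>(i, j). if i \<in> S then A $$ (i, j) else 0)"
proof (rule eq_matI)
  fix i j assume "i < dim_row (mat K n (\<lambda>(i, j). if i \<in> S then A $$ (i, j) else 0))"
    "j < dim_col (mat K n (\<lambda>(i, j). if i \<in> S then A $$ (i, j) else 0))"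
  then have ij: "i < K" "j < n" by auto
  have "(dg K S * A) $$ (i, j) = (\<Sum>t<K. dg K S $$ (i, t) * A $$ (t, j))"
    by (rule mult_mat_nth[OF dg_carrier(1) assms ij])
  also have "\<dots> = (\<Sum>t<K. if t = i then if i \<in> S then A $$ (i, j) else 0 else 0)"
    using ij by (intro sum.cong) (auto simp: dg_def)
  also have "\<dots> = (if i \<in> S then A $$ (i, j) else 0)" using ij by simp
  finally show "(dg K S * A) $$ (i, j) = mat K n (\<lambda>(i, j). if i \<in> S then A $$ (i, j) else 0) $$ (i, j)"
    using ij by simp
qed (use assms in auto)

lemma mult_dg: 
  assumes "A \<in> carrier_mat n K"
  shows "A * dg K S = mat n K (\<lambda>(i, j). if j \<in> S then A $$ (i, j) else 0)"
proof (rule eq_matI)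
  fix i j assume "i < dim_row (mat n K (\<lambda>(i, j). if j \<in> S then A $$ (i, j) else 0))"
    "j < dim_col (mat n K (\<lambda>(i, j). if j \<in> S then A $$ (i, j) else 0))"
  then have ij: "i < n" "j < K" by auto
  have "(A * dg K S) $$ (i, j) = (\<Sum>t<K. A $$ (i, t) * dg K S $$ (t, j))"
    by (rule mult_mat_nth[OF assms dg_carrier(1) ij])
  also have "\<dots> = (\<Sum>t<K. if t = j then if j \<in> S then A $$ (i, j) else 0 else 0)"
    using ij by (intro sum.cong) (auto simp: dg_def)
  also have "\<dots> = (if j \<in> S then A $$ (i, j) else 0)" using ij by simp
  finally show "(A * dg K S) $$ (i, j) = mat n K (\<lambda>(i, j). if j \<in> S then A $$ (i, j) else 0) $$ (i, j)"
    using ij by simp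
qed (use assms in auto)

lemma dg_mult_dg: "dg K S * dg K T = dg K (S \<inter> T)"
  unfolding dg_mult[OF dg_carrier(1)] by (rule eq_matI) (auto simp: dg_def)

lemma dg_mult_vec:
  assumes "v \<in> carrier_vec K"
  shows "dg K S *\<^sub>v v = vec K (\<lambda>i. if i \<in> S then v $ i else 0)"
proof (rule eq_vecI)
  fix i assume "i < dim_vec (vec K (\<lambda>i. if i \<in> S then v $ i else 0))"
  then have i: "i < K" by simp
  have "(dg K S *\<^sub>v v) $ i = (\<Sum>j<K. dg K S $$ (i, j) * v $ j)"
    by (rule mult_mat_vec_nth[OF dg_carrier(1) assms i])
  also have "\<dots> = (\<Sum>j<K. if j = i then if i \<in> S then v $ i else 0 else 0)"
    using i by (intro sum.cong) (auto simp: dg_def)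
  finally show "(dg K S *\<^sub>v v) $ i = vec K (\<lambda>i. if i \<in> S then v $ i else 0) $ i" using i by simp
qed auto

lemma op_norm_dg: "op_norm (dg K S) \<le> 1"
proof (rule op_norm_le[OF dg_carrier(1)])
  fix v :: "complex vec" assume v: "v \<in> carrier_vec K"
  have "(vec_norm2 (dg K S *\<^sub>v v))\<^sup>2 \<le> (vec_norm2 v)\<^sup>2"
    using v by (auto simp: vec_norm2_sq dg_mult_vec intro!: sum_mono)
  then show "vec_norm2 (dg K S *\<^sub>v v) \<le> 1 * vec_norm2 v" by (simp add: power2_le_iff_abs_le)
qed simp

section \<open>The refinement embedding\<close>

lemma refine_carrier: "A \<in> carrier_mat n k \<Longrightarrow> refine m A \<in> carrier_mat (n * m) (k * m)"
  unfolding refine_def by auto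

lemma refine_nth:
  "A \<in> carrier_mat n k \<Longrightarrow> p < n * m \<Longrightarrow> q < k * m \<Longrightarrow>
    refine m A $$ (p, q) = (if p mod m = q mod m then A $$ (p div m, q div m) else 0)"
  by (simp add: refine_def)

lemma mult_add_less: "(t::nat) < K \<Longrightarrow> s < m \<Longrightarrow> t * m + s < K * m"
proof -
  assume "t < K" "s < m"
  then have "t * m + s < Suc t * m" by simp
  also have "\<dots> \<le> K * m" using \<open>t < K\<close> by (intro mult_le_mono1) simp
  finally show ?thesis .
qed

text \<open>\<open>refine m A\<close> is the tensor product of \<open>A\<close> with the identity of
  size \<open>m\<close>: coordinates with a fixed residue modulo \<open>m\<close> form a copy of the
  original space, on which it acts as \<open>A\<close>.\<close>

lemma refine_mult_vec_nth:
  assumes A: "A \<in> carrier_mat n k" and v: "v \<in> carrier_vec (k * m)" and t: "t < n" "s < m"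
  shows "(refine m A *\<^sub>v v) $ (t * m + s) = (A *\<^sub>v vec k (\<lambda>r. v $ (r * m + s))) $ t"
proof -
  have lt: "t * m + s < n * m" using t by (rule mult_add_less)
  have "(refine m A *\<^sub>v v) $ (t * m + s) = (\<Sum>r<k * m. refine m A $$ (t * m + s, r) * v $ r)"
    by (rule mult_mat_vec_nth[OF refine_carrier[OF A] v lt])
  also have "\<dots> = (\<Sum>r<k. \<Sum>u<m. refine m A $$ (t * m + s, r * m + u) * v $ (r * m + u))"
    by (rule sum_lessThan_mult)
  also have "\<dots> = (\<Sum>r<k. \<Sum>u<m. if u = s then A $$ (t, r) * v $ (r * m + s) else 0)"
    using t by (intro sum.cong refl) (auto simp: refine_nth[OF A lt] mult_add_less)
  also have "\<dots> = (\<Sum>r<k. A $$ (t, r) * v $ (r * m + s))" using t by simp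
  also have "\<dots> = (A *\<^sub>v vec k (\<lambda>r. v $ (r * m + s))) $ t"
    using t by (subst mult_mat_vec_nth[OF A]) auto
  finally show ?thesis .
qed

lemma vec_norm2_blocks:
  assumes "v \<in> carrier_vec (k * m)"
  shows "(vec_norm2 v)\<^sup>2 = (\<Sum>s<m. (vec_norm2 (vec k (\<lambda>r. v $ (r * m + s))))\<^sup>2)"
proof -
  have "(vec_norm2 v)\<^sup>2 = (\<Sum>r<k. \<Sum>s<m. (cmod (v $ (r * m + s)))\<^sup>2)"
    using assms by (simp add: vec_norm2_sq sum_lessThan_mult)
  also have "\<dots> = (\<Sum>s<m. \<Sum>r<k. (cmod (v $ (r * m + s)))\<^sup>2)" by (rule sum.swap)
  finally show ?thesis by (simp add: vec_norm2_sq)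
qed

text \<open>An orthogonal direct sum of copies of \<open>A\<close>, one for each residue, has the
  norm of \<open>A\<close>.\<close>

lemma op_norm_refine:
  assumes A: "A \<in> carrier_mat n k" and m: "0 < m"
  shows "op_norm (refine m A) = op_norm A"
proof (rule antisym)
  show "op_norm (refine m A) \<le> op_norm A"
  proof (rule op_norm_le[OF refine_carrier[OF A] op_norm_nonneg])
    fix v :: "complex vec" assume v: "v \<in> carrier_vec (k * m)"
    have "refine m A *\<^sub>v v \<in> carrier_vec (n * m)" using A by (intro carrier_vecI) (simp add: refine_def)
    then have "(vec_norm2 (refine m A *\<^sub>v v))\<^sup>2 =
        (\<Sum>s<m. (vec_norm2 (vec n (\<lambda>t. (refine m A *\<^sub>v v) $ (t * m + s))))\<^sup>2)"
      by (rule vec_norm2_blocks)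
    also have "\<dots> = (\<Sum>s<m. (vec_norm2 (A *\<^sub>v vec k (\<lambda>r. v $ (r * m + s))))\<^sup>2)"
    proof (intro sum.cong refl arg_cong[of _ _ "\<lambda>v. (vec_norm2 v)\<^sup>2"] eq_vecI)
      fix s t assume "s \<in> {..<m}" "t < dim_vec (A *\<^sub>v vec k (\<lambda>r. v $ (r * m + s)))"
      then show "vec n (\<lambda>t. (refine m A *\<^sub>v v) $ (t * m + s)) $ t = (A *\<^sub>v vec k (\<lambda>r. v $ (r * m + s))) $ t"
        using refine_mult_vec_nth[OF A v] A by simp
    qed (use A in auto)
    also have "\<dots> \<le> (\<Sum>s<m. (op_norm A * vec_norm2 (vec k (\<lambda>r. v $ (r * m + s))))\<^sup>2)"
      using op_norm_bound[OF A] by (intro sum_mono power_mono) auto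
    also have "\<dots> = (op_norm A * vec_norm2 v)\<^sup>2"
      unfolding power_mult_distrib vec_norm2_blocks[OF v] sum_distrib_left ..
    finally show "vec_norm2 (refine m A *\<^sub>v v) \<le> op_norm A * vec_norm2 v"
      by (rule power2_le_imp_le) simp
  qed
  show "op_norm A \<le> op_norm (refine m A)"
  proof (rule op_norm_le[OF A op_norm_nonneg])
    fix v :: "complex vec" assume v: "v \<in> carrier_vec k"
    \<comment> \<open>For the lower bound \<open>v\<close> is placed in the copy belonging to
      residue 0.\<close>
    define w where "w = vec (k * m) (\<lambda>p. if p mod m = 0 then v $ (p div m) else 0)"
    have w: "w \<in> carrier_vec (k * m)" by (simp add: w_def)
    have w_blocks: "vec k (\<lambda>r. w $ (r * m + s)) = (if s = 0 then v else 0\<^sub>v k)" if "s < m" for s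
      using that v by (intro eq_vecI) (auto simp: w_def mult_add_less)
    have rw: "refine m A *\<^sub>v w \<in> carrier_vec (n * m)" using A by (intro carrier_vecI) (simp add: refine_def)
    have "(vec_norm2 w)\<^sup>2 = (\<Sum>s<m. if s = 0 then (vec_norm2 v)\<^sup>2 else 0)"
      unfolding vec_norm2_blocks[OF w] by (intro sum.cong refl) (simp add: w_blocks)
    also have "\<dots> = (vec_norm2 v)\<^sup>2" using m by simp
    finally have "vec_norm2 w = vec_norm2 v" by (simp add: power2_eq_iff_nonneg)
    moreover have "A *\<^sub>v v = vec n (\<lambda>t. (refine m A *\<^sub>v w) $ (t * m + 0))"
    proof (rule eq_vecI)
      fix t assume "t < dim_vec (vec n (\<lambda>t. (refine m A *\<^sub>v w) $ (t * m + 0)))"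
      then have "t < n" by simp
      then have "(refine m A *\<^sub>v w) $ (t * m + 0) = (A *\<^sub>v v) $ t"
        using refine_mult_vec_nth[OF A w _ m] w_blocks[OF m] by simp
      then show "(A *\<^sub>v v) $ t = vec n (\<lambda>t. (refine m A *\<^sub>v w) $ (t * m + 0)) $ t" using \<open>t < n\<close> by simp
    qed (use A in simp)
    then have "(vec_norm2 (A *\<^sub>v v))\<^sup>2 \<le> (vec_norm2 (refine m A *\<^sub>v w))\<^sup>2"
      unfolding vec_norm2_blocks[OF rw] using m by (simp only:) (rule member_le_sum; simp)
    then have "vec_norm2 (A *\<^sub>v v) \<le> vec_norm2 (refine m A *\<^sub>v w)"
      by (rule power2_le_imp_le) simp
    ultimately show "vec_norm2 (A *\<^sub>v v) \<le> op_norm (refine m A) * vec_norm2 v"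
      using op_norm_bound[OF refine_carrier[OF A] w] by simp
  qed
qed

lemma refine_mult:
  assumes A: "A \<in> carrier_mat n k" and B: "B \<in> carrier_mat k l"
  shows "refine m (A * B) = refine m A * refine m B"
proof (rule eq_matI)
  fix p q assume "p < dim_row (refine m A * refine m B)" "q < dim_col (refine m A * refine m B)"
  then have pq: "p < n * m" "q < l * m" using A B by (auto simp: refine_def)
  then have m: "0 < m" by (cases m) auto
  have dv: "p div m < n" "q div m < l" using pq by (auto simp: less_mult_imp_div_less)
  have "(refine m A * refine m B) $$ (p, q) = (\<Sum>r<k * m. refine m A $$ (p, r) * refine m B $$ (r, q))"
    by (rule mult_mat_nth[OF refine_carrier[OF A] refine_carrier[OF B] pq])
  also have "\<dots> = (\<Sum>t<k. \<Sum>s<m. refine m A $$ (p, t * m + s) * refine m B $$ (t * m + s, q))"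
    by (rule sum_lessThan_mult)
  also have "\<dots> = (\<Sum>t<k. \<Sum>s<m. if s = p mod m then
      if p mod m = q mod m then A $$ (p div m, t) * B $$ (t, q div m) else 0 else 0)"
    using pq by (intro sum.cong refl) (auto simp: refine_nth[OF A] refine_nth[OF B] mult_add_less)
  also have "\<dots> = (if p mod m = q mod m then (\<Sum>t<k. A $$ (p div m, t) * B $$ (t, q div m)) else 0)"
    using m by simp
  also have "\<dots> = refine m (A * B) $$ (p, q)"
    unfolding refine_nth[OF mult_carrier_mat[OF A B] pq] mult_mat_nth[OF A B dv] ..
  finally show "refine m (A * B) $$ (p, q) = (refine m A * refine m B) $$ (p, q)" ..
qed (use A B in \<open>auto simp: refine_def\<close>)

lemma refine_refine: "refine m' (refine m A) = refine (m * m') A"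
proof (rule eq_matI)
  fix p q assume "p < dim_row (refine (m * m') A)" "q < dim_col (refine (m * m') A)"
  then have pq: "p < dim_row A * m * m'" "q < dim_col A * m * m'" by (auto simp: refine_def mult.assoc)
  have dv: "p div m' < dim_row A * m" "q div m' < dim_col A * m" using pq by (auto simp: less_mult_imp_div_less)
  have "p mod (m * m') = q mod (m * m') \<longleftrightarrow> p mod m' = q mod m' \<and> p div m' mod m = q div m' mod m"
  proof
    assume h: "p mod (m * m') = q mod (m * m')"
    have "p mod (m * m') mod m' = p mod m'" "q mod (m * m') mod m' = q mod m'"
      by (simp_all add: mod_mod_cancel)
    moreover have "p mod (m * m') div m' = p div m' mod m" "q mod (m * m') div m' = q div m' mod m"
      using mod_mult2_eq[of _ m' m] by (cases "m' = 0"; simp add: mult.commute[of m])+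
    ultimately show "p mod m' = q mod m' \<and> p div m' mod m = q div m' mod m" using h by metis
  next
    assume "p mod m' = q mod m' \<and> p div m' mod m = q div m' mod m"
    then show "p mod (m * m') = q mod (m * m')" by (simp add: mult.commute[of m] mod_mult2_eq)
  qed
  moreover have "p div (m * m') = p div m' div m" "q div (m * m') = q div m' div m"
    by (subst mult.commute, rule div_mult2_eq)+
  moreover have "p < dim_row A * (m * m')" "q < dim_col A * (m * m')" using pq by (simp_all add: mult.assoc)
  ultimately show "refine m' (refine m A) $$ (p, q) = refine (m * m') A $$ (p, q)"
    using pq dv by (simp add: refine_def)
qed (auto simp: refine_def mult.assoc)

lemma refine_1: "refine (Suc 0) A = A"
  by (rule eq_matI) (auto simp: refine_def)

lemma refine_add:
  assumes "A \<in> carrier_mat n k" "B \<in> carrier_mat n k"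
  shows "refine m (A + B) = refine m A + refine m B"
  using assms by (intro eq_matI) (auto simp: refine_def less_mult_imp_div_less)

lemma refine_minus:
  assumes "A \<in> carrier_mat n k" "B \<in> carrier_mat n k"
  shows "refine m (A - B) = refine m A - refine m B"
  using assms by (intro eq_matI) (auto simp: refine_def less_mult_imp_div_less)

lemma refine_smult: "refine m (c \<cdot>\<^sub>m A) = c \<cdot>\<^sub>m refine m A"
  by (intro eq_matI) (auto simp: refine_def less_mult_imp_div_less)

lemma refine_zero [simp]: "refine m (0\<^sub>m n k) = 0\<^sub>m (n * m) (k * m)"
  by (intro eq_matI) (auto simp: refine_def less_mult_imp_div_less)

lemma refine_dg: "refine m (dg K S) = dg (K * m) {p. p div m \<in> S}"
proof (rule eq_matI)
  fix p q assume "p < dim_row (dg (K * m) {p. p div m \<in> S})" "q < dim_col (dg (K * m) {p. p div m \<in> S})"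
  then have "p < K * m" "q < K * m" by simp_all
  moreover have "p div m = q div m \<Longrightarrow> p mod m = q mod m \<Longrightarrow> p = q" by (metis div_mult_mod_eq)
  ultimately show "refine m (dg K S) $$ (p, q) = dg (K * m) {p. p div m \<in> S} $$ (p, q)"
    by (auto simp: refine_def dg_def less_mult_imp_div_less)
qed (simp_all add: refine_def)

lemma dg_UNIV: "dg K UNIV = 1\<^sub>m K"
  by (intro eq_matI) (auto simp: dg_def)

lemma refine_one: "refine m (1\<^sub>m K) = 1\<^sub>m (K * m)"
  using refine_dg[of m K UNIV] by (simp add: dg_UNIV)

section \<open>Matrices that are almost contractive idempotents\<close>

text \<open>The inner product of \<open>\<complex>\<close>-vectors, conjugate-linear in the first
  argument.\<close>

definition ip :: "complex vec \<Rightarrow> complex vec \<Rightarrow> complex" where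
  "ip x y = (\<Sum>i<dim_vec y. cnj (x $ i) * y $ i)"

text \<open>The adjoint of \<open>A\<close> applied to \<open>z\<close>; the adjoint matrix itself
  is never formed.\<close>

definition adj_vec :: "complex mat \<Rightarrow> complex vec \<Rightarrow> complex vec" where
  "adj_vec A z = vec (dim_col A) (\<lambda>j. \<Sum>i<dim_row A. cnj (A $$ (i, j)) * z $ i)"

lemma ip_le:
  assumes "x \<in> carrier_vec n" "y \<in> carrier_vec n"
  shows "cmod (ip x y) \<le> vec_norm2 x * vec_norm2 y"
proof -
  have "cmod (ip x y) \<le> (\<Sum>i<n. \<bar>cmod (x $ i)\<bar> * \<bar>cmod (y $ i)\<bar>)"
    using assms norm_sum[of "\<lambda>i. cnj (x $ i) * y $ i" "{..<n}"] by (simp add: ip_def norm_mult)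
  also have "\<dots> \<le> vec_norm2 x * vec_norm2 y"
    using assms L2_set_mult_ineq[of "\<lambda>i. cmod (x $ i)" "\<lambda>i. cmod (y $ i)" "{..<n}"]
    by (simp add: vec_norm2_def)
  finally show ?thesis .
qed

lemma ip_self: "ip x x = complex_of_real ((vec_norm2 x)\<^sup>2)"
  unfolding ip_def vec_norm2_sq of_real_sum
  by (intro sum.cong refl) (simp only: complex_norm_square[symmetric] mult.commute)

lemma ip_cnj: "dim_vec x = dim_vec y \<Longrightarrow> ip x y = cnj (ip y x)"
  by (simp add: ip_def mult.commute)

lemma ip_add_left: "x \<in> carrier_vec n \<Longrightarrow> y \<in> carrier_vec n \<Longrightarrow> z \<in> carrier_vec n \<Longrightarrow>
    ip (x + y) z = ip x z + ip y z"
  by (simp add: ip_def sum.distrib[symmetric] algebra_simps)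

lemma ip_diff_left: "x \<in> carrier_vec n \<Longrightarrow> y \<in> carrier_vec n \<Longrightarrow> z \<in> carrier_vec n \<Longrightarrow>
    ip (x - y) z = ip x z - ip y z"
  by (simp add: ip_def sum_subtractf[symmetric] algebra_simps)

lemma ip_diff_right: "x \<in> carrier_vec n \<Longrightarrow> y \<in> carrier_vec n \<Longrightarrow> z \<in> carrier_vec n \<Longrightarrow>
    ip x (y - z) = ip x y - ip x z"
  by (simp add: ip_def sum_subtractf[symmetric] algebra_simps)

lemma ip_adj_vec:
  assumes A: "A \<in> carrier_mat n m" and y: "y \<in> carrier_vec m" and z: "z \<in> carrier_vec n"
  shows "ip (A *\<^sub>v y) z = ip y (adj_vec A z)"
proof -
  have "ip (A *\<^sub>v y) z = (\<Sum>i<n. \<Sum>j<m. cnj (A $$ (i, j)) * cnj (y $ j) * z $ i)"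
    using z mult_mat_vec_nth[OF A y] by (simp add: ip_def sum_distrib_right del: index_mult_mat_vec)
  also have "\<dots> = (\<Sum>j<m. \<Sum>i<n. cnj (A $$ (i, j)) * cnj (y $ j) * z $ i)" by (rule sum.swap)
  also have "\<dots> = ip y (adj_vec A z)"
    using A by (simp add: ip_def adj_vec_def sum_distrib_left algebra_simps)
  finally show ?thesis .
qed

lemma adj_vec_carrier: "A \<in> carrier_mat n m \<Longrightarrow> adj_vec A z \<in> carrier_vec m"
  unfolding adj_vec_def by auto

text \<open>With \<open>a\<close> the adjoint of \<open>A\<close> applied to \<open>z\<close>, the
  square of the norm of \<open>a\<close> is the inner product of \<open>A a\<close> with
  \<open>z\<close>; apply Cauchy-Schwarz and divide by the norm of \<open>a\<close>.\<close>

lemma vec_norm2_adj_vec: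
  assumes A: "A \<in> carrier_mat n m" and z: "z \<in> carrier_vec n"
  shows "vec_norm2 (adj_vec A z) \<le> op_norm A * vec_norm2 z"
proof -
  define a where "a = adj_vec A z"
  have a: "a \<in> carrier_vec m" and Aa: "A *\<^sub>v a \<in> carrier_vec n"
    using adj_vec_carrier[OF A] A by (auto simp: a_def intro: mult_mat_vec_carrier)
  have "(vec_norm2 a)\<^sup>2 = cmod (ip (A *\<^sub>v a) z)"
    unfolding ip_adj_vec[OF A a z] a_def[symmetric] ip_self norm_of_real by simp
  also have "\<dots> \<le> vec_norm2 (A *\<^sub>v a) * vec_norm2 z" by (rule ip_le[OF Aa z])
  also have "\<dots> \<le> op_norm A * vec_norm2 a * vec_norm2 z"
    by (intro mult_right_mono op_norm_bound[OF A a]) simp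
  finally have "vec_norm2 a * vec_norm2 a \<le> vec_norm2 a * (op_norm A * vec_norm2 z)"
    by (simp add: power2_eq_square algebra_simps)
  then have "vec_norm2 a \<le> op_norm A * vec_norm2 z"
    using vec_norm2_nonneg[of a] by (cases "vec_norm2 a = 0") auto
  then show ?thesis by (simp add: a_def)
qed

text \<open>
  A contractive idempotent \<open>A\<close> satisfies \<open>A\<^sup>* A = A\<close>; this is the quantitative version.
\<close>

lemma near_idempotent_ip:
  assumes A: "A \<in> carrier_mat n n" and e: "0 \<le> e" "e \<le> 1"
    and contr: "op_norm A \<le> 1 + e" and idem: "op_norm (A * A - A) \<le> e"
    and x: "x \<in> carrier_vec n" and y: "y \<in> carrier_vec n"
  shows "cmod (ip y (A *\<^sub>v x) - ip (A *\<^sub>v y) (A *\<^sub>v x)) \<le> 4 * sqrt e * (vec_norm2 x * vec_norm2 y)"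
proof -
  \<comment> \<open>In the exact case \<open>A\<close> fixes \<open>z = A x\<close>, and the adjoint
    of a contraction fixes every vector that the contraction fixes. Here \<open>d\<close> measures
    how far \<open>A\<close> is from fixing \<open>z\<close>, and the aim is to bound the distance
    from \<open>a\<close> to \<open>z\<close>.\<close>
  define z where "z = A *\<^sub>v x"
  define a where "a = adj_vec A z"
  define d where "d = (A * A - A) *\<^sub>v x"
  have AA: "A * A - A \<in> carrier_mat n n" using A by auto
  have z: "z \<in> carrier_vec n" and a: "a \<in> carrier_vec n" and d: "d \<in> carrier_vec n"
    using A x AA by (auto simp: z_def a_def d_def intro: mult_mat_vec_carrier adj_vec_carrier)
  have Az: "A *\<^sub>v z = z + d"
  proof -
    have "d = A * A *\<^sub>v x - A *\<^sub>v x"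
      unfolding d_def using A x by (intro minus_mult_distrib_mat_vec) auto
    then have "d = A *\<^sub>v z - z" using A x by (simp add: z_def assoc_mult_mat_vec)
    then show ?thesis using A z by (intro eq_vecI) auto
  qed
  let ?z = "vec_norm2 z" and ?x = "vec_norm2 x" and ?y = "vec_norm2 y"
  have nz: "?z \<le> (1 + e) * ?x"
    using op_norm_bound[OF A x] mult_right_mono[OF contr vec_norm2_nonneg[of x]] by (simp add: z_def)
  also have "\<dots> \<le> 2 * ?x" using e by (intro mult_right_mono) auto
  finally have nz: "?z \<le> 2 * ?x" .
  have nd: "vec_norm2 d \<le> e * ?x"
    using op_norm_bound[OF AA x] mult_right_mono[OF idem vec_norm2_nonneg[of x]] by (simp add: d_def)
  have na: "vec_norm2 a \<le> (1 + e) * ?z"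
    using vec_norm2_adj_vec[OF A z] mult_right_mono[OF contr vec_norm2_nonneg[of z]] by (simp add: a_def)
  have "ip (A *\<^sub>v z) z = ip z a" unfolding a_def by (rule ip_adj_vec[OF A z z])
  then have za: "ip z a = ip z z + ip d z" unfolding Az using ip_add_left[OF z d z] by simp
  have az: "ip a z = cnj (ip z a)" using a z by (intro ip_cnj) auto
  have amz: "a - z \<in> carrier_vec n" using a z by auto
  \<comment> \<open>Expanding the square and inserting \<open>ip z a = ip z z + ip d z\<close>
    leaves the difference of two squared norms, small because \<open>A\<close> is nearly
    contractive, and a term in \<open>d\<close>, small because \<open>A\<close> is nearly
    idempotent.\<close>
  have "ip (a - z) (a - z) = (ip a a - ip z a) - (ip a z - ip z z)"
    unfolding ip_diff_right[OF amz a z] ip_diff_left[OF a z a] ip_diff_left[OF a z z] ..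
  then have "Re (ip (a - z) (a - z)) = Re (ip a a) - Re (ip z z) - 2 * Re (ip d z)"
    by (simp add: az za)
  then have "(vec_norm2 (a - z))\<^sup>2 = (vec_norm2 a)\<^sup>2 - ?z\<^sup>2 - 2 * Re (ip d z)"
    by (simp add: ip_self del: of_real_power)
  also have "- Re (ip d z) \<le> e * ?x * ?z"
    using abs_Re_le_cmod[of "ip d z"] ip_le[OF d z] mult_right_mono[OF nd vec_norm2_nonneg[of z]] by linarith
  then have "(vec_norm2 a)\<^sup>2 - ?z\<^sup>2 - 2 * Re (ip d z) \<le> ((1 + e) * ?z)\<^sup>2 - ?z\<^sup>2 + 2 * (e * ?x * ?z)"
    using power_mono[OF na vec_norm2_nonneg, of 2] by linarith
  also have "\<dots> = e * (2 * ?z\<^sup>2 + 2 * ?x * ?z) + e * e * ?z\<^sup>2"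
    by (simp add: power2_eq_square algebra_simps)
  also have "\<dots> \<le> e * (2 * ?z\<^sup>2 + 2 * ?x * ?z) + e * 1 * ?z\<^sup>2"
    using e by (intro add_left_mono mult_right_mono mult_left_mono) auto
  also have "\<dots> = e * (3 * ?z\<^sup>2 + 2 * ?x * ?z)" by (simp add: algebra_simps)
  \<comment> \<open>With the norm of \<open>z\<close> at most twice that of \<open>x\<close>, the
    coefficient of \<open>e\<close> becomes 12 + 4 = 16, whose root is the constant 4 of the
    statement.\<close>
  also have "\<dots> \<le> e * (3 * (2 * ?x)\<^sup>2 + 2 * ?x * (2 * ?x))"
    using e nz by (intro mult_left_mono add_mono power_mono) auto
  also have "\<dots> = (4 * sqrt e * ?x)\<^sup>2" using e by (simp add: power_mult_distrib power2_eq_square)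
  finally have "vec_norm2 (a - z) \<le> 4 * sqrt e * ?x"
    by (rule power2_le_imp_le) (use e in simp)
  then have "cmod (ip y (a - z)) \<le> ?y * (4 * sqrt e * ?x)"
    using ip_le[OF y amz] mult_left_mono[OF _ vec_norm2_nonneg[of y]] order_trans by blast
  moreover have "ip y (a - z) = ip (A *\<^sub>v y) z - ip y z"
    using ip_diff_right[OF y a z] ip_adj_vec[OF A y z] by (simp add: a_def)
  ultimately have "cmod (ip (A *\<^sub>v y) z - ip y z) \<le> ?y * (4 * sqrt e * ?x)" by simp
  then show ?thesis by (simp add: z_def norm_minus_commute mult.commute mult.left_commute)
qed

text \<open>A matrix that is nearly a contractive idempotent is nearly self-adjoint. If its block
  with rows in \<open>T\<close> and columns in \<open>S\<close> vanishes, the opposite block must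
  therefore be small.\<close>

lemma near_idempotent_block:
  assumes A: "A \<in> carrier_mat n n" and e: "0 \<le> e" "e \<le> 1"
    and contr: "op_norm A \<le> 1 + e" and idem: "op_norm (A * A - A) \<le> e"
    and zero: "\<And>i j. i < n \<Longrightarrow> j < n \<Longrightarrow> i \<in> T \<Longrightarrow> j \<in> S \<Longrightarrow> A $$ (i, j) = 0"
  shows "op_norm (dg n S * A * dg n T) \<le> 8 * sqrt e"
proof (rule op_norm_le)
  fix v :: "complex vec" assume v: "v \<in> carrier_vec n"
  define x where "x = dg n T *\<^sub>v v"
  define y where "y = dg n S *\<^sub>v (A *\<^sub>v x)"
  have x: "x \<in> carrier_vec n" and Ax: "A *\<^sub>v x \<in> carrier_vec n" and y: "y \<in> carrier_vec n"
    using A unfolding x_def y_def carrier_vec_def by auto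
  have Ay: "A *\<^sub>v y \<in> carrier_vec n" using A unfolding carrier_vec_def by auto
  have eq: "(dg n S * A * dg n T) *\<^sub>v v = y"
  proof -
    have "(dg n S * A * dg n T) *\<^sub>v v = (dg n S * A) *\<^sub>v x"
      unfolding x_def using A v by (intro assoc_mult_mat_vec[of _ n n _ n]) auto
    also have "\<dots> = y" unfolding y_def using A x by (intro assoc_mult_mat_vec[of _ n n _ n]) auto
    finally show ?thesis .
  qed
  have nx: "vec_norm2 x \<le> vec_norm2 v"
    using op_norm_bound[OF dg_carrier(1) v, of T] mult_right_mono[OF op_norm_dg vec_norm2_nonneg[of v], of n T]
    by (simp add: x_def)
  have y_nth: "y $ i = (if i \<in> S then (A *\<^sub>v x) $ i else 0)" if "i < n" for i
    using that unfolding y_def by (simp add: dg_mult_vec[OF Ax])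
  have x_nth: "x $ i = (if i \<in> T then v $ i else 0)" if "i < n" for i
    using that unfolding x_def by (simp add: dg_mult_vec[OF v])
  have yy: "ip y y = ip y (A *\<^sub>v x)"
    unfolding ip_def using carrier_vecD[OF y] carrier_vecD[OF Ax]
    by (intro sum.cong) (auto simp: y_nth simp del: index_mult_mat_vec dim_mult_mat_vec)
  \<comment> \<open>The vector \<open>y\<close> is supported in \<open>S\<close>, so by hypothesis
    \<open>A y\<close> vanishes on \<open>T\<close>, where \<open>x\<close> is supported.\<close>
  have xy: "ip x (A *\<^sub>v y) = 0"
  proof -
    have "cnj (x $ i) * (A *\<^sub>v y) $ i = 0" if "i < n" for i
    proof (cases "i \<in> T")
      case True
      have "(A *\<^sub>v y) $ i = (\<Sum>j<n. A $$ (i, j) * y $ j)" using mult_mat_vec_nth[OF A y that] .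
      also have "\<dots> = 0" using zero[OF that _ True] y_nth by (intro sum.neutral) auto
      finally show ?thesis by simp
    qed (use x_nth that in simp)
    then show ?thesis unfolding ip_def carrier_vecD[OF Ay] by (intro sum.neutral) blast
  qed
  have Axy: "ip (A *\<^sub>v y) (A *\<^sub>v x) = cnj (ip (A *\<^sub>v x) (A *\<^sub>v y))"
    by (intro ip_cnj) (simp only: carrier_vecD[OF Ax] carrier_vecD[OF Ay])
  \<comment> \<open>By the preceding lemma, used in both orders, \<open>ip y (A x)\<close> and the
    conjugate of \<open>ip x (A y)\<close>, which is 0, are both close to
    \<open>ip (A y) (A x)\<close>. Each use costs \<open>4 * sqrt e\<close>.\<close>
  have "(vec_norm2 y)\<^sup>2 = cmod (ip y (A *\<^sub>v x))" unfolding yy[symmetric] ip_self norm_of_real by simp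
  also have "\<dots> \<le> cmod (ip y (A *\<^sub>v x) - ip (A *\<^sub>v y) (A *\<^sub>v x)) + cmod (ip (A *\<^sub>v y) (A *\<^sub>v x))"
    using norm_triangle_ineq[of "ip y (A *\<^sub>v x) - ip (A *\<^sub>v y) (A *\<^sub>v x)" "ip (A *\<^sub>v y) (A *\<^sub>v x)"] by simp
  also have "cmod (ip (A *\<^sub>v y) (A *\<^sub>v x)) = cmod (ip x (A *\<^sub>v y) - ip (A *\<^sub>v x) (A *\<^sub>v y))"
    unfolding Axy xy by simp
  also have "cmod (ip y (A *\<^sub>v x) - ip (A *\<^sub>v y) (A *\<^sub>v x)) + \<dots>
      \<le> 4 * sqrt e * (vec_norm2 x * vec_norm2 y) + 4 * sqrt e * (vec_norm2 y * vec_norm2 x)"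
    by (intro add_mono near_idempotent_ip[OF A e contr idem] x y)
  also have "\<dots> = (8 * sqrt e * vec_norm2 x) * vec_norm2 y" by simp
  also have "\<dots> \<le> (8 * sqrt e * vec_norm2 v) * vec_norm2 y"
    using nx e by (intro mult_right_mono mult_left_mono) auto
  finally have "vec_norm2 y * vec_norm2 y \<le> (8 * sqrt e * vec_norm2 v) * vec_norm2 y"
    by (simp add: power2_eq_square)
  then have "vec_norm2 y \<le> 8 * sqrt e * vec_norm2 v"
    using vec_norm2_nonneg[of y] e by (cases "vec_norm2 y = 0") auto
  then show "vec_norm2 ((dg n S * A * dg n T) *\<^sub>v v) \<le> 8 * sqrt e * vec_norm2 v" unfolding eq .
qed (use A e in \<open>auto intro: mult_carrier_mat\<close>)

lemma dg_mult_mult_dg: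
  assumes "A \<in> carrier_mat K K"
  shows "dg K S * A * dg K S' = mat K K (\<lambda>(i, j). if i \<in> S \<and> j \<in> S' then A $$ (i, j) else 0)"
proof -
  have "dg K S * A * dg K S' = mat K K (\<lambda>(i, j). if i \<in> S then A $$ (i, j) else 0) * dg K S'"
    by (simp only: dg_mult[OF assms])
  also have "\<dots> = mat K K (\<lambda>(i, j). if i \<in> S \<and> j \<in> S' then A $$ (i, j) else 0)"
    by (subst mult_dg[of _ K]) (auto intro!: eq_matI)
  finally show ?thesis .
qed

section \<open>Matrices supported on an order relation\<close>

text \<open>The zero-pattern form of \<open>tree_mats\<close>. The column index is the ancestor,
  since the matrix unit with row \<open>i\<close> and column \<open>j\<close> stands for an arc from
  \<open>j\<close> to \<open>i\<close>.\<close>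

definition tri :: "nat \<Rightarrow> (nat \<Rightarrow> nat \<Rightarrow> bool) \<Rightarrow> complex mat set" where
  "tri K leq = {A \<in> carrier_mat K K. \<forall>i<K. \<forall>j<K. A $$ (i, j) \<noteq> 0 \<longrightarrow> leq j i}"

lemma tree_mats_eq_tri:
  assumes "hasse G leq" "pverts G = {..<K}"
  shows "tree_mats K G = tri K leq"
proof (intro equalityI subsetI)
  fix A assume "A \<in> tree_mats K G"
  then have "A \<in> mat_span K {matrix_unit K i j | i j. leq j i}"
    by (simp add: tree_mats_def hasse_reachable[OF assms(1)])
  then show "A \<in> tri K leq"
  proof (induction rule: mat_span.induct)
    case (add A B)
    then have "A \<in> carrier_mat K K" "B \<in> carrier_mat K K" by (auto simp: tri_def)
    moreover have "leq j i" if "i < K" "j < K" "(A + B) $$ (i, j) \<noteq> 0" for i j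
      using add.IH that calculation by (cases "A $$ (i, j) = 0") (auto simp: tri_def)
    ultimately show ?case by (auto simp: tri_def)
  qed (auto simp: tri_def matrix_unit_def split: if_splits)
next
  fix A assume A: "A \<in> tri K leq"
  let ?S = "{matrix_unit K i j | i j. leq j i}"
  \<comment> \<open>\<open>P F\<close> keeps the entries of \<open>A\<close> at the positions in
    \<open>F\<close>; positions are added one at a time, each contributing a multiple of a matrix
    unit.\<close>
  define P where "P F = mat K K (\<lambda>(i, j). if (i, j) \<in> F then A $$ (i, j) else 0)" for F
  have span: "P F \<in> mat_span K ?S" if "finite F" for F
    using that
  proof (induction F rule: finite_induct)
    case empty
    have "P {} = 0\<^sub>m K K" by (intro eq_matI) (auto simp: P_def)
    then show ?case by (simp add: mat_span.zero)
  next
    case (insert e F)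
    obtain i j where e: "e = (i, j)" by (cases e)
    show ?case
    proof (cases "i < K \<and> j < K \<and> A $$ (i, j) \<noteq> 0")
      case True
      then have "matrix_unit K i j \<in> ?S" using A by (auto simp: tri_def)
      then have "P F + A $$ (i, j) \<cdot>\<^sub>m matrix_unit K i j \<in> mat_span K ?S"
        by (intro mat_span.add mat_span.smult mat_span.base insert.IH)
      moreover have "P (insert e F) = P F + A $$ (i, j) \<cdot>\<^sub>m matrix_unit K i j"
        using insert.hyps e by (intro eq_matI) (auto simp: P_def matrix_unit_def)
      ultimately show ?thesis by simp
    next
      case False
      then have "P (insert e F) = P F" using e by (intro eq_matI) (auto simp: P_def)
      then show ?thesis using insert.IH by simp
    qed
  qed
  have "P ({..<K} \<times> {..<K}) \<in> mat_span K ?S" by (rule span) simp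
  moreover have "P ({..<K} \<times> {..<K}) = A"
    using A by (intro eq_matI) (auto simp: P_def tri_def)
  ultimately show "A \<in> tree_mats K G" by (simp add: tree_mats_def hasse_reachable[OF assms(1)])
qed

lemma tri_carrier: "A \<in> tri K leq \<Longrightarrow> A \<in> carrier_mat K K"
  unfolding tri_def by blast

text \<open>A nonzero entry of a refinement has equal residues in row and column, so inside a
  diagonal block it sits on the diagonal and respects the order of the block trivially.\<close>

lemma refine_tri:
  assumes A: "A \<in> tri K leq" and refl: "\<And>i. i < K \<Longrightarrow> leq i i"
  shows "refine m A \<in> tri (K * m) (amp_le m leq)"
proof -
  have "amp_le m leq q p" if "p < K * m" "q < K * m" "refine m A $$ (p, q) \<noteq> 0" for p q
  proof -
    have *: "p mod m = q mod m" "A $$ (p div m, q div m) \<noteq> 0"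
      using that refine_nth[OF tri_carrier[OF A] that(1,2)] by (auto split: if_splits)
    then have "leq (q div m) (p div m)"
      using A that by (auto simp: tri_def less_mult_imp_div_less)
    moreover have "q div m = p div m \<Longrightarrow> q = p" using * by (metis div_mult_mod_eq)
    ultimately show ?thesis by (auto simp: amp_le_def)
  qed
  then show ?thesis using refine_carrier[OF tri_carrier[OF A]] by (auto simp: tri_def)
qed

lemma tri_mult:
  assumes A: "A \<in> tri K leq" and B: "B \<in> tri K leq" and trans: "\<And>i j k. leq i j \<Longrightarrow> leq j k \<Longrightarrow> leq i k"
  shows "A * B \<in> tri K leq"
proof -
  have "leq j i" if "i < K" "j < K" "(A * B) $$ (i, j) \<noteq> 0" for i j
  proof -
    have "(\<Sum>t<K. A $$ (i, t) * B $$ (t, j)) \<noteq> 0"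
      using that mult_mat_nth[OF tri_carrier[OF A] tri_carrier[OF B]] by simp
    then obtain t where "t < K" "A $$ (i, t) * B $$ (t, j) \<noteq> 0"
      by (meson lessThan_iff sum.not_neutral_contains_not_neutral)
    then show ?thesis using A B that trans[of j t i] by (auto simp: tri_def)
  qed
  then show ?thesis
    using mult_carrier_mat[OF tri_carrier[OF A] tri_carrier[OF B]] by (simp add: tri_def del: index_mult_mat)
qed

lemma dg_tri: "(\<And>i. i < K \<Longrightarrow> leq i i) \<Longrightarrow> dg K S \<in> tri K leq"
  by (auto simp: tri_def dg_def split: if_splits)

section \<open>The UHF algebra as a normed ring\<close>

lemma add_diff_add_mat:
  fixes A :: "'a :: ab_group_add mat"
  assumes "A \<in> carrier_mat n m" "B \<in> carrier_mat n m" "C \<in> carrier_mat n m" "D \<in> carrier_mat n m"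
  shows "(A + B) - (C + D) = (A - C) + (B - D)"
  using assms by (intro eq_matI) auto

lemma smult_diff_mat:
  fixes A :: "'a :: comm_ring_1 mat"
  assumes "A \<in> carrier_mat n m" "B \<in> carrier_mat n m"
  shows "c \<cdot>\<^sub>m A - c \<cdot>\<^sub>m B = c \<cdot>\<^sub>m (A - B)"
  using assms by (intro eq_matI) (auto simp: algebra_simps)

lemma mult_diff_mult_mat:
  fixes A :: "'a :: ring mat"
  assumes "A \<in> carrier_mat n m" "B \<in> carrier_mat m p" "C \<in> carrier_mat n m" "D \<in> carrier_mat m p"
  shows "A * B - C * D = A * (B - D) + (A - C) * D"
proof -
  have "P - R = (P - Q) + (Q - R)"
    if "P \<in> carrier_mat n p" "Q \<in> carrier_mat n p" "R \<in> carrier_mat n p" for P Q R :: "'a mat"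
    using that by (intro eq_matI) auto
  from this[of "A * B" "A * D" "C * D"] have "A * B - C * D = (A * B - A * D) + (A * D - C * D)"
    using assms mult_carrier_mat by blast
  then show ?thesis
    using mult_minus_distrib_mat[OF assms(1,2,4)] minus_mult_distrib_mat[OF assms(1,3,4)] by simp
qed

locale supernatural =
  fixes k :: "nat \<Rightarrow> nat"
  assumes k_pos: "0 < k n" and k_dvd_Suc: "k n dvd k (Suc n)"
begin

abbreviation mats :: "nat \<Rightarrow> complex mat set" where
  "mats n \<equiv> carrier_mat (k n) (k n)"

text \<open>The closed form of \<open>connecting\<close>: successive refinements compose to one by
  the quotient of the sizes.\<close>

definition up :: "nat \<Rightarrow> nat \<Rightarrow> complex mat \<Rightarrow> complex mat" where
  "up m n = refine (k n div k m)"

lemma k_dvd: "m \<le> n \<Longrightarrow> k m dvd k n"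
  by (induction n rule: dec_induct) (auto intro: dvd_trans k_dvd_Suc)

lemma k_mult: "m \<le> n \<Longrightarrow> k m * (k n div k m) = k n"
  by (simp add: k_dvd)

lemma k_div_pos: "m \<le> n \<Longrightarrow> 0 < k n div k m"
  using k_mult[of m n] k_pos[of n] by (metis mult_0_right not_gr_zero)

lemma connecting_eq: "m \<le> n \<Longrightarrow> connecting k m n A = up m n A"
proof (induction n rule: dec_induct)
  case base
  then show ?case using k_pos[of m] by (simp add: connecting_def up_def refine_1)
next
  case (step n)
  have "connecting k m (Suc n) A = refine (k (Suc n) div k n) (connecting k m n A)"
    using step by (simp add: connecting_def)
  also have "\<dots> = refine ((k n div k m) * (k (Suc n) div k n)) A"
    by (simp add: step.IH up_def refine_refine)
  also have "(k n div k m) * (k (Suc n) div k n) = k (Suc n) div k m"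
  proof -
    have "k m * ((k n div k m) * (k (Suc n) div k n)) = k m * (k (Suc n) div k m)"
      using k_mult[of m n] k_mult[of n "Suc n"] k_mult[of m "Suc n"] step by (metis le_SucI mult.assoc order_refl)
    then show ?thesis using k_pos[of m] by simp
  qed
  finally show ?case by (simp add: up_def)
qed

lemma up_up: "m \<le> n \<Longrightarrow> n \<le> p \<Longrightarrow> up n p (up m n A) = up m p A"
proof -
  assume "m \<le> n" "n \<le> p"
  have "k m * ((k n div k m) * (k p div k n)) = k m * (k p div k m)"
    using k_mult[of m n] k_mult[of n p] k_mult[of m p] \<open>m \<le> n\<close> \<open>n \<le> p\<close> by (metis le_trans mult.assoc)
  then have "(k n div k m) * (k p div k n) = k p div k m" using k_pos[of m] by simp
  then show ?thesis by (simp add: up_def refine_refine)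
qed

lemma up_carrier: "m \<le> n \<Longrightarrow> A \<in> mats m \<Longrightarrow> up m n A \<in> mats n"
  using refine_carrier[of A "k m" "k m" "k n div k m"] by (simp add: up_def k_mult)

lemma up_same: "up n n A = A"
  using k_pos[of n] by (simp add: up_def refine_1)

lemma op_norm_up: "m \<le> n \<Longrightarrow> A \<in> mats m \<Longrightarrow> op_norm (up m n A) = op_norm A"
  unfolding up_def by (rule op_norm_refine[OF _ k_div_pos])

lemma up_mult: "A \<in> mats m \<Longrightarrow> B \<in> mats m \<Longrightarrow> up m n (A * B) = up m n A * up m n B"
  unfolding up_def by (rule refine_mult)

lemma up_add: "A \<in> mats m \<Longrightarrow> B \<in> mats m \<Longrightarrow> up m n (A + B) = up m n A + up m n B"
  unfolding up_def by (rule refine_add)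

lemma up_minus: "A \<in> mats m \<Longrightarrow> B \<in> mats m \<Longrightarrow> up m n (A - B) = up m n A - up m n B"
  unfolding up_def by (rule refine_minus)

lemma up_smult: "up m n (c \<cdot>\<^sub>m A) = c \<cdot>\<^sub>m up m n A"
  unfolding up_def by (rule refine_smult)

lemma up_zero: "m \<le> n \<Longrightarrow> up m n (0\<^sub>m (k m) (k m)) = 0\<^sub>m (k n) (k n)"
  unfolding up_def by (simp add: k_mult)

lemma up_one: "m \<le> n \<Longrightarrow> up m n (1\<^sub>m (k m)) = 1\<^sub>m (k n)"
  unfolding up_def by (simp add: refine_one k_mult)

lemma seqs_iff: "X \<in> uhf_seqs k \<longleftrightarrow> (\<forall>n. X n \<in> mats n) \<and>
    (\<forall>\<epsilon>>0. \<exists>N. \<forall>m\<ge>N. \<forall>n\<ge>m. op_norm (X n - up m n (X m)) < \<epsilon>)"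
  unfolding uhf_seqs_def by (simp add: connecting_eq cong: imp_cong)

lemma seqs_carrier: "X \<in> uhf_seqs k \<Longrightarrow> X n \<in> mats n"
  unfolding uhf_seqs_def by blast

lemma seqs_cauchy:
  assumes "X \<in> uhf_seqs k" "0 < e"
  obtains N where "\<And>m n. N \<le> m \<Longrightarrow> m \<le> n \<Longrightarrow> op_norm (X n - up m n (X m)) < e"
  using assms unfolding seqs_iff by blast

lemma seqsI:
  assumes "\<And>n. X n \<in> mats n"
    and "\<And>e. 0 < e \<Longrightarrow> \<exists>N. \<forall>m\<ge>N. \<forall>n\<ge>m. op_norm (X n - up m n (X m)) < e"
  shows "X \<in> uhf_seqs k"
  using assms unfolding seqs_iff by blast

text \<open>The reverse triangle inequality across stages; the embedding preserves the norm of
  \<open>B\<close>. It makes the norms along a Cauchy sequence converge.\<close>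

lemma seqs_norm_diff:
  assumes "A \<in> mats n" "B \<in> mats m" "m \<le> n"
  shows "\<bar>op_norm A - op_norm B\<bar> \<le> op_norm (A - up m n B)"
proof -
  have B: "up m n B \<in> mats n" using assms up_carrier by blast
  have "A = (A - up m n B) + up m n B" "up m n B = (up m n B - A) + A"
    using assms(1) B by (auto intro!: eq_matI)
  then have "op_norm A \<le> op_norm (A - up m n B) + op_norm (up m n B)"
    "op_norm (up m n B) \<le> op_norm (up m n B - A) + op_norm A"
    using op_norm_triangle minus_carrier_mat assms(1) B by metis+
  then show ?thesis using op_norm_up[OF assms(3,2)] op_norm_minus_commute[OF assms(1) B] by linarith
qed

lemma seqs_convergent:
  assumes X: "X \<in> uhf_seqs k"
  shows "convergent (\<lambda>n. op_norm (X n))"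
proof -
  have "Cauchy (\<lambda>n. op_norm (X n))"
  proof (rule CauchyI')
    fix e :: real assume "0 < e"
    then obtain N where N: "\<And>m n. N \<le> m \<Longrightarrow> m \<le> n \<Longrightarrow> op_norm (X n - up m n (X m)) < e"
      using seqs_cauchy[OF X] by blast
    have "dist (op_norm (X m)) (op_norm (X n)) < e" if "N \<le> m" "m < n" for m n
      using seqs_norm_diff[OF seqs_carrier[OF X] seqs_carrier[OF X], of m n] N[of m n] that
      by (simp add: dist_real_def abs_minus_commute)
    then show "\<exists>M. \<forall>m\<ge>M. \<forall>n>m. dist (op_norm (X m)) (op_norm (X n)) < e" by blast
  qed
  then show ?thesis by (simp add: Cauchy_convergent_iff)
qed

lemma seqs_bounded:
  assumes X: "X \<in> uhf_seqs k"
  obtains B where "0 < B" "\<And>n. op_norm (X n) \<le> B"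
proof -
  have "Bseq (\<lambda>n. op_norm (X n))" using seqs_convergent[OF X] by (rule convergent_imp_Bseq)
  then show thesis using that unfolding Bseq_def by auto
qed

lemma seqs_add:
  assumes X: "X \<in> uhf_seqs k" and Y: "Y \<in> uhf_seqs k"
  shows "(\<lambda>n. X n + Y n) \<in> uhf_seqs k"
proof (rule seqsI)
  fix e :: real assume "0 < e"
  then have e: "0 < e / 2" by simp
  obtain N M where N: "\<And>m n. N \<le> m \<Longrightarrow> m \<le> n \<Longrightarrow> op_norm (X n - up m n (X m)) < e / 2"
    and M: "\<And>m n. M \<le> m \<Longrightarrow> m \<le> n \<Longrightarrow> op_norm (Y n - up m n (Y m)) < e / 2"
    using seqs_cauchy[OF X e] seqs_cauchy[OF Y e] by metis
  have "op_norm (X n + Y n - up m n (X m + Y m)) < e" if "max N M \<le> m" "m \<le> n" for m n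
  proof -
    note c = seqs_carrier[OF X, of n] seqs_carrier[OF Y, of n] up_carrier[OF that(2) seqs_carrier[OF X]]
      up_carrier[OF that(2) seqs_carrier[OF Y]]
    have "X n + Y n - up m n (X m + Y m) = (X n - up m n (X m)) + (Y n - up m n (Y m))"
      by (simp only: up_add[OF seqs_carrier[OF X] seqs_carrier[OF Y]] add_diff_add_mat[OF c])
    then have "op_norm (X n + Y n - up m n (X m + Y m))
        \<le> op_norm (X n - up m n (X m)) + op_norm (Y n - up m n (Y m))"
      using op_norm_triangle[OF minus_carrier_mat[OF c(3)] minus_carrier_mat[OF c(4)]] by simp
    then show ?thesis using N[of m n] M[of m n] that by simp
  qed
  then show "\<exists>N. \<forall>m\<ge>N. \<forall>n\<ge>m. op_norm (X n + Y n - up m n (X m + Y m)) < e" by blast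
qed (use assms seqs_carrier in auto)

lemma seqs_smult:
  assumes X: "X \<in> uhf_seqs k"
  shows "(\<lambda>n. c \<cdot>\<^sub>m X n) \<in> uhf_seqs k"
proof (rule seqsI)
  fix e :: real assume "0 < e"
  then have e: "0 < e / (cmod c + 1)" by (simp add: add_nonneg_pos)
  obtain N where N: "\<And>m n. N \<le> m \<Longrightarrow> m \<le> n \<Longrightarrow> op_norm (X n - up m n (X m)) < e / (cmod c + 1)"
    using seqs_cauchy[OF X e] by metis
  have "op_norm (c \<cdot>\<^sub>m X n - up m n (c \<cdot>\<^sub>m X m)) < e" if "N \<le> m" "m \<le> n" for m n
  proof -
    note c = seqs_carrier[OF X, of n] up_carrier[OF that(2) seqs_carrier[OF X]]
    have "c \<cdot>\<^sub>m X n - up m n (c \<cdot>\<^sub>m X m) = c \<cdot>\<^sub>m (X n - up m n (X m))"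
      by (simp only: up_smult smult_diff_mat[OF c])
    then have "op_norm (c \<cdot>\<^sub>m X n - up m n (c \<cdot>\<^sub>m X m)) \<le> cmod c * op_norm (X n - up m n (X m))"
      using op_norm_smult_le[OF minus_carrier_mat[OF c(2)]] by simp
    also have "\<dots> \<le> (cmod c + 1) * op_norm (X n - up m n (X m))" by (intro mult_right_mono) auto
    also have "\<dots> < (cmod c + 1) * (e / (cmod c + 1))"
      using N[OF that] by (intro mult_strict_left_mono) (auto simp: add_nonneg_pos)
    finally show ?thesis by (simp add: add_nonneg_eq_0_iff)
  qed
  then show "\<exists>N. \<forall>m\<ge>N. \<forall>n\<ge>m. op_norm (c \<cdot>\<^sub>m X n - up m n (c \<cdot>\<^sub>m X m)) < e" by blast
qed (use assms seqs_carrier in auto)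

lemma seqs_mult:
  assumes X: "X \<in> uhf_seqs k" and Y: "Y \<in> uhf_seqs k"
  shows "(\<lambda>n. X n * Y n) \<in> uhf_seqs k"
proof (rule seqsI)
  fix e :: real assume "0 < e"
  obtain B C where B: "0 < B" "\<And>n. op_norm (X n) \<le> B" and C: "0 < C" "\<And>n. op_norm (Y n) \<le> C"
    using seqs_bounded[OF X] seqs_bounded[OF Y] by metis
  define d where "d = e / (B + C)"
  have d: "0 < d" using \<open>0 < e\<close> B C by (simp add: d_def)
  obtain N M where N: "\<And>m n. N \<le> m \<Longrightarrow> m \<le> n \<Longrightarrow> op_norm (X n - up m n (X m)) < d"
    and M: "\<And>m n. M \<le> m \<Longrightarrow> m \<le> n \<Longrightarrow> op_norm (Y n - up m n (Y m)) < d"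
    using seqs_cauchy[OF X d] seqs_cauchy[OF Y d] by metis
  have "op_norm (X n * Y n - up m n (X m * Y m)) < e" if "max N M \<le> m" "m \<le> n" for m n
  proof -
    note c = seqs_carrier[OF X, of n] seqs_carrier[OF Y, of n] up_carrier[OF that(2) seqs_carrier[OF X]]
      up_carrier[OF that(2) seqs_carrier[OF Y]]
    define P Q where "P = X n - up m n (X m)" and "Q = Y n - up m n (Y m)"
    have PQ: "P \<in> mats n" "Q \<in> mats n" using c by (auto simp: P_def Q_def minus_carrier_mat)
    have "X n * Y n - up m n (X m * Y m) = X n * Q + P * up m n (Y m)"
      unfolding up_mult[OF seqs_carrier[OF X] seqs_carrier[OF Y]] P_def Q_def by (rule mult_diff_mult_mat[OF c])
    then have "op_norm (X n * Y n - up m n (X m * Y m)) \<le> op_norm (X n * Q) + op_norm (P * up m n (Y m))"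
      using op_norm_triangle[OF mult_carrier_mat[OF c(1) PQ(2)] mult_carrier_mat[OF PQ(1) c(4)]] by simp
    also have "\<dots> \<le> op_norm (X n) * op_norm Q + op_norm P * op_norm (Y m)"
      using op_norm_mult[OF c(1) PQ(2)] op_norm_mult[OF PQ(1) c(4)] op_norm_up[OF that(2) seqs_carrier[OF Y]] by simp
    also have "\<dots> \<le> B * op_norm Q + op_norm P * C"
      using B C by (intro add_mono mult_mono) (auto intro: less_imp_le)
    also have "\<dots> < B * d + d * C"
      using N[of m n] M[of m n] that B C
      by (intro add_strict_mono mult_strict_left_mono mult_strict_right_mono) (auto simp: P_def Q_def)
    also have "\<dots> = (B + C) * d" by (simp add: algebra_simps)
    also have "\<dots> = e" using B C by (simp add: d_def)
    finally show ?thesis .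
  qed
  then show "\<exists>N. \<forall>m\<ge>N. \<forall>n\<ge>m. op_norm (X n * Y n - up m n (X m * Y m)) < e" by blast
qed (use assms seqs_carrier mult_carrier_mat in blast)

definition emb_seq :: "nat \<Rightarrow> complex mat \<Rightarrow> nat \<Rightarrow> complex mat" where
  "emb_seq n A j = (if j < n then 0\<^sub>m (k j) (k j) else up n j A)"

lemma seqs_emb:
  assumes A: "A \<in> mats n"
  shows "emb_seq n A \<in> uhf_seqs k"
proof (rule seqsI)
  show "emb_seq n A j \<in> mats j" for j using up_carrier[OF _ A, of j] by (auto simp: emb_seq_def)
  have "op_norm (emb_seq n A j - up i j (emb_seq n A i)) = 0" if "n \<le> i" "i \<le> j" for i j
  proof -
    have "up n j A \<in> mats j" using up_carrier[OF _ A, of j] that by simp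
    then have "up n j A - up n j A = 0\<^sub>m (k j) (k j)" by simp
    then show ?thesis using that by (simp add: emb_seq_def up_up)
  qed
  then show "\<exists>N. \<forall>m\<ge>N. \<forall>i\<ge>m. op_norm (emb_seq n A i - up m i (emb_seq n A m)) < e" if "0 < e" for e
    using that by (intro exI[of _ n]) auto
qed

lemma seqs_zero: "(\<lambda>n. 0\<^sub>m (k n) (k n)) \<in> uhf_seqs k"
proof (rule seqsI)
  show "\<exists>N. \<forall>m\<ge>N. \<forall>n\<ge>m. op_norm (0\<^sub>m (k n) (k n) - up m n (0\<^sub>m (k m) (k m))) < e" if "0 < e" for e
    using that by (intro exI[of _ 0]) (simp add: up_zero minus_r_inv_mat[OF zero_carrier_mat])
qed auto

lemma seqs_one: "(\<lambda>n. 1\<^sub>m (k n)) \<in> uhf_seqs k"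
proof (rule seqsI)
  show "\<exists>N. \<forall>m\<ge>N. \<forall>n\<ge>m. op_norm (1\<^sub>m (k n) - up m n (1\<^sub>m (k m))) < e" if "0 < e" for e
    using that by (intro exI[of _ 0]) (simp add: up_one minus_r_inv_mat[OF one_carrier_mat])
qed auto

lemma seqs_minus:
  assumes X: "X \<in> uhf_seqs k" and Y: "Y \<in> uhf_seqs k"
  shows "(\<lambda>n. X n - Y n) \<in> uhf_seqs k"
proof -
  have "X n - Y n = X n + (- 1) \<cdot>\<^sub>m Y n" for n
    using seqs_carrier[OF X, of n] seqs_carrier[OF Y, of n] by (intro eq_matI) auto
  then show ?thesis using seqs_add[OF X seqs_smult[OF Y, of "- 1"]] by simp
qed

end

lemma tendsto_0_le_nonneg:
  fixes f g :: "'a \<Rightarrow> real"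
  assumes "(g \<longlongrightarrow> 0) F" "\<And>x. 0 \<le> f x" "\<And>x. f x \<le> g x"
  shows "(f \<longlongrightarrow> 0) F"
  using assms by (intro tendsto_sandwich[OF _ _ tendsto_const assms(1)] always_eventually) auto

context supernatural
begin

definition cls :: "(nat \<Rightarrow> complex mat) \<Rightarrow> uhf_element" where
  "cls X = uhf_eq k `` {X}"

abbreviation U :: "uhf_element normed_alg" where
  "U \<equiv> uhf_algebra k"

abbreviation nrm :: "uhf_element \<Rightarrow> real" where
  "nrm \<equiv> alg_norm U"

lemma uhf_eq_iff: "(X, Y) \<in> uhf_eq k \<longleftrightarrow> X \<in> uhf_seqs k \<and> Y \<in> uhf_seqs k \<and>
    (\<lambda>n. op_norm (X n - Y n)) \<longlonglongrightarrow> 0"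
  by (simp add: uhf_eq_def)

lemma equiv_uhf_eq: "equiv (uhf_seqs k) (uhf_eq k)"
proof (rule equivI)
  show "uhf_eq k \<subseteq> uhf_seqs k \<times> uhf_seqs k" by (auto simp: uhf_eq_iff)
  have "X n - X n = 0\<^sub>m (k n) (k n)" if "X \<in> uhf_seqs k" for X n
    using minus_r_inv_mat[OF seqs_carrier[OF that]] .
  then show "refl_on (uhf_seqs k) (uhf_eq k)" by (auto simp: refl_on_def uhf_eq_iff)
  show "sym (uhf_eq k)"
  proof (rule symI)
    fix X Y assume XY: "(X, Y) \<in> uhf_eq k"
    then have "X \<in> uhf_seqs k" "Y \<in> uhf_seqs k" by (auto simp: uhf_eq_iff)
    then have "op_norm (Y n - X n) = op_norm (X n - Y n)" for n
      using op_norm_minus_commute[OF seqs_carrier seqs_carrier] by blast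
    then show "(Y, X) \<in> uhf_eq k" using XY by (simp add: uhf_eq_iff)
  qed
  show "trans (uhf_eq k)"
  proof (rule transI)
    fix X Y Z assume XYZ: "(X, Y) \<in> uhf_eq k" "(Y, Z) \<in> uhf_eq k"
    then have seqs: "X \<in> uhf_seqs k" "Y \<in> uhf_seqs k" "Z \<in> uhf_seqs k" by (auto simp: uhf_eq_iff)
    have "(\<lambda>n. op_norm (X n - Y n) + op_norm (Y n - Z n)) \<longlonglongrightarrow> 0"
      using tendsto_add[of "\<lambda>n. op_norm (X n - Y n)" 0 sequentially "\<lambda>n. op_norm (Y n - Z n)" 0] XYZ
      by (simp add: uhf_eq_iff)
    then have "(\<lambda>n. op_norm (X n - Z n)) \<longlonglongrightarrow> 0"
      by (rule tendsto_0_le_nonneg[OF _ op_norm_nonneg op_norm_triangle_minus[OF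
        seqs_carrier[OF seqs(1)] seqs_carrier[OF seqs(2)] seqs_carrier[OF seqs(3)]]])
    then show "(X, Z) \<in> uhf_eq k" using seqs by (simp add: uhf_eq_iff)
  qed
qed

lemma cls_eq_iff:
  "X \<in> uhf_seqs k \<Longrightarrow> Y \<in> uhf_seqs k \<Longrightarrow> cls X = cls Y \<longleftrightarrow> (\<lambda>n. op_norm (X n - Y n)) \<longlonglongrightarrow> 0"
  unfolding cls_def by (subst eq_equiv_class_iff[OF equiv_uhf_eq]) (auto simp: uhf_eq_iff)

lemma cls_eqI:
  "X \<in> uhf_seqs k \<Longrightarrow> Y \<in> uhf_seqs k \<Longrightarrow> (\<lambda>n. op_norm (X n - Y n)) \<longlonglongrightarrow> 0 \<Longrightarrow> cls X = cls Y"
  by (simp add: cls_eq_iff)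

lemma carrier_U: "carrier U = cls ` uhf_seqs k"
  by (auto simp: uhf_algebra_def quotient_def cls_def)

lemma cls_in_carrier: "X \<in> uhf_seqs k \<Longrightarrow> cls X \<in> carrier U"
  by (simp add: carrier_U)

lemma carrierE:
  assumes "x \<in> carrier U" obtains X where "X \<in> uhf_seqs k" "x = cls X"
  using assms by (auto simp: carrier_U)

lemma add_cls:
  assumes "X \<in> uhf_seqs k" "Y \<in> uhf_seqs k"
  shows "cls X \<oplus>\<^bsub>U\<^esub> cls Y = cls (\<lambda>n. X n + Y n)"
proof -
  have "congruent2 (uhf_eq k) (uhf_eq k) (\<lambda>X Y. uhf_eq k `` {\<lambda>n. X n + Y n})"
  proof (rule congruent2I[OF equiv_uhf_eq equiv_uhf_eq])
    have *: "cls (\<lambda>n. Y n + X n) = cls (\<lambda>n. Z n + X n)" "cls (\<lambda>n. X n + Y n) = cls (\<lambda>n. X n + Z n)"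
      if YZ: "(Y, Z) \<in> uhf_eq k" and X: "X \<in> uhf_seqs k" for X Y Z
    proof -
      have Y: "Y \<in> uhf_seqs k" and Z: "Z \<in> uhf_seqs k" using YZ by (auto simp: uhf_eq_iff)
      have "Y n + X n - (Z n + X n) = Y n - Z n" "X n + Y n - (X n + Z n) = Y n - Z n" for n
        using seqs_carrier[OF X, of n] seqs_carrier[OF Y, of n] seqs_carrier[OF Z, of n]
        by (auto intro!: eq_matI)
      then show "cls (\<lambda>n. Y n + X n) = cls (\<lambda>n. Z n + X n)" "cls (\<lambda>n. X n + Y n) = cls (\<lambda>n. X n + Z n)"
        using YZ by (intro cls_eqI seqs_add X Y Z; simp add: uhf_eq_iff)+
    qed
    show "uhf_eq k `` {\<lambda>n. Y n + X n} = uhf_eq k `` {\<lambda>n. Z n + X n}"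
      if "X \<in> uhf_seqs k" "(Y, Z) \<in> uhf_eq k" for X Y Z using *(1)[OF that(2,1)] by (simp add: cls_def)
    show "uhf_eq k `` {\<lambda>n. X n + Y n} = uhf_eq k `` {\<lambda>n. X n + Z n}"
      if "X \<in> uhf_seqs k" "(Y, Z) \<in> uhf_eq k" for X Y Z using *(2)[OF that(2,1)] by (simp add: cls_def)
  qed
  from UN_equiv_class2[OF equiv_uhf_eq equiv_uhf_eq this assms]
  show ?thesis by (simp add: uhf_algebra_def cls_def)
qed

lemma mult_cls:
  assumes "X \<in> uhf_seqs k" "Y \<in> uhf_seqs k"
  shows "cls X \<otimes>\<^bsub>U\<^esub> cls Y = cls (\<lambda>n. X n * Y n)"
proof -
  have "congruent2 (uhf_eq k) (uhf_eq k) (\<lambda>X Y. uhf_eq k `` {\<lambda>n. X n * Y n})"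
  proof (rule congruent2I[OF equiv_uhf_eq equiv_uhf_eq])
    fix X Y Z assume X: "X \<in> uhf_seqs k" and YZ: "(Y, Z) \<in> uhf_eq k"
    have Y: "Y \<in> uhf_seqs k" and Z: "Z \<in> uhf_seqs k" using YZ by (auto simp: uhf_eq_iff)
    note c = seqs_carrier[OF X] seqs_carrier[OF Y] seqs_carrier[OF Z]
    obtain B where B: "0 < B" "\<And>n. op_norm (X n) \<le> B" using seqs_bounded[OF X] by metis
    have lim: "(\<lambda>n. B * op_norm (Y n - Z n)) \<longlonglongrightarrow> 0"
      using tendsto_mult_right_zero YZ by (auto simp: uhf_eq_iff)
    have "op_norm (Y n * X n - Z n * X n) \<le> B * op_norm (Y n - Z n)" for n
    proof -
      have "op_norm (Y n * X n - Z n * X n) \<le> op_norm (Y n - Z n) * op_norm (X n)"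
        using minus_mult_distrib_mat[OF c(2,3,1)] op_norm_mult[OF minus_carrier_mat[OF c(3)] c(1)] by metis
      also have "\<dots> \<le> op_norm (Y n - Z n) * B" by (intro mult_left_mono B op_norm_nonneg)
      finally show ?thesis by (simp add: mult.commute)
    qed
    then have "(\<lambda>n. op_norm (Y n * X n - Z n * X n)) \<longlonglongrightarrow> 0"
      by (intro tendsto_0_le_nonneg[OF lim]) auto
    then have "cls (\<lambda>n. Y n * X n) = cls (\<lambda>n. Z n * X n)" by (intro cls_eqI seqs_mult X Y Z)
    then show "uhf_eq k `` {\<lambda>n. Y n * X n} = uhf_eq k `` {\<lambda>n. Z n * X n}" by (simp add: cls_def)
    have "op_norm (X n * Y n - X n * Z n) \<le> B * op_norm (Y n - Z n)" for n
    proof -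
      have "op_norm (X n * Y n - X n * Z n) \<le> op_norm (X n) * op_norm (Y n - Z n)"
        using mult_minus_distrib_mat[OF c(1,2,3)] op_norm_mult[OF c(1) minus_carrier_mat[OF c(3)]] by metis
      also have "\<dots> \<le> B * op_norm (Y n - Z n)" by (intro mult_right_mono B op_norm_nonneg)
      finally show ?thesis .
    qed
    then have "(\<lambda>n. op_norm (X n * Y n - X n * Z n)) \<longlonglongrightarrow> 0"
      by (intro tendsto_0_le_nonneg[OF lim]) auto
    then have "cls (\<lambda>n. X n * Y n) = cls (\<lambda>n. X n * Z n)" by (intro cls_eqI seqs_mult X Y Z)
    then show "uhf_eq k `` {\<lambda>n. X n * Y n} = uhf_eq k `` {\<lambda>n. X n * Z n}" by (simp add: cls_def)
  qed
  from UN_equiv_class2[OF equiv_uhf_eq equiv_uhf_eq this assms]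
  show ?thesis by (simp add: uhf_algebra_def cls_def)
qed

lemma smult_cls:
  assumes "X \<in> uhf_seqs k"
  shows "c \<odot>\<^bsub>U\<^esub> cls X = cls (\<lambda>n. c \<cdot>\<^sub>m X n)"
proof -
  have "congruent (uhf_eq k) (\<lambda>X. uhf_eq k `` {\<lambda>n. c \<cdot>\<^sub>m X n})"
  proof (rule congruentI)
    fix Y Z assume YZ: "(Y, Z) \<in> uhf_eq k"
    have Y: "Y \<in> uhf_seqs k" and Z: "Z \<in> uhf_seqs k" using YZ by (auto simp: uhf_eq_iff)
    have lim: "(\<lambda>n. cmod c * op_norm (Y n - Z n)) \<longlonglongrightarrow> 0"
      using tendsto_mult_right_zero YZ by (auto simp: uhf_eq_iff)
    have "op_norm (c \<cdot>\<^sub>m Y n - c \<cdot>\<^sub>m Z n) \<le> cmod c * op_norm (Y n - Z n)" for n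
      unfolding smult_diff_mat[OF seqs_carrier[OF Y] seqs_carrier[OF Z]]
      by (rule op_norm_smult_le[OF minus_carrier_mat[OF seqs_carrier[OF Z]]])
    then have "(\<lambda>n. op_norm (c \<cdot>\<^sub>m Y n - c \<cdot>\<^sub>m Z n)) \<longlonglongrightarrow> 0"
      by (intro tendsto_0_le_nonneg[OF lim]) auto
    then have "cls (\<lambda>n. c \<cdot>\<^sub>m Y n) = cls (\<lambda>n. c \<cdot>\<^sub>m Z n)" by (intro cls_eqI seqs_smult Y Z)
    then show "uhf_eq k `` {\<lambda>n. c \<cdot>\<^sub>m Y n} = uhf_eq k `` {\<lambda>n. c \<cdot>\<^sub>m Z n}" by (simp add: cls_def)
  qed
  from UN_equiv_class[OF equiv_uhf_eq this assms]
  show ?thesis by (simp add: uhf_algebra_def cls_def)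
qed

lemma one_cls: "\<one>\<^bsub>U\<^esub> = cls (\<lambda>n. 1\<^sub>m (k n))"
  by (simp add: uhf_algebra_def cls_def)

lemma zero_cls: "\<zero>\<^bsub>U\<^esub> = cls (\<lambda>n. 0\<^sub>m (k n) (k n))"
  by (simp add: uhf_algebra_def cls_def)

lemmas cls_ops = add_cls mult_cls one_cls zero_cls seqs_add seqs_mult seqs_one seqs_zero

lemma add_uminus_cls:
  assumes Y: "Y \<in> uhf_seqs k"
  shows "cls (\<lambda>n. (- 1) \<cdot>\<^sub>m Y n) \<oplus>\<^bsub>U\<^esub> cls Y = \<zero>\<^bsub>U\<^esub>"
proof -
  have "(- 1) \<cdot>\<^sub>m Y n + Y n = 0\<^sub>m (k n) (k n)" for n
    using seqs_carrier[OF Y, of n] by (intro eq_matI) auto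
  then show ?thesis by (simp add: cls_ops seqs_smult Y)
qed

lemma ring_U: "ring U"
proof (rule ringI)
  show "abelian_group U"
  proof (rule abelian_groupI)
    fix x y z assume xyz: "x \<in> carrier U" "y \<in> carrier U" "z \<in> carrier U"
    obtain X Y Z where XYZ: "X \<in> uhf_seqs k" "x = cls X" "Y \<in> uhf_seqs k" "y = cls Y"
        "Z \<in> uhf_seqs k" "z = cls Z"
      by (rule carrierE[OF xyz(1)], rule carrierE[OF xyz(2)], rule carrierE[OF xyz(3)])
    note c = seqs_carrier[OF XYZ(1)] seqs_carrier[OF XYZ(3)] seqs_carrier[OF XYZ(5)]
    show "x \<oplus>\<^bsub>U\<^esub> y \<in> carrier U" by (simp add: XYZ cls_ops cls_in_carrier)
    show "x \<oplus>\<^bsub>U\<^esub> y \<oplus>\<^bsub>U\<^esub> z = x \<oplus>\<^bsub>U\<^esub> (y \<oplus>\<^bsub>U\<^esub> z)"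
      by (simp add: XYZ cls_ops assoc_add_mat[OF c])
    show "x \<oplus>\<^bsub>U\<^esub> y = y \<oplus>\<^bsub>U\<^esub> x"
      by (simp add: XYZ cls_ops comm_add_mat[OF c(1,2)])
    show "\<zero>\<^bsub>U\<^esub> \<oplus>\<^bsub>U\<^esub> x = x" by (simp add: XYZ cls_ops left_add_zero_mat[OF c(1)])
    show "\<exists>y\<in>carrier U. y \<oplus>\<^bsub>U\<^esub> x = \<zero>\<^bsub>U\<^esub>"
      using add_uminus_cls[OF XYZ(1)] cls_in_carrier[OF seqs_smult[OF XYZ(1)]] XYZ(2) by blast
  qed (simp add: cls_ops cls_in_carrier)
  show "Group.monoid U"
  proof (rule monoidI)
    fix x y z assume xyz: "x \<in> carrier U" "y \<in> carrier U" "z \<in> carrier U"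
    obtain X Y Z where XYZ: "X \<in> uhf_seqs k" "x = cls X" "Y \<in> uhf_seqs k" "y = cls Y"
        "Z \<in> uhf_seqs k" "z = cls Z"
      by (rule carrierE[OF xyz(1)], rule carrierE[OF xyz(2)], rule carrierE[OF xyz(3)])
    note c = seqs_carrier[OF XYZ(1)] seqs_carrier[OF XYZ(3)] seqs_carrier[OF XYZ(5)]
    show "x \<otimes>\<^bsub>U\<^esub> y \<in> carrier U" by (simp add: XYZ cls_ops cls_in_carrier)
    show "x \<otimes>\<^bsub>U\<^esub> y \<otimes>\<^bsub>U\<^esub> z = x \<otimes>\<^bsub>U\<^esub> (y \<otimes>\<^bsub>U\<^esub> z)"
      by (simp add: XYZ cls_ops assoc_mult_mat[OF c])
    show "\<one>\<^bsub>U\<^esub> \<otimes>\<^bsub>U\<^esub> x = x" by (simp add: XYZ cls_ops left_mult_one_mat[OF c(1)])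
    show "x \<otimes>\<^bsub>U\<^esub> \<one>\<^bsub>U\<^esub> = x" by (simp add: XYZ cls_ops right_mult_one_mat[OF c(1)])
  qed (simp add: cls_ops cls_in_carrier)
  fix x y z assume xyz: "x \<in> carrier U" "y \<in> carrier U" "z \<in> carrier U"
  obtain X Y Z where XYZ: "X \<in> uhf_seqs k" "x = cls X" "Y \<in> uhf_seqs k" "y = cls Y"
      "Z \<in> uhf_seqs k" "z = cls Z"
    by (rule carrierE[OF xyz(1)], rule carrierE[OF xyz(2)], rule carrierE[OF xyz(3)])
  note c = seqs_carrier[OF XYZ(1)] seqs_carrier[OF XYZ(3)] seqs_carrier[OF XYZ(5)]
  show "(x \<oplus>\<^bsub>U\<^esub> y) \<otimes>\<^bsub>U\<^esub> z = x \<otimes>\<^bsub>U\<^esub> z \<oplus>\<^bsub>U\<^esub> y \<otimes>\<^bsub>U\<^esub> z"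
    by (simp add: XYZ cls_ops add_mult_distrib_mat[OF c])
  show "z \<otimes>\<^bsub>U\<^esub> (x \<oplus>\<^bsub>U\<^esub> y) = z \<otimes>\<^bsub>U\<^esub> x \<oplus>\<^bsub>U\<^esub> z \<otimes>\<^bsub>U\<^esub> y"
    by (simp add: XYZ cls_ops mult_add_distrib_mat[OF c(3,1,2)])
qed

end

sublocale supernatural \<subseteq> U: ring "uhf_algebra k"
  by (rule ring_U)

context supernatural
begin

lemma minus_cls:
  assumes X: "X \<in> uhf_seqs k" and Y: "Y \<in> uhf_seqs k"
  shows "cls X \<ominus>\<^bsub>U\<^esub> cls Y = cls (\<lambda>n. X n - Y n)"
proof -
  have "\<ominus>\<^bsub>U\<^esub> cls Y = cls (\<lambda>n. (- 1) \<cdot>\<^sub>m Y n)"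
    by (rule U.minus_equality[OF add_uminus_cls[OF Y]]) (auto intro: cls_in_carrier seqs_smult Y)
  moreover have "X n + (- 1) \<cdot>\<^sub>m Y n = X n - Y n" for n
    using seqs_carrier[OF X, of n] seqs_carrier[OF Y, of n] by (intro eq_matI) auto
  ultimately show ?thesis by (simp add: a_minus_def cls_ops X Y seqs_smult)
qed

text \<open>The description by \<open>THE\<close> is meaningful because representatives of one class
  differ by a null sequence and so have the same limit of norms.\<close>

lemma nrm_cls:
  assumes X: "X \<in> uhf_seqs k"
  shows "(\<lambda>n. op_norm (X n)) \<longlonglongrightarrow> nrm (cls X)"
proof -
  obtain r where r: "(\<lambda>n. op_norm (X n)) \<longlonglongrightarrow> r"
    using seqs_convergent[OF X] by (auto simp: convergent_def)
  have all: "(\<lambda>n. op_norm (Y n)) \<longlonglongrightarrow> r" if "Y \<in> cls X" for Y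
  proof -
    have Y: "Y \<in> uhf_seqs k" and lim: "(\<lambda>n. op_norm (X n - Y n)) \<longlonglongrightarrow> 0"
      using that by (auto simp: cls_def uhf_eq_iff)
    have "\<bar>op_norm (X n) - op_norm (Y n)\<bar> \<le> op_norm (X n - Y n)" for n
      using seqs_norm_diff[OF seqs_carrier[OF X] seqs_carrier[OF Y] order_refl, of n] by (simp add: up_same)
    then have "(\<lambda>n. \<bar>op_norm (X n) - op_norm (Y n)\<bar>) \<longlonglongrightarrow> 0"
      by (intro tendsto_0_le_nonneg[OF lim]) auto
    then have "(\<lambda>n. op_norm (X n) - op_norm (Y n)) \<longlonglongrightarrow> 0" by (rule tendsto_rabs_zero_cancel)
    from tendsto_diff[OF r this] show ?thesis by simp
  qed
  have "X \<in> cls X" using equiv_class_self[OF equiv_uhf_eq X] by (simp add: cls_def)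
  have "(THE r. \<forall>Y\<in>cls X. (\<lambda>n. op_norm (Y n)) \<longlonglongrightarrow> r) = r"
    by (rule the_equality) (use all \<open>X \<in> cls X\<close> r LIMSEQ_unique in blast)+
  then show ?thesis using r by (simp add: uhf_algebra_def)
qed

lemma nrm_eqI: "X \<in> uhf_seqs k \<Longrightarrow> (\<lambda>n. op_norm (X n)) \<longlonglongrightarrow> r \<Longrightarrow> nrm (cls X) = r"
  using nrm_cls LIMSEQ_unique by blast

lemma nrm_nonneg: "x \<in> carrier U \<Longrightarrow> 0 \<le> nrm x"
  by (erule carrierE) (auto intro: LIMSEQ_le_const[OF nrm_cls])

lemma nrm_add_le:
  assumes "x \<in> carrier U" "y \<in> carrier U"
  shows "nrm (x \<oplus>\<^bsub>U\<^esub> y) \<le> nrm x + nrm y"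
proof -
  obtain X Y where XY: "X \<in> uhf_seqs k" "x = cls X" "Y \<in> uhf_seqs k" "y = cls Y"
    by (rule carrierE[OF assms(1)], rule carrierE[OF assms(2)])
  show ?thesis
    unfolding XY add_cls[OF XY(1,3)]
    using op_norm_triangle[OF seqs_carrier[OF XY(1)] seqs_carrier[OF XY(3)]]
    by (intro LIMSEQ_le[OF nrm_cls[OF seqs_add[OF XY(1,3)]] tendsto_add[OF nrm_cls[OF XY(1)] nrm_cls[OF XY(3)]]])
      auto
qed

lemma nrm_mult_le:
  assumes "x \<in> carrier U" "y \<in> carrier U"
  shows "nrm (x \<otimes>\<^bsub>U\<^esub> y) \<le> nrm x * nrm y"
proof -
  obtain X Y where XY: "X \<in> uhf_seqs k" "x = cls X" "Y \<in> uhf_seqs k" "y = cls Y"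
    by (rule carrierE[OF assms(1)], rule carrierE[OF assms(2)])
  show ?thesis
    unfolding XY mult_cls[OF XY(1,3)]
    using op_norm_mult[OF seqs_carrier[OF XY(1)] seqs_carrier[OF XY(3)]]
    by (intro LIMSEQ_le[OF nrm_cls[OF seqs_mult[OF XY(1,3)]] tendsto_mult[OF nrm_cls[OF XY(1)] nrm_cls[OF XY(3)]]])
      auto
qed

lemma nrm_minus_commute:
  assumes "x \<in> carrier U" "y \<in> carrier U"
  shows "nrm (x \<ominus>\<^bsub>U\<^esub> y) = nrm (y \<ominus>\<^bsub>U\<^esub> x)"
proof -
  obtain X Y where XY: "X \<in> uhf_seqs k" "x = cls X" "Y \<in> uhf_seqs k" "y = cls Y"
    by (rule carrierE[OF assms(1)], rule carrierE[OF assms(2)])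
  have "op_norm (X n - Y n) = op_norm (Y n - X n)" for n
    by (rule op_norm_minus_commute[OF seqs_carrier[OF XY(1)] seqs_carrier[OF XY(3)]])
  then show ?thesis
    unfolding XY minus_cls[OF XY(1,3)] minus_cls[OF XY(3,1)]
    using nrm_cls[OF seqs_minus[OF XY(3,1)]] by (intro nrm_eqI seqs_minus XY) simp
qed

lemma nrm_triangle:
  assumes "x \<in> carrier U" "y \<in> carrier U" "z \<in> carrier U"
  shows "nrm (x \<ominus>\<^bsub>U\<^esub> z) \<le> nrm (x \<ominus>\<^bsub>U\<^esub> y) + nrm (y \<ominus>\<^bsub>U\<^esub> z)"
proof -
  have "x \<ominus>\<^bsub>U\<^esub> z = (x \<ominus>\<^bsub>U\<^esub> y) \<oplus>\<^bsub>U\<^esub> (y \<ominus>\<^bsub>U\<^esub> z)"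
    using assms by (simp add: a_minus_def U.a_ac U.r_neg1 U.r_neg2)
  then show ?thesis using nrm_add_le[of "x \<ominus>\<^bsub>U\<^esub> y" "y \<ominus>\<^bsub>U\<^esub> z"] assms by simp
qed

lemma nrm_zero: "nrm \<zero>\<^bsub>U\<^esub> = 0"
  unfolding zero_cls by (intro nrm_eqI seqs_zero) simp

lemma nrm_eq_0:
  assumes "x \<in> carrier U" "nrm x = 0"
  shows "x = \<zero>\<^bsub>U\<^esub>"
proof -
  obtain X where X: "X \<in> uhf_seqs k" "x = cls X" using assms(1) by (rule carrierE)
  have "X n - 0\<^sub>m (k n) (k n) = X n" for n using seqs_carrier[OF X(1), of n] by (intro eq_matI) auto
  then show ?thesis using nrm_cls[OF X(1)] assms(2) X
    by (simp add: zero_cls cls_eq_iff seqs_zero)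
qed

lemma nrm_le_diff:
  assumes "x \<in> carrier U" "y \<in> carrier U"
  shows "nrm x \<le> nrm (x \<ominus>\<^bsub>U\<^esub> y) + nrm y"
proof -
  have "x = (x \<ominus>\<^bsub>U\<^esub> y) \<oplus>\<^bsub>U\<^esub> y" using assms by (simp add: a_minus_def U.a_assoc U.l_neg)
  then show ?thesis using nrm_add_le[of "x \<ominus>\<^bsub>U\<^esub> y" y] assms by simp
qed

section \<open>Finite stages inside the UHF algebra\<close>

definition emb :: "nat \<Rightarrow> complex mat \<Rightarrow> uhf_element" where
  "emb n A = cls (emb_seq n A)"

lemma uhf_embed_eq: "uhf_embed k n A = emb n A"
proof -
  have "(\<lambda>j. if j < n then 0\<^sub>m (k j) (k j) else connecting k n j A) = emb_seq n A"
    by (auto simp: emb_seq_def fun_eq_iff connecting_eq)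
  then show ?thesis by (simp add: uhf_embed_def emb_def cls_def)
qed

lemma emb_carrier: "A \<in> mats n \<Longrightarrow> emb n A \<in> carrier U"
  unfolding emb_def by (intro cls_in_carrier seqs_emb)

lemma cls_eventually_eqI:
  assumes X: "X \<in> uhf_seqs k" and Y: "Y \<in> uhf_seqs k" and eq: "\<And>n. N \<le> n \<Longrightarrow> X n = Y n"
  shows "cls X = cls Y"
proof (rule cls_eqI[OF X Y])
  have "op_norm (X n - Y n) = 0" if "N \<le> n" for n
    using eq[OF that] minus_r_inv_mat[OF seqs_carrier[OF Y, of n]] by simp
  then show "(\<lambda>n. op_norm (X n - Y n)) \<longlonglongrightarrow> 0"
    by (intro tendsto_eventually eventually_sequentiallyI[of N]) simp
qed

lemma emb_mult:
  assumes A: "A \<in> mats n" and B: "B \<in> mats n"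
  shows "emb n A \<otimes>\<^bsub>U\<^esub> emb n B = emb n (A * B)"
  unfolding emb_def mult_cls[OF seqs_emb[OF A] seqs_emb[OF B]]
  by (rule cls_eventually_eqI[OF seqs_mult[OF seqs_emb[OF A] seqs_emb[OF B]] seqs_emb[OF mult_carrier_mat[OF A B]], of n])
    (simp add: emb_seq_def up_mult[OF A B])

lemma emb_add:
  assumes A: "A \<in> mats n" and B: "B \<in> mats n"
  shows "emb n A \<oplus>\<^bsub>U\<^esub> emb n B = emb n (A + B)"
  unfolding emb_def add_cls[OF seqs_emb[OF A] seqs_emb[OF B]]
  by (rule cls_eventually_eqI[OF seqs_add[OF seqs_emb[OF A] seqs_emb[OF B]] seqs_emb[OF add_carrier_mat[OF B]], of n])
    (simp add: emb_seq_def up_add[OF A B])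

lemma emb_minus:
  assumes A: "A \<in> mats n" and B: "B \<in> mats n"
  shows "emb n A \<ominus>\<^bsub>U\<^esub> emb n B = emb n (A - B)"
  unfolding emb_def minus_cls[OF seqs_emb[OF A] seqs_emb[OF B]]
  by (rule cls_eventually_eqI[OF seqs_minus[OF seqs_emb[OF A] seqs_emb[OF B]] seqs_emb[OF minus_carrier_mat[OF B]], of n])
    (simp add: emb_seq_def up_minus[OF A B])

lemma emb_up: "m \<le> n \<Longrightarrow> A \<in> mats m \<Longrightarrow> emb n (up m n A) = emb m A"
  unfolding emb_def
  by (rule cls_eventually_eqI[of _ _ n]) (auto intro!: seqs_emb up_carrier simp: emb_seq_def up_up)

lemma emb_one: "emb n (1\<^sub>m (k n)) = \<one>\<^bsub>U\<^esub>"
  unfolding emb_def one_cls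
  by (rule cls_eventually_eqI[of _ _ n]) (auto intro!: seqs_emb seqs_one simp: emb_seq_def up_one)

lemma emb_zero: "emb n (0\<^sub>m (k n) (k n)) = \<zero>\<^bsub>U\<^esub>"
  unfolding emb_def zero_cls
  by (rule cls_eventually_eqI[of _ _ n]) (auto intro!: seqs_emb seqs_zero simp: emb_seq_def up_zero)

lemma nrm_emb: "A \<in> mats n \<Longrightarrow> nrm (emb n A) = op_norm A"
  unfolding emb_def
  by (intro nrm_eqI seqs_emb tendsto_eventually eventually_sequentiallyI[of n]) (auto simp: emb_seq_def op_norm_up)

lemma emb_eq_0_iff:
  assumes A: "A \<in> mats n"
  shows "emb n A = \<zero>\<^bsub>U\<^esub> \<longleftrightarrow> A = 0\<^sub>m (k n) (k n)"
proof
  assume "emb n A = \<zero>\<^bsub>U\<^esub>"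
  then have "op_norm A = 0" using nrm_emb[OF A] nrm_zero by simp
  then have "A $$ (i, j) = 0" if "i < k n" "j < k n" for i j
    using op_norm_entry[OF A that] by simp
  then show "A = 0\<^sub>m (k n) (k n)" using A by (intro eq_matI) auto
qed (simp add: emb_zero)

text \<open>The terms of a representing Cauchy sequence are themselves the approximants.
  Approximation holds at every late stage, which later allows one stage to be chosen for several
  elements.\<close>

lemma emb_dense:
  assumes x: "x \<in> carrier U" and e: "0 < e"
  obtains N where "\<And>n. N \<le> n \<Longrightarrow> \<exists>A\<in>mats n. nrm (x \<ominus>\<^bsub>U\<^esub> emb n A) < e"
proof -
  obtain X where X: "X \<in> uhf_seqs k" "x = cls X" using x by (rule carrierE)
  obtain N where N: "\<And>m n. N \<le> m \<Longrightarrow> m \<le> n \<Longrightarrow> op_norm (X n - up m n (X m)) < e / 2"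
    using seqs_cauchy[OF X(1), of "e / 2"] e by auto
  have "nrm (x \<ominus>\<^bsub>U\<^esub> emb n (X n)) < e" if "N \<le> n" for n
  proof -
    have emb: "emb_seq n (X n) \<in> uhf_seqs k" by (intro seqs_emb seqs_carrier X)
    have "nrm (x \<ominus>\<^bsub>U\<^esub> emb n (X n)) \<le> e / 2"
      unfolding X(2) emb_def minus_cls[OF X(1) emb]
    proof (rule LIMSEQ_le_const2[OF nrm_cls[OF seqs_minus[OF X(1) emb]]], intro exI[of _ n] allI impI)
      fix j assume "n \<le> j"
      then show "op_norm (X j - emb_seq n (X n) j) \<le> e / 2"
        using N[OF that] by (simp add: emb_seq_def less_imp_le)
    qed
    then show ?thesis using e by simp
  qed
  then show thesis using that seqs_carrier[OF X(1)] by blast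
qed

end

context supernatural
begin

lemma minus_add_minus:
  assumes "x \<in> carrier U" "y \<in> carrier U" "z \<in> carrier U"
  shows "(x \<ominus>\<^bsub>U\<^esub> y) \<oplus>\<^bsub>U\<^esub> (y \<ominus>\<^bsub>U\<^esub> z) = x \<ominus>\<^bsub>U\<^esub> z"
  using assms by (simp add: a_minus_def U.a_ac U.r_neg1 U.r_neg2)

lemma minus_zero [simp]: "x \<in> carrier U \<Longrightarrow> x \<ominus>\<^bsub>U\<^esub> \<zero>\<^bsub>U\<^esub> = x"
  by (simp add: a_minus_def)

lemma mult_diff_mult:
  assumes "x \<in> carrier U" "y \<in> carrier U" "a \<in> carrier U" "b \<in> carrier U"
  shows "x \<otimes>\<^bsub>U\<^esub> y \<ominus>\<^bsub>U\<^esub> a \<otimes>\<^bsub>U\<^esub> b = x \<otimes>\<^bsub>U\<^esub> (y \<ominus>\<^bsub>U\<^esub> b) \<oplus>\<^bsub>U\<^esub> (x \<ominus>\<^bsub>U\<^esub> a) \<otimes>\<^bsub>U\<^esub> b"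
proof -
  have "x \<otimes>\<^bsub>U\<^esub> (y \<ominus>\<^bsub>U\<^esub> b) = x \<otimes>\<^bsub>U\<^esub> y \<ominus>\<^bsub>U\<^esub> x \<otimes>\<^bsub>U\<^esub> b"
    "(x \<ominus>\<^bsub>U\<^esub> a) \<otimes>\<^bsub>U\<^esub> b = x \<otimes>\<^bsub>U\<^esub> b \<ominus>\<^bsub>U\<^esub> a \<otimes>\<^bsub>U\<^esub> b"
    using assms by (simp_all add: a_minus_def U.l_distr U.r_distr U.l_minus U.r_minus)
  then show ?thesis
    using minus_add_minus[of "x \<otimes>\<^bsub>U\<^esub> y" "x \<otimes>\<^bsub>U\<^esub> b" "a \<otimes>\<^bsub>U\<^esub> b"] assms by simp
qed

lemma nrm_mult_diff_mult:
  assumes "x \<in> carrier U" "y \<in> carrier U" "a \<in> carrier U" "b \<in> carrier U"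
  shows "nrm (x \<otimes>\<^bsub>U\<^esub> y \<ominus>\<^bsub>U\<^esub> a \<otimes>\<^bsub>U\<^esub> b) \<le> nrm x * nrm (y \<ominus>\<^bsub>U\<^esub> b) + nrm (x \<ominus>\<^bsub>U\<^esub> a) * nrm b"
proof -
  have "nrm (x \<otimes>\<^bsub>U\<^esub> y \<ominus>\<^bsub>U\<^esub> a \<otimes>\<^bsub>U\<^esub> b) \<le> nrm (x \<otimes>\<^bsub>U\<^esub> (y \<ominus>\<^bsub>U\<^esub> b)) + nrm ((x \<ominus>\<^bsub>U\<^esub> a) \<otimes>\<^bsub>U\<^esub> b)"
    unfolding mult_diff_mult[OF assms] using assms by (intro nrm_add_le) auto
  then show ?thesis using nrm_mult_le[of x "y \<ominus>\<^bsub>U\<^esub> b"] nrm_mult_le[of "x \<ominus>\<^bsub>U\<^esub> a" b] assms by simp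
qed

lemma nrm_mult_contr:
  assumes "x \<in> carrier U" "p \<in> carrier U" "nrm p \<le> 1"
  shows "nrm (p \<otimes>\<^bsub>U\<^esub> x) \<le> nrm x" "nrm (x \<otimes>\<^bsub>U\<^esub> p) \<le> nrm x"
  using nrm_mult_le[OF assms(2,1)] nrm_mult_le[OF assms(1,2)] nrm_nonneg[OF assms(1)] assms(3)
    mult_right_mono[OF assms(3) nrm_nonneg[OF assms(1)]] mult_left_mono[OF assms(3) nrm_nonneg[OF assms(1)]]
  by linarith+

text \<open>The norm of an idempotent is at most its own square, so it is 0 as soon as it is below
  1.\<close>

lemma idempotent_small_zero:
  assumes "x \<in> carrier U" "x \<otimes>\<^bsub>U\<^esub> x = x" "nrm x < 1"
  shows "x = \<zero>\<^bsub>U\<^esub>"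
proof -
  have "nrm x \<le> nrm x * nrm x" using nrm_mult_le[OF assms(1,1)] assms(2) by simp
  then have "nrm x * (1 - nrm x) \<le> 0" by (simp add: algebra_simps)
  then have "nrm x \<le> 0" using assms(3) by (simp add: mult_le_0_iff)
  then show ?thesis using nrm_eq_0 nrm_nonneg assms(1) by force
qed

lemma minus_eq_0:
  "x \<in> carrier U \<Longrightarrow> y \<in> carrier U \<Longrightarrow> x \<ominus>\<^bsub>U\<^esub> y = \<zero>\<^bsub>U\<^esub> \<longleftrightarrow> x = y"
proof -
  assume x: "x \<in> carrier U" and y: "y \<in> carrier U"
  have "x = (x \<ominus>\<^bsub>U\<^esub> y) \<oplus>\<^bsub>U\<^esub> y" using x y by (simp add: a_minus_def U.a_assoc U.l_neg)
  then show ?thesis using x y by (auto simp: a_minus_def U.r_neg)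
qed

section \<open>Diagonal projections in the UHF algebra\<close>

definition pr :: "nat \<Rightarrow> nat set \<Rightarrow> uhf_element" where
  "pr n S = emb n (dg (k n) S)"

lemma pr_carrier [simp]: "pr n S \<in> carrier U"
  unfolding pr_def by (rule emb_carrier[OF dg_carrier(1)])

lemma pr_mult_pr: "pr n S \<otimes>\<^bsub>U\<^esub> pr n S' = pr n (S \<inter> S')"
  unfolding pr_def by (simp add: emb_mult dg_mult_dg)

lemma nrm_pr: "nrm (pr n S) \<le> 1"
  unfolding pr_def nrm_emb[OF dg_carrier(1)] by (rule op_norm_dg)

lemma pr_cong: "S \<inter> {..<k n} = S' \<inter> {..<k n} \<Longrightarrow> pr n S = pr n S'"
proof -
  assume "S \<inter> {..<k n} = S' \<inter> {..<k n}"
  then have "i \<in> S \<longleftrightarrow> i \<in> S'" if "i < k n" for i using that by blast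
  then have "dg (k n) S = dg (k n) S'" by (intro eq_matI) (auto simp: dg_def)
  then show ?thesis by (simp add: pr_def)
qed

lemma pr_full: "{..<k n} \<subseteq> S \<Longrightarrow> pr n S = \<one>\<^bsub>U\<^esub>"
  using pr_cong[of S n UNIV] by (auto simp: pr_def dg_UNIV emb_one)

lemma pr_disjoint_union: "S \<inter> S' = {} \<Longrightarrow> pr n (S \<union> S') = pr n S \<oplus>\<^bsub>U\<^esub> pr n S'"
proof -
  assume "S \<inter> S' = {}"
  then have "dg (k n) (S \<union> S') = dg (k n) S + dg (k n) S'" by (intro eq_matI) (auto simp: dg_def)
  then show ?thesis by (simp add: pr_def emb_add)
qed

lemma pr_eq_0_iff: "pr n S = \<zero>\<^bsub>U\<^esub> \<longleftrightarrow> S \<inter> {..<k n} = {}"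
proof
  assume "pr n S = \<zero>\<^bsub>U\<^esub>"
  then have dg: "dg (k n) S = 0\<^sub>m (k n) (k n)" by (simp add: pr_def emb_eq_0_iff)
  have "False" if "i \<in> S" "i < k n" for i
  proof -
    have "dg (k n) S $$ (i, i) = 1" using that by (simp add: dg_def)
    then show False using dg that by simp
  qed
  then show "S \<inter> {..<k n} = {}" by blast
next
  assume "S \<inter> {..<k n} = {}"
  then have "dg (k n) S = 0\<^sub>m (k n) (k n)" by (intro eq_matI) (auto simp: dg_def)
  then show "pr n S = \<zero>\<^bsub>U\<^esub>" by (simp add: pr_def emb_zero)
qed

lemma pr_up: "m \<le> n \<Longrightarrow> pr m S = pr n {p. p div (k n div k m) \<in> S}"
  using emb_up[of m n "dg (k m) S"] by (simp add: pr_def up_def refine_dg k_mult)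

lemma pr_eq_iff: "pr n S = pr n S' \<longleftrightarrow> S \<inter> {..<k n} = S' \<inter> {..<k n}"
proof
  assume eq: "pr n S = pr n S'"
  have "pr n (S - S') = pr n S \<otimes>\<^bsub>U\<^esub> pr n (- S')" by (simp add: pr_mult_pr Diff_eq)
  also have "\<dots> = pr n (S' - S')" by (simp add: eq pr_mult_pr Diff_eq)
  finally have 1: "(S - S') \<inter> {..<k n} = {}" using pr_eq_0_iff[of n "{}"] pr_eq_0_iff[of n "S - S'"] by simp
  have "pr n (S' - S) = pr n S' \<otimes>\<^bsub>U\<^esub> pr n (- S)" by (simp add: pr_mult_pr Diff_eq)
  also have "\<dots> = pr n (S - S)" by (simp add: eq[symmetric] pr_mult_pr Diff_eq)
  finally have "(S' - S) \<inter> {..<k n} = {}" using pr_eq_0_iff[of n "{}"] pr_eq_0_iff[of n "S' - S"] by simp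
  with 1 show "S \<inter> {..<k n} = S' \<inter> {..<k n}" by blast
qed (rule pr_cong)

text \<open>The atoms of a stage add up to the unit, so an element annihilating all of them
  annihilates the unit.\<close>

lemma atoms_zero:
  assumes x: "x \<in> carrier U" and z: "\<And>i. i < k n \<Longrightarrow> x \<otimes>\<^bsub>U\<^esub> pr n {i} = \<zero>\<^bsub>U\<^esub>"
  shows "x = \<zero>\<^bsub>U\<^esub>"
proof -
  have "x \<otimes>\<^bsub>U\<^esub> pr n {..<j} = \<zero>\<^bsub>U\<^esub>" if "j \<le> k n" for j
    using that
  proof (induction j)
    case 0
    have "pr n {..<0} = \<zero>\<^bsub>U\<^esub>" by (simp add: pr_eq_0_iff)
    then show ?case using x by simp
  next
    case (Suc j)
    have "pr n {..<Suc j} = pr n {..<j} \<oplus>\<^bsub>U\<^esub> pr n {j}"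
      using pr_disjoint_union[of "{..<j}" "{j}" n] by (simp add: lessThan_Suc)
    then show ?case using Suc z[of j] x by (simp add: U.r_distr)
  qed
  from this[of "k n"] show ?thesis using x pr_full[of n "{..<k n}"] by simp
qed

end

section \<open>Tree-refinement algebras\<close>

locale tree_algebra = supernatural k for k :: "nat \<Rightarrow> nat" +
  fixes G :: "nat pair_pre_digraph" and leq :: "nat \<Rightarrow> nat \<Rightarrow> bool"
  assumes hasse_G: "hasse G leq" and verts_G: "pverts G = {..<k 0}"
begin

definition lev :: "nat \<Rightarrow> nat \<Rightarrow> nat \<Rightarrow> bool" where
  "lev n = amp_le (k n div k 0) leq"

abbreviation TR :: "uhf_element normed_alg" where
  "TR \<equiv> tree_refinement_algebra G k"

abbreviation T :: "uhf_element set" where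
  "T \<equiv> carrier TR"

lemma tower: "hasse (tree_tower G k n) (lev n)" "pverts (tree_tower G k n) = {..<k n}"
  using hasse_tree_tower[OF hasse_G verts_G k_pos k_dvd_Suc, of n] by (auto simp: lev_def)

lemma tree_order_lev: "tree_order {..<k n} (lev n)"
  using tower[of n] by (simp add: hasse_def)

lemma lev_0: "lev 0 = leq"
  using k_pos[of 0] by (simp add: lev_def)

lemma lev_up: "m \<le> n \<Longrightarrow> lev n = amp_le (k n div k m) (lev m)"
proof -
  assume mn: "m \<le> n"
  have "k 0 * ((k m div k 0) * (k n div k m)) = k 0 * (k n div k 0)"
    using k_mult[of 0 m] k_mult[OF mn] k_mult[of 0 n] by (metis le0 mult.assoc)
  then have "(k m div k 0) * (k n div k m) = k n div k 0" using k_pos[of 0] by simp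
  then show ?thesis by (simp add: lev_def amp_le_amp_le)
qed

lemma lev_refl: "i < k n \<Longrightarrow> lev n i i"
  using tree_order.le_refl[OF tree_order_lev] by simp

lemma lev_trans: "lev n i j \<Longrightarrow> lev n j h \<Longrightarrow> lev n i h"
  using tree_order.le_trans[OF tree_order_lev] by blast

lemma lev_antisym: "lev n i j \<Longrightarrow> lev n j i \<Longrightarrow> i = j"
  using tree_order.le_antisym[OF tree_order_lev] by blast

lemma TR_simps [simp]: "monoid.mult TR = monoid.mult U" "add TR = add U" "one TR = one U" "zero TR = zero U"
  "Module.smult TR = Module.smult U" "alg_norm TR = alg_norm U"
  by (simp_all add: tree_refinement_algebra_def)

abbreviation tris :: "nat \<Rightarrow> complex mat set" where
  "tris n \<equiv> tri (k n) (lev n)"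

lemma T_iff: "x \<in> T \<longleftrightarrow> x \<in> carrier U \<and> (\<forall>e>0. \<exists>n. \<exists>A\<in>tris n. nrm (x \<ominus>\<^bsub>U\<^esub> emb n A) < e)"
  by (simp add: tree_refinement_algebra_def uhf_embed_eq tree_mats_eq_tri[OF tower])

lemma T_carrier: "x \<in> T \<Longrightarrow> x \<in> carrier U"
  by (simp add: T_iff)

lemma up_tris: "m \<le> n \<Longrightarrow> A \<in> tris m \<Longrightarrow> up m n A \<in> tris n"
  using refine_tri[of A "k m" "lev m" "k n div k m"] lev_refl
  by (simp add: up_def lev_up[of m n] k_mult)

lemma emb_T: "A \<in> tris n \<Longrightarrow> emb n A \<in> T"
proof -
  assume A: "A \<in> tris n"
  then have "emb n A \<in> carrier U" by (rule emb_carrier[OF tri_carrier])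
  then have "emb n A \<ominus>\<^bsub>U\<^esub> emb n A = \<zero>\<^bsub>U\<^esub>" by (simp add: minus_eq_0)
  then have "nrm (emb n A \<ominus>\<^bsub>U\<^esub> emb n A) = 0" by (simp only: nrm_zero)
  then show ?thesis using A \<open>emb n A \<in> carrier U\<close> by (force simp: T_iff)
qed

lemma pr_T: "pr n S \<in> T"
  unfolding pr_def by (intro emb_T dg_tri lev_refl)

text \<open>Triangular matrices stay triangular under refinement, so the stage of the approximant
  can be pushed beyond any prescribed \<open>m\<close>.\<close>

lemma T_approx:
  assumes x: "x \<in> T" and e: "0 < e"
  obtains n A where "m \<le> n" "A \<in> tris n" "nrm (x \<ominus>\<^bsub>U\<^esub> emb n A) < e"
proof -
  obtain n A where A: "A \<in> tris n" "nrm (x \<ominus>\<^bsub>U\<^esub> emb n A) < e"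
    using assms by (auto simp: T_iff)
  show thesis
  proof (rule that)
    show "m \<le> max m n" by simp
    show "up n (max m n) A \<in> tris (max m n)" by (rule up_tris[OF _ A(1)]) simp
    show "nrm (x \<ominus>\<^bsub>U\<^esub> emb (max m n) (up n (max m n) A)) < e"
      using A emb_up[of n "max m n" A] tri_carrier by simp
  qed
qed

lemma T_mult:
  assumes x: "x \<in> T" and y: "y \<in> T"
  shows "x \<otimes>\<^bsub>U\<^esub> y \<in> T"
  unfolding T_iff
proof (intro conjI allI impI)
  have xU: "x \<in> carrier U" and yU: "y \<in> carrier U" using x y by (auto intro: T_carrier)
  then show "x \<otimes>\<^bsub>U\<^esub> y \<in> carrier U" by simp
  fix e :: real assume e: "0 < e"
  define C where "C = nrm x + nrm y + 1"
  have C: "0 < C" using nrm_nonneg[OF xU] nrm_nonneg[OF yU] by (simp add: C_def)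
  \<comment> \<open>\<open>d \<le> 1\<close> keeps the approximant of \<open>y\<close> within norm
    \<open>nrm y + 1\<close>, and then \<open>C\<close> collects the coefficients of
    \<open>d\<close> in the estimate for the product.\<close>
  define d where "d = min 1 (e / C)"
  have d: "0 < d" "d \<le> 1" "d * C \<le> e"
    using e C by (auto simp: d_def min_def field_simps)
  obtain n A where A: "A \<in> tris n" "nrm (x \<ominus>\<^bsub>U\<^esub> emb n A) < d" using T_approx[OF x d(1)] by blast
  obtain n' B where B: "n \<le> n'" "B \<in> tris n'" "nrm (y \<ominus>\<^bsub>U\<^esub> emb n' B) < d" using T_approx[OF y d(1)] by blast
  define A' where "A' = up n n' A"
  have A': "A' \<in> tris n'" "emb n' A' = emb n A"
    using up_tris[OF B(1) A(1)] emb_up[OF B(1) tri_carrier[OF A(1)]] by (auto simp: A'_def)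
  have c: "emb n' A' \<in> carrier U" "emb n' B \<in> carrier U" using A'(1) B(2) by (blast intro: emb_carrier tri_carrier)+
  have nB: "nrm (emb n' B) \<le> nrm y + 1"
    using nrm_le_diff[OF c(2) yU] nrm_minus_commute[OF c(2) yU] B(3) d by linarith
  have "nrm (x \<otimes>\<^bsub>U\<^esub> y \<ominus>\<^bsub>U\<^esub> emb n' (A' * B)) = nrm (x \<otimes>\<^bsub>U\<^esub> y \<ominus>\<^bsub>U\<^esub> emb n' A' \<otimes>\<^bsub>U\<^esub> emb n' B)"
    using emb_mult[OF tri_carrier[OF A'(1)] tri_carrier[OF B(2)]] by simp
  also have "\<dots> \<le> nrm x * nrm (y \<ominus>\<^bsub>U\<^esub> emb n' B) + nrm (x \<ominus>\<^bsub>U\<^esub> emb n' A') * nrm (emb n' B)"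
    by (rule nrm_mult_diff_mult[OF xU yU c])
  also have "\<dots> \<le> nrm x * d + nrm (x \<ominus>\<^bsub>U\<^esub> emb n' A') * (nrm y + 1)"
    using B(3) nB nrm_nonneg xU c by (intro add_mono mult_left_mono) auto
  also have "\<dots> < nrm x * d + d * (nrm y + 1)"
    using A A' nrm_nonneg[OF yU] by (intro add_strict_left_mono mult_strict_right_mono) auto
  also have "\<dots> = d * C" by (simp add: C_def algebra_simps)
  finally have "nrm (x \<otimes>\<^bsub>U\<^esub> y \<ominus>\<^bsub>U\<^esub> emb n' (A' * B)) < e" using d by linarith
  moreover have "A' * B \<in> tris n'" using A'(1) B(2) by (rule tri_mult) (rule lev_trans)
  ultimately show "\<exists>n. \<exists>A\<in>tris n. nrm (x \<otimes>\<^bsub>U\<^esub> y \<ominus>\<^bsub>U\<^esub> emb n A) < e" by blast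
qed

lemma nrm_small_zero:
  assumes "x \<in> carrier U" "\<And>e. 0 < e \<Longrightarrow> nrm x \<le> e"
  shows "x = \<zero>\<^bsub>U\<^esub>"
  using nrm_eq_0[OF assms(1)] field_le_epsilon[of "nrm x" 0] assms(2) nrm_nonneg[OF assms(1)] by auto

lemma compression_approx:
  assumes x: "x \<in> carrier U" and a: "a \<in> carrier U"
  shows "nrm (pr m S \<otimes>\<^bsub>U\<^esub> x \<otimes>\<^bsub>U\<^esub> pr m S') \<le> nrm (x \<ominus>\<^bsub>U\<^esub> a) + nrm (pr m S \<otimes>\<^bsub>U\<^esub> a \<otimes>\<^bsub>U\<^esub> pr m S')"
proof -
  let ?p = "pr m S" and ?q = "pr m S'"
  have "?p \<otimes>\<^bsub>U\<^esub> x \<otimes>\<^bsub>U\<^esub> ?q \<ominus>\<^bsub>U\<^esub> ?p \<otimes>\<^bsub>U\<^esub> a \<otimes>\<^bsub>U\<^esub> ?q = ?p \<otimes>\<^bsub>U\<^esub> (x \<ominus>\<^bsub>U\<^esub> a) \<otimes>\<^bsub>U\<^esub> ?q"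
    using x a by (simp add: a_minus_def U.l_distr U.r_distr U.l_minus U.r_minus)
  moreover have "nrm (?p \<otimes>\<^bsub>U\<^esub> (x \<ominus>\<^bsub>U\<^esub> a) \<otimes>\<^bsub>U\<^esub> ?q) \<le> nrm (x \<ominus>\<^bsub>U\<^esub> a)"
    using nrm_mult_contr(1)[of "x \<ominus>\<^bsub>U\<^esub> a" ?p] nrm_mult_contr(2)[of "?p \<otimes>\<^bsub>U\<^esub> (x \<ominus>\<^bsub>U\<^esub> a)" ?q]
      x a nrm_pr by force
  ultimately show ?thesis
    using nrm_le_diff[of "?p \<otimes>\<^bsub>U\<^esub> x \<otimes>\<^bsub>U\<^esub> ?q" "?p \<otimes>\<^bsub>U\<^esub> a \<otimes>\<^bsub>U\<^esub> ?q"] x a by simp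
qed

lemma compression_emb:
  assumes "m \<le> n" "A \<in> mats n"
  shows "pr m S \<otimes>\<^bsub>U\<^esub> emb n A \<otimes>\<^bsub>U\<^esub> pr m S' =
    emb n (dg (k n) {p. p div (k n div k m) \<in> S} * A * dg (k n) {p. p div (k n div k m) \<in> S'})"
  unfolding pr_up[OF assms(1)] unfolding pr_def using assms(2)
  by (simp add: emb_mult mult_carrier_mat[of _ "k n" "k n"])

lemma lev_div:
  assumes "m \<le> n" "lev n i j"
  shows "lev m (i div (k n div k m)) (j div (k n div k m))"
  using assms by (simp add: lev_up[of m n] amp_le_def)

lemma div_less_k: "m \<le> n \<Longrightarrow> i < k n \<Longrightarrow> i div (k n div k m) < k m"
  by (simp add: k_mult less_mult_imp_div_less)

text \<open>Dividing indices maps the order of a later stage into that of stage \<open>m\<close>. So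
  the block vanishes exactly for triangular approximants at later stages, and by continuity for
  \<open>x\<close>.\<close>

lemma block_zero:
  assumes x: "x \<in> T" and no: "\<And>i j. i \<in> S \<Longrightarrow> j \<in> S' \<Longrightarrow> i < k m \<Longrightarrow> j < k m \<Longrightarrow> \<not> lev m j i"
  shows "pr m S \<otimes>\<^bsub>U\<^esub> x \<otimes>\<^bsub>U\<^esub> pr m S' = \<zero>\<^bsub>U\<^esub>"
proof (rule nrm_small_zero)
  have xU: "x \<in> carrier U" using x by (rule T_carrier)
  then show "pr m S \<otimes>\<^bsub>U\<^esub> x \<otimes>\<^bsub>U\<^esub> pr m S' \<in> carrier U" by simp
  fix e :: real assume "0 < e"
  then obtain n A where A: "m \<le> n" "A \<in> tris n" "nrm (x \<ominus>\<^bsub>U\<^esub> emb n A) < e" using T_approx[OF x] by metis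
  have Ac: "A \<in> mats n" using A(2) by (rule tri_carrier)
  let ?r = "k n div k m"
  have "dg (k n) {p. p div ?r \<in> S} * A * dg (k n) {p. p div ?r \<in> S'} = 0\<^sub>m (k n) (k n)"
  proof (rule eq_matI)
    fix i j assume "i < dim_row (0\<^sub>m (k n) (k n))" "j < dim_col (0\<^sub>m (k n) (k n))"
    then have ij: "i < k n" "j < k n" by auto
    have "A $$ (i, j) = 0" if "i div ?r \<in> S" "j div ?r \<in> S'"
      using no[OF that div_less_k[OF A(1) ij(1)] div_less_k[OF A(1) ij(2)]] lev_div[OF A(1)] A(2) ij
      unfolding tri_def by blast
    then show "(dg (k n) {p. p div ?r \<in> S} * A * dg (k n) {p. p div ?r \<in> S'}) $$ (i, j) = 0\<^sub>m (k n) (k n) $$ (i, j)"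
      unfolding dg_mult_mult_dg[OF Ac] using ij by simp
  qed (use Ac in auto)
  then have "pr m S \<otimes>\<^bsub>U\<^esub> emb n A \<otimes>\<^bsub>U\<^esub> pr m S' = \<zero>\<^bsub>U\<^esub>"
    using compression_emb[OF A(1) Ac] by (simp add: emb_zero)
  then show "nrm (pr m S \<otimes>\<^bsub>U\<^esub> x \<otimes>\<^bsub>U\<^esub> pr m S') \<le> e"
    using compression_approx[OF xU emb_carrier[OF Ac], of m S S'] A(3) by (simp add: nrm_zero)
qed

lemma block_nonzero:
  assumes "i \<in> S" "j \<in> S'" "i < k m" "j < k m" "lev m j i"
  shows "\<exists>x\<in>T. pr m S \<otimes>\<^bsub>U\<^esub> x \<otimes>\<^bsub>U\<^esub> pr m S' \<noteq> \<zero>\<^bsub>U\<^esub>"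
proof (rule bexI)
  let ?A = "matrix_unit (k m) i j"
  have A: "?A \<in> tris m" using assms by (auto simp: tri_def matrix_unit_def split: if_splits)
  then show "emb m ?A \<in> T" by (rule emb_T)
  have "(dg (k m) S * ?A * dg (k m) S') $$ (i, j) = 1"
    unfolding dg_mult_mult_dg[OF tri_carrier[OF A]] using assms by (simp add: matrix_unit_def)
  moreover have "0\<^sub>m (k m) (k m) $$ (i, j) = (0 :: complex)" using assms by simp
  ultimately have "dg (k m) S * ?A * dg (k m) S' \<noteq> 0\<^sub>m (k m) (k m)" by (metis zero_neq_one)
  then show "pr m S \<otimes>\<^bsub>U\<^esub> emb m ?A \<otimes>\<^bsub>U\<^esub> pr m S' \<noteq> \<zero>\<^bsub>U\<^esub>"
    using tri_carrier[OF A] by (simp add: pr_def emb_mult mult_carrier_mat[of _ "k m" "k m"] emb_eq_0_iff)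
qed

text \<open>Turns the order of indices into a condition on products within the algebra, which an
  isomorphism preserves. Note the orientation: the right-hand projection carries the
  ancestors.\<close>

lemma block_iff:
  "(\<exists>x\<in>T. pr m S \<otimes>\<^bsub>U\<^esub> x \<otimes>\<^bsub>U\<^esub> pr m S' \<noteq> \<zero>\<^bsub>U\<^esub>) \<longleftrightarrow>
    (\<exists>i\<in>S \<inter> {..<k m}. \<exists>j\<in>S' \<inter> {..<k m}. lev m j i)"
  using block_zero[of _ S S' m] block_nonzero[of _ S _ S' m] by blast

text \<open>Triangularity kills the opposite block, with rows in \<open>S'\<close> and columns in
  \<open>S\<close>; since approximants of \<open>p\<close> are nearly self-adjoint, the given block
  of \<open>p\<close> is arbitrarily small.\<close>

lemma idempotent_block_zero:
  assumes p: "p \<in> T" "p \<otimes>\<^bsub>U\<^esub> p = p" "nrm p \<le> 1"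
    and no: "\<And>i j. i \<in> S \<Longrightarrow> j \<in> S' \<Longrightarrow> i < k m \<Longrightarrow> j < k m \<Longrightarrow> \<not> lev m i j"
  shows "pr m S \<otimes>\<^bsub>U\<^esub> p \<otimes>\<^bsub>U\<^esub> pr m S' = \<zero>\<^bsub>U\<^esub>"
proof (rule nrm_small_zero)
  have pU: "p \<in> carrier U" using p by (intro T_carrier)
  then show "pr m S \<otimes>\<^bsub>U\<^esub> p \<otimes>\<^bsub>U\<^esub> pr m S' \<in> carrier U" by simp
  fix \<eta> :: real assume \<eta>: "0 < \<eta>"
  \<comment> \<open>With \<open>e\<close> the square of \<open>s\<close>, the block of the
    approximant is at most \<open>8 * s\<close>, and the approximation error below
    \<open>e / 8\<close> still fits into the remaining \<open>s\<close>.\<close>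
  define s where "s = min 1 (\<eta> / 9)"
  define e where "e = s\<^sup>2"
  have s: "0 < s" "s \<le> 1" "9 * s \<le> \<eta>" using \<eta> by (auto simp: s_def)
  have e: "0 < e" "e \<le> 1" "e \<le> s" "sqrt e = s"
    using s by (auto simp: e_def power2_eq_square mult_le_one mult_left_le)
  obtain n A where A: "m \<le> n" "A \<in> tris n" "nrm (p \<ominus>\<^bsub>U\<^esub> emb n A) < e / 8"
    by (rule T_approx[OF p(1), of "e / 8" m]) (use e in auto)
  have Ac: "A \<in> mats n" using A(2) by (rule tri_carrier)
  define a where "a = emb n A"
  have aU: "a \<in> carrier U" unfolding a_def by (rule emb_carrier[OF Ac])
  have ap: "nrm (a \<ominus>\<^bsub>U\<^esub> p) < e / 8" using A(3) nrm_minus_commute[OF aU pU] by (simp add: a_def)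
  have na: "nrm a \<le> 1 + e" using nrm_le_diff[OF aU pU] ap p(3) e by linarith
  then have contr: "op_norm A \<le> 1 + e" using nrm_emb[OF Ac] by (simp add: a_def)
  \<comment> \<open>Near-idempotence of \<open>a\<close> comes from that of \<open>p\<close>: the
    three errors add up to at most \<open>4 * (e / 8)\<close>, which is within
    \<open>e\<close>.\<close>
  have "nrm (a \<otimes>\<^bsub>U\<^esub> a \<ominus>\<^bsub>U\<^esub> a) \<le> nrm (a \<otimes>\<^bsub>U\<^esub> a \<ominus>\<^bsub>U\<^esub> p \<otimes>\<^bsub>U\<^esub> p) + nrm (p \<ominus>\<^bsub>U\<^esub> a)"
    using nrm_triangle[of "a \<otimes>\<^bsub>U\<^esub> a" p a] aU pU p(2) by simp
  also have "\<dots> \<le> nrm a * nrm (a \<ominus>\<^bsub>U\<^esub> p) + nrm (a \<ominus>\<^bsub>U\<^esub> p) * nrm p + nrm (p \<ominus>\<^bsub>U\<^esub> a)"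
    using nrm_mult_diff_mult[OF aU aU pU pU] by simp
  also have "\<dots> \<le> 2 * (e / 8) + (e / 8) * 1 + e / 8"
    using na e ap A(3) p(3) nrm_nonneg[OF aU] nrm_nonneg[OF pU] nrm_nonneg[of "a \<ominus>\<^bsub>U\<^esub> p"] aU pU
    by (intro add_mono mult_mono) (auto simp: a_def)
  finally have "nrm (emb n (A * A - A)) \<le> e"
    using e Ac by (simp add: a_def emb_mult emb_minus mult_carrier_mat[of _ "k n" "k n"])
  then have idem: "op_norm (A * A - A) \<le> e" using nrm_emb[OF minus_carrier_mat[OF Ac]] by simp
  let ?r = "k n div k m"
  have "op_norm (dg (k n) {p. p div ?r \<in> S} * A * dg (k n) {p. p div ?r \<in> S'}) \<le> 8 * sqrt e"
  proof (rule near_idempotent_block[OF Ac _ e(2) contr idem])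
    fix i j assume ij: "i < k n" "j < k n" "i \<in> {p. p div ?r \<in> S'}" "j \<in> {p. p div ?r \<in> S}"
    then have "\<not> lev m (j div ?r) (i div ?r)" using no div_less_k[OF A(1)] by simp
    then show "A $$ (i, j) = 0" using lev_div[OF A(1)] A(2) ij unfolding tri_def by blast
  qed (use e in simp)
  then have "nrm (pr m S \<otimes>\<^bsub>U\<^esub> a \<otimes>\<^bsub>U\<^esub> pr m S') \<le> 8 * s"
    unfolding a_def compression_emb[OF A(1) Ac]
    using Ac e by (subst nrm_emb) (auto intro!: mult_carrier_mat[of _ "k n" "k n"])
  then show "nrm (pr m S \<otimes>\<^bsub>U\<^esub> p \<otimes>\<^bsub>U\<^esub> pr m S') \<le> \<eta>"
    using compression_approx[OF pU aU, of m S S'] A(3) e s by (simp add: a_def)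
qed

text \<open>
  A contractive idempotent is self-adjoint, so that triangularity forces it to be diagonal.
\<close>

lemma idempotent_commutes_atom:
  assumes p: "p \<in> T" "p \<otimes>\<^bsub>U\<^esub> p = p" "nrm p \<le> 1" and i: "i < k m"
  shows "pr m {i} \<otimes>\<^bsub>U\<^esub> p = p \<otimes>\<^bsub>U\<^esub> pr m {i}"
proof -
  let ?e = "pr m {i}"
  have pU: "p \<in> carrier U" using p by (intro T_carrier)
  \<comment> \<open>The unit is split into the atom \<open>i\<close>, the other indices standing in
    the relation \<open>P\<close>, and the rest. In each of the two uses below one of the last two
    parts is removed by triangularity and the other by self-adjointness.\<close>
  have split: "\<one>\<^bsub>U\<^esub> = (?e \<oplus>\<^bsub>U\<^esub> pr m {j. j \<noteq> i \<and> P j}) \<oplus>\<^bsub>U\<^esub> pr m {j. j \<noteq> i \<and> \<not> P j}" for P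
  proof -
    have "pr m ({i} \<union> {j. j \<noteq> i \<and> P j} \<union> {j. j \<noteq> i \<and> \<not> P j}) = \<one>\<^bsub>U\<^esub>" by (rule pr_full) auto
    moreover have "pr m ({i} \<union> {j. j \<noteq> i \<and> P j} \<union> {j. j \<noteq> i \<and> \<not> P j}) =
        (?e \<oplus>\<^bsub>U\<^esub> pr m {j. j \<noteq> i \<and> P j}) \<oplus>\<^bsub>U\<^esub> pr m {j. j \<noteq> i \<and> \<not> P j}"
      by (subst pr_disjoint_union, blast, subst pr_disjoint_union, blast, rule refl)
    ultimately show ?thesis by simp
  qed
  have "?e \<otimes>\<^bsub>U\<^esub> p = ?e \<otimes>\<^bsub>U\<^esub> p \<otimes>\<^bsub>U\<^esub> \<one>\<^bsub>U\<^esub>" using pU by simp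
  also have "\<dots> = ?e \<otimes>\<^bsub>U\<^esub> p \<otimes>\<^bsub>U\<^esub> ?e"
  proof -
    have "?e \<otimes>\<^bsub>U\<^esub> p \<otimes>\<^bsub>U\<^esub> pr m {j. j \<noteq> i \<and> lev m j i} = \<zero>\<^bsub>U\<^esub>"
      using lev_antisym by (intro idempotent_block_zero p) auto
    moreover have "?e \<otimes>\<^bsub>U\<^esub> p \<otimes>\<^bsub>U\<^esub> pr m {j. j \<noteq> i \<and> \<not> lev m j i} = \<zero>\<^bsub>U\<^esub>"
      by (intro block_zero p) auto
    ultimately show ?thesis
      using pU by (subst split[of "\<lambda>j. lev m j i"]) (simp add: U.r_distr)
  qed
  also have "\<dots> = \<one>\<^bsub>U\<^esub> \<otimes>\<^bsub>U\<^esub> p \<otimes>\<^bsub>U\<^esub> ?e"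
  proof -
    have "pr m {j. j \<noteq> i \<and> lev m i j} \<otimes>\<^bsub>U\<^esub> p \<otimes>\<^bsub>U\<^esub> ?e = \<zero>\<^bsub>U\<^esub>"
      using lev_antisym by (intro idempotent_block_zero p) auto
    moreover have "pr m {j. j \<noteq> i \<and> \<not> lev m i j} \<otimes>\<^bsub>U\<^esub> p \<otimes>\<^bsub>U\<^esub> ?e = \<zero>\<^bsub>U\<^esub>"
      by (intro block_zero p) auto
    ultimately show ?thesis
      using pU by (subst split[of "\<lambda>j. lev m i j"]) (simp add: U.l_distr)
  qed
  also have "\<dots> = p \<otimes>\<^bsub>U\<^esub> ?e" using pU by simp
  finally show ?thesis .
qed

text \<open>Compressing the approximant \<open>A\<close> to a single index gives a scalar
  \<open>c\<close>, although the corner of \<open>p\<close> there is not known to be scalar. That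
  corner is an idempotent \<open>q\<close>, so \<open>c\<close> must be close to 0 or to 1, and then
  \<open>q\<close> is exactly 0 or the whole atom.\<close>

lemma idempotent_atom:
  assumes p: "p \<in> T" "p \<otimes>\<^bsub>U\<^esub> p = p" "nrm p \<le> 1" and i: "i < k m"
    and A: "A \<in> mats m" "nrm (p \<ominus>\<^bsub>U\<^esub> emb m A) < 1 / 32"
  shows "p \<otimes>\<^bsub>U\<^esub> pr m {i} = \<zero>\<^bsub>U\<^esub> \<or> p \<otimes>\<^bsub>U\<^esub> pr m {i} = pr m {i}"
proof -
  let ?e = "pr m {i}"
  define q where "q = ?e \<otimes>\<^bsub>U\<^esub> p \<otimes>\<^bsub>U\<^esub> ?e"
  define c where "c = A $$ (i, i)"
  define C where "C = emb m (c \<cdot>\<^sub>m dg (k m) {i})"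
  have pU: "p \<in> carrier U" using p by (intro T_carrier)
  have ee: "?e \<otimes>\<^bsub>U\<^esub> ?e = ?e" by (simp add: pr_mult_pr)
  have comm: "?e \<otimes>\<^bsub>U\<^esub> p = p \<otimes>\<^bsub>U\<^esub> ?e" by (rule idempotent_commutes_atom[OF p i])
  have qp: "q = p \<otimes>\<^bsub>U\<^esub> ?e" using pU ee comm by (simp add: q_def U.m_assoc)
  have qU: "q \<in> carrier U" using pU by (simp add: q_def)
  have qe: "q \<otimes>\<^bsub>U\<^esub> ?e = q" "?e \<otimes>\<^bsub>U\<^esub> q = q" 
    using pU ee by (simp_all add: q_def U.m_assoc) (simp add: U.m_assoc[symmetric])
  have qq: "q \<otimes>\<^bsub>U\<^esub> q = q"
  proof -
    have "q \<otimes>\<^bsub>U\<^esub> q = p \<otimes>\<^bsub>U\<^esub> (?e \<otimes>\<^bsub>U\<^esub> q)" using pU qU by (simp add: qp U.m_assoc)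
    also have "\<dots> = (p \<otimes>\<^bsub>U\<^esub> p) \<otimes>\<^bsub>U\<^esub> ?e" unfolding qe using pU by (simp add: qp U.m_assoc)
    finally show ?thesis using p(2) qp by simp
  qed
  have dc: "d \<cdot>\<^sub>m dg (k m) {i} \<in> mats m" for d by simp
  have CU: "C \<in> carrier U" unfolding C_def by (intro emb_carrier dc)
  have nd: "nrm (emb m (d \<cdot>\<^sub>m dg (k m) {i})) = cmod d" for d
  proof (rule antisym)
    have "op_norm (d \<cdot>\<^sub>m dg (k m) {i}) \<le> cmod d * op_norm (dg (k m) {i})"
      by (rule op_norm_smult_le[OF dg_carrier(1)])
    also have "\<dots> \<le> cmod d * 1" by (intro mult_left_mono op_norm_dg) simp
    finally show "nrm (emb m (d \<cdot>\<^sub>m dg (k m) {i})) \<le> cmod d" by (simp add: nrm_emb[OF dc])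
    have "(d \<cdot>\<^sub>m dg (k m) {i}) $$ (i, i) = d" using i by (simp add: dg_def)
    then show "cmod d \<le> nrm (emb m (d \<cdot>\<^sub>m dg (k m) {i}))"
      using op_norm_entry[OF dc i i, of d] by (simp add: nrm_emb[OF dc])
  qed
  have "dg (k m) {i} * A * dg (k m) {i} = c \<cdot>\<^sub>m dg (k m) {i}"
    unfolding dg_mult_mult_dg[OF A(1)] by (intro eq_matI) (auto simp: c_def dg_def)
  then have C_eq: "C = ?e \<otimes>\<^bsub>U\<^esub> emb m A \<otimes>\<^bsub>U\<^esub> ?e"
    using A(1) by (simp add: C_def pr_def emb_mult mult_carrier_mat[of _ "k m" "k m"])
  have qC: "nrm (q \<ominus>\<^bsub>U\<^esub> C) < 1 / 32"
  proof -
    have "q \<ominus>\<^bsub>U\<^esub> C = ?e \<otimes>\<^bsub>U\<^esub> (p \<ominus>\<^bsub>U\<^esub> emb m A) \<otimes>\<^bsub>U\<^esub> ?e"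
      using pU emb_carrier[OF A(1)]
      by (simp add: q_def C_eq a_minus_def U.l_distr U.r_distr U.l_minus U.r_minus)
    moreover have "nrm (?e \<otimes>\<^bsub>U\<^esub> (p \<ominus>\<^bsub>U\<^esub> emb m A) \<otimes>\<^bsub>U\<^esub> ?e) \<le> nrm (p \<ominus>\<^bsub>U\<^esub> emb m A)"
      using nrm_mult_contr(1)[of "p \<ominus>\<^bsub>U\<^esub> emb m A" ?e] nrm_mult_contr(2)[of "?e \<otimes>\<^bsub>U\<^esub> (p \<ominus>\<^bsub>U\<^esub> emb m A)" ?e]
        pU emb_carrier[OF A(1)] nrm_pr by force
    ultimately show ?thesis using A(2) by simp
  qed
  have nq: "nrm q \<le> 1"
    using nrm_mult_contr(2)[of p ?e] pU p(3) nrm_pr[of m "{i}"] by (simp add: qp)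
  have eC: "?e \<ominus>\<^bsub>U\<^esub> C = emb m ((1 - c) \<cdot>\<^sub>m dg (k m) {i})"
  proof -
    have "dg (k m) {i} - c \<cdot>\<^sub>m dg (k m) {i} = (1 - c) \<cdot>\<^sub>m dg (k m) {i}"
      by (intro eq_matI) (auto simp: algebra_simps)
    then show ?thesis unfolding C_def pr_def by (simp add: emb_minus)
  qed
  have "q \<otimes>\<^bsub>U\<^esub> (?e \<ominus>\<^bsub>U\<^esub> q) = q \<otimes>\<^bsub>U\<^esub> ?e \<ominus>\<^bsub>U\<^esub> q \<otimes>\<^bsub>U\<^esub> q"
    using qU by (simp add: a_minus_def U.r_distr U.r_minus)
  then have zero: "q \<otimes>\<^bsub>U\<^esub> (?e \<ominus>\<^bsub>U\<^esub> q) = \<zero>\<^bsub>U\<^esub>" using qe qq qU by (simp add: minus_eq_0)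
  have CeC: "C \<otimes>\<^bsub>U\<^esub> (?e \<ominus>\<^bsub>U\<^esub> C) = emb m ((c * (1 - c)) \<cdot>\<^sub>m dg (k m) {i})"
  proof -
    have "(c \<cdot>\<^sub>m dg (k m) {i}) * ((1 - c) \<cdot>\<^sub>m dg (k m) {i}) = (c * (1 - c)) \<cdot>\<^sub>m (dg (k m) {i} * dg (k m) {i})"
      by (intro eq_matI) (auto simp: scalar_prod_def sum_distrib_left algebra_simps)
    then show ?thesis unfolding eC unfolding C_def by (simp add: emb_mult dg_mult_dg)
  qed
  \<comment> \<open>As \<open>q (e - q) = 0\<close>, the product of \<open>c\<close> and
    \<open>1 - c\<close> is controlled by the distance of \<open>q\<close> from \<open>C\<close>.
    With factors of norm at most 2, the tolerance 1/32 yields 1/8.\<close>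
  have "cmod c * cmod (1 - c) = nrm (C \<otimes>\<^bsub>U\<^esub> (?e \<ominus>\<^bsub>U\<^esub> C) \<ominus>\<^bsub>U\<^esub> q \<otimes>\<^bsub>U\<^esub> (?e \<ominus>\<^bsub>U\<^esub> q))"
    unfolding zero CeC by (simp add: nd norm_mult emb_carrier[OF dc])
  also have "\<dots> \<le> nrm C * nrm ((?e \<ominus>\<^bsub>U\<^esub> C) \<ominus>\<^bsub>U\<^esub> (?e \<ominus>\<^bsub>U\<^esub> q)) + nrm (C \<ominus>\<^bsub>U\<^esub> q) * nrm (?e \<ominus>\<^bsub>U\<^esub> q)"
    using CU qU by (intro nrm_mult_diff_mult) auto
  also have "(?e \<ominus>\<^bsub>U\<^esub> C) \<ominus>\<^bsub>U\<^esub> (?e \<ominus>\<^bsub>U\<^esub> q) = q \<ominus>\<^bsub>U\<^esub> C"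
  proof -
    let ?u = "?e \<ominus>\<^bsub>U\<^esub> q" and ?v = "q \<ominus>\<^bsub>U\<^esub> C"
    have uv: "?u \<in> carrier U" "?v \<in> carrier U" using CU qU by auto
    have "?e \<ominus>\<^bsub>U\<^esub> C = ?v \<oplus>\<^bsub>U\<^esub> ?u"
      using minus_add_minus[of ?e q C] CU qU U.a_comm[OF uv] by simp
    then show ?thesis using uv by (simp add: a_minus_def[of _ _ ?u] U.a_assoc U.r_neg)
  qed
  also have "nrm (C \<ominus>\<^bsub>U\<^esub> q) = nrm (q \<ominus>\<^bsub>U\<^esub> C)" using CU qU by (rule nrm_minus_commute)
  also have "nrm C * nrm (q \<ominus>\<^bsub>U\<^esub> C) + nrm (q \<ominus>\<^bsub>U\<^esub> C) * nrm (?e \<ominus>\<^bsub>U\<^esub> q) \<le> 2 * (1 / 32) + (1 / 32) * 2"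
  proof (intro add_mono mult_mono)
    show "nrm C \<le> 2" using nrm_le_diff[OF CU qU] nrm_minus_commute[OF CU qU] qC nq by linarith
    have "nrm (?e \<ominus>\<^bsub>U\<^esub> q) \<le> nrm (?e \<ominus>\<^bsub>U\<^esub> \<zero>\<^bsub>U\<^esub>) + nrm (\<zero>\<^bsub>U\<^esub> \<ominus>\<^bsub>U\<^esub> q)"
      using qU by (intro nrm_triangle) auto
    also have "nrm (\<zero>\<^bsub>U\<^esub> \<ominus>\<^bsub>U\<^esub> q) = nrm q"
      using nrm_minus_commute[of "\<zero>\<^bsub>U\<^esub>" q] qU by (simp add: a_minus_def)
    finally show "nrm (?e \<ominus>\<^bsub>U\<^esub> q) \<le> 2" using nrm_pr[of m "{i}"] nq by (simp add: a_minus_def)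
  qed (use qC nrm_nonneg CU qU in auto)
  finally have small: "cmod c * cmod (1 - c) \<le> 1 / 8" by simp
  show ?thesis
  \<comment> \<open>In the first case \<open>q\<close> has norm at most 1/2 + 1/32, in the second
    \<open>e - q\<close> has norm at most 1/4 + 1/32. Both are idempotents of norm below 1, hence
    0.\<close>
  proof (cases "cmod c \<le> 1 / 2")
    case True
    have "nrm q < 1" using nrm_le_diff[OF qU CU] qC True nd[of c] by (simp add: C_def)
    then have "q = \<zero>\<^bsub>U\<^esub>" by (rule idempotent_small_zero[OF qU qq])
    then show ?thesis by (simp add: qp)
  next
    case False
    then have "1 / 2 * cmod (1 - c) \<le> cmod c * cmod (1 - c)" by (intro mult_right_mono) auto
    then have "cmod (1 - c) \<le> 1 / 4" using small by linarith
    moreover have "nrm (?e \<ominus>\<^bsub>U\<^esub> q) \<le> nrm (?e \<ominus>\<^bsub>U\<^esub> C) + nrm (C \<ominus>\<^bsub>U\<^esub> q)"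
      using CU qU by (intro nrm_triangle) auto
    ultimately have lt: "nrm (?e \<ominus>\<^bsub>U\<^esub> q) < 1"
      using qC nrm_minus_commute[OF CU qU] nd[of "1 - c"] by (simp add: eC)
    have "(?e \<ominus>\<^bsub>U\<^esub> q) \<otimes>\<^bsub>U\<^esub> (?e \<ominus>\<^bsub>U\<^esub> q) = ?e \<otimes>\<^bsub>U\<^esub> (?e \<ominus>\<^bsub>U\<^esub> q) \<ominus>\<^bsub>U\<^esub> q \<otimes>\<^bsub>U\<^esub> (?e \<ominus>\<^bsub>U\<^esub> q)"
      using qU by (simp add: a_minus_def U.l_distr U.l_minus)
    also have "\<dots> = ?e \<ominus>\<^bsub>U\<^esub> q"
      unfolding zero using qU ee qe by (simp add: a_minus_def U.r_distr U.r_minus)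
    finally have "?e \<ominus>\<^bsub>U\<^esub> q = \<zero>\<^bsub>U\<^esub>" using lt qU by (intro idempotent_small_zero) auto
    then show ?thesis using qU by (simp add: qp minus_eq_0)
  qed
qed

text \<open>A single stage that approximates \<open>p\<close> within 1/32 settles all its atoms at
  once, so \<open>p\<close> is the sum of the atoms of that stage which it dominates.\<close>

lemma idempotent_is_pr:
  assumes p: "p \<in> T" "p \<otimes>\<^bsub>U\<^esub> p = p" "nrm p \<le> 1"
  obtains n S where "p = pr n S" "S \<subseteq> {..<k n}"
proof -
  have pU: "p \<in> carrier U" using p by (intro T_carrier)
  obtain m A where A: "A \<in> tris m" "nrm (p \<ominus>\<^bsub>U\<^esub> emb m A) < 1 / 32"
    by (rule T_approx[OF p(1), of "1 / 32" 0]) auto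
  define S where "S = {i. i < k m \<and> p \<otimes>\<^bsub>U\<^esub> pr m {i} = pr m {i}}"
  have "p \<ominus>\<^bsub>U\<^esub> pr m S = \<zero>\<^bsub>U\<^esub>"
  proof (rule atoms_zero[of _ m])
    fix i assume i: "i < k m"
    have "(p \<ominus>\<^bsub>U\<^esub> pr m S) \<otimes>\<^bsub>U\<^esub> pr m {i} = p \<otimes>\<^bsub>U\<^esub> pr m {i} \<ominus>\<^bsub>U\<^esub> pr m (S \<inter> {i})"
      using pU by (simp add: a_minus_def U.l_distr U.l_minus pr_mult_pr)
    also have "\<dots> = \<zero>\<^bsub>U\<^esub>"
    proof (cases "i \<in> S")
      case True
      then have "S \<inter> {i} = {i}" by blast
      then show ?thesis using True by (simp add: S_def minus_eq_0)
    next
      case False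
      then have "p \<otimes>\<^bsub>U\<^esub> pr m {i} = \<zero>\<^bsub>U\<^esub>"
        using idempotent_atom[OF p i tri_carrier[OF A(1)] A(2)] i by (auto simp: S_def)
      moreover have "pr m (S \<inter> {i}) = \<zero>\<^bsub>U\<^esub>" using False by (simp add: pr_eq_0_iff)
      ultimately show ?thesis by (simp add: minus_eq_0)
    qed
    finally show "(p \<ominus>\<^bsub>U\<^esub> pr m S) \<otimes>\<^bsub>U\<^esub> pr m {i} = \<zero>\<^bsub>U\<^esub>" .
  qed (use pU in simp)
  then have "p = pr m S" using pU by (simp add: minus_eq_0)
  then show thesis by (rule that) (auto simp: S_def)
qed

end

text \<open>Choosing in \<open>R s\<close> one index per residue injects the pairs of an
  \<open>s\<close> and a residue into the pairs of an element of \<open>S'\<close> and a residue,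
  because index and residue determine each other's block and the \<open>R s\<close> are disjoint.
  The factor \<open>r\<close> then cancels.\<close>

lemma card_le_of_disjoint_transversals:
  fixes S S' :: "nat set" and R :: "nat \<Rightarrow> nat set"
  assumes fin: "finite S'" and r: "0 < r"
    and ex: "\<And>s \<sigma>. s \<in> S \<Longrightarrow> \<sigma> < r \<Longrightarrow> \<exists>p\<in>R s. p mod r = \<sigma>"
    and sub: "\<And>s. s \<in> S \<Longrightarrow> R s \<subseteq> {p. p div r \<in> S'}"
    and disj: "\<And>s s'. s \<in> S \<Longrightarrow> s' \<in> S \<Longrightarrow> s \<noteq> s' \<Longrightarrow> R s \<inter> R s' = {}"
  shows "card S \<le> card S'"
proof -
  obtain p where p: "\<And>s \<sigma>. s \<in> S \<Longrightarrow> \<sigma> < r \<Longrightarrow> p s \<sigma> \<in> R s"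
    "\<And>s \<sigma>. s \<in> S \<Longrightarrow> \<sigma> < r \<Longrightarrow> p s \<sigma> mod r = \<sigma>"
    using ex by metis
  have "inj_on (\<lambda>(s, \<sigma>). (p s \<sigma> div r, \<sigma>)) (S \<times> {..<r})"
  proof (rule inj_onI)
    fix x y assume x: "x \<in> S \<times> {..<r}" and y: "y \<in> S \<times> {..<r}"
      and eq: "(\<lambda>(s, \<sigma>). (p s \<sigma> div r, \<sigma>)) x = (\<lambda>(s, \<sigma>). (p s \<sigma> div r, \<sigma>)) y"
    obtain s \<sigma> s' where xy: "x = (s, \<sigma>)" "y = (s', \<sigma>)" using eq by (cases x; cases y) auto
    have h: "s \<in> S" "\<sigma> < r" "s' \<in> S" "p s \<sigma> div r = p s' \<sigma> div r" using x y eq xy by auto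
    then have "p s \<sigma> = p s' \<sigma>" using p(2)[of s \<sigma>] p(2)[of s' \<sigma>] by (metis div_mult_mod_eq)
    then have "s = s'" using p(1)[of s \<sigma>] p(1)[of s' \<sigma>] disj[of s s'] h by auto
    then show "x = y" using xy by simp
  qed
  moreover have "(\<lambda>(s, \<sigma>). (p s \<sigma> div r, \<sigma>)) ` (S \<times> {..<r}) \<subseteq> S' \<times> {..<r}"
    using p(1) sub by auto
  ultimately have "card (S \<times> {..<r}) \<le> card (S' \<times> {..<r})" using fin by (intro card_inj_on_le) auto
  then show ?thesis using r by (simp add: card_cartesian_product)
qed

context supernatural
begin

text \<open>A diagonal projection of one stage is also one at every later stage, so finitely many
  can be placed on a common stage.\<close>

lemma common_level:
  assumes "finite I" "\<And>i. i \<in> I \<Longrightarrow> \<exists>n S. f i = pr n S"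
  shows "\<exists>N. \<forall>n\<ge>N. \<forall>i\<in>I. \<exists>S. S \<subseteq> {..<k n} \<and> f i = pr n S"
proof -
  obtain nn SS where f: "\<And>i. i \<in> I \<Longrightarrow> f i = pr (nn i) (SS i)" using assms(2) by metis
  define N where "N = Max (insert 0 (nn ` I))"
  have "\<exists>S. S \<subseteq> {..<k n} \<and> f i = pr n S" if "N \<le> n" "i \<in> I" for n i
  proof -
    have "nn i \<le> N" using assms(1) that(2) by (auto simp: N_def)
    then have "nn i \<le> n" using that(1) by simp
    then have "f i = pr n {p. p div (k n div k (nn i)) \<in> SS i}"
      unfolding f[OF that(2)] by (rule pr_up)
    also have "\<dots> = pr n ({p. p div (k n div k (nn i)) \<in> SS i} \<inter> {..<k n})" by (rule pr_cong) auto
    finally have "f i = pr n ({p. p div (k n div k (nn i)) \<in> SS i} \<inter> {..<k n})" .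
    then show ?thesis by (intro exI[of _ "{p. p div (k n div k (nn i)) \<in> SS i} \<inter> {..<k n}"] conjI) simp_all
  qed
  then show ?thesis by (intro exI[of _ N]) simp
qed

lemma pr_absorb_iff: "pr n S \<otimes>\<^bsub>U\<^esub> pr n S' = pr n S \<longleftrightarrow> S \<inter> {..<k n} \<subseteq> S'"
  by (auto simp: pr_mult_pr pr_eq_iff)

lemma pr_orth_iff: "pr n S \<otimes>\<^bsub>U\<^esub> pr n S' = \<zero>\<^bsub>U\<^esub> \<longleftrightarrow> S \<inter> S' \<inter> {..<k n} = {}"
  by (simp add: pr_mult_pr pr_eq_0_iff)

text \<open>A refined matrix is a tensor product with an identity, so its nonzero entries join
  indices of equal residue. A nonvanishing compression thus exhibits such a pair.\<close>

lemma support_mod: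
  assumes M: "M \<in> mats n" and nn: "n \<le> n'" and nz: "pr n' R \<otimes>\<^bsub>U\<^esub> emb n M \<otimes>\<^bsub>U\<^esub> pr n' R' \<noteq> \<zero>\<^bsub>U\<^esub>"
  obtains p q where "p \<in> R" "q \<in> R'" "p mod (k n' div k n) = q mod (k n' div k n)" "p < k n'" "q < k n'"
proof -
  let ?r = "k n' div k n"
  have uM: "up n n' M \<in> mats n'" by (rule up_carrier[OF nn M])
  have "pr n' R \<otimes>\<^bsub>U\<^esub> emb n M \<otimes>\<^bsub>U\<^esub> pr n' R' = emb n' (dg (k n') R * up n n' M * dg (k n') R')"
    using uM by (simp add: pr_def emb_up[OF nn M, symmetric] emb_mult mult_carrier_mat[of _ "k n'" "k n'"])
  then have "dg (k n') R * up n n' M * dg (k n') R' \<noteq> 0\<^sub>m (k n') (k n')" using nz by (metis emb_zero)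
  moreover have "dg (k n') R * up n n' M * dg (k n') R' = 0\<^sub>m (k n') (k n')"
    if no: "\<And>p q. p \<in> R \<Longrightarrow> q \<in> R' \<Longrightarrow> p < k n' \<Longrightarrow> q < k n' \<Longrightarrow> p mod ?r \<noteq> q mod ?r"
  proof -
    have "up n n' M $$ (p, q) = 0" if "p \<in> R" "q \<in> R'" "p < k n'" "q < k n'" for p q
      using no[OF that] refine_nth[OF M, of p ?r q] that by (simp add: up_def k_mult[OF nn])
    then show ?thesis unfolding dg_mult_mult_dg[OF uM] by (intro eq_matI) auto
  qed
  ultimately show thesis using that by blast
qed

end

section \<open>Matrix units acting on diagonal projections\<close>

context tree_algebra
begin

text \<open>Phrased by product and norm alone, hence invariant under isometric isomorphisms; these
  elements are exactly the diagonal projections.\<close>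

definition proj :: "uhf_element \<Rightarrow> bool" where
  "proj p \<longleftrightarrow> p \<in> T \<and> p \<otimes>\<^bsub>U\<^esub> p = p \<and> nrm p \<le> 1"

lemma proj_pr: "proj (pr n S)"
  by (simp add: proj_def pr_T pr_mult_pr nrm_pr)

lemma proj_imp_pr: "proj p \<Longrightarrow> \<exists>n S. p = pr n S"
  using idempotent_is_pr unfolding proj_def by metis

definition unit_el :: "nat \<Rightarrow> nat \<Rightarrow> uhf_element" where
  "unit_el i j = emb 0 (matrix_unit (k 0) i j)"

lemma matrix_unit_tris: "leq j i \<Longrightarrow> matrix_unit (k 0) i j \<in> tris 0"
  by (auto simp: tri_def matrix_unit_def lev_0 split: if_splits)

lemma unit_el_T: "leq j i \<Longrightarrow> unit_el i j \<in> T"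
  unfolding unit_el_def by (intro emb_T matrix_unit_tris)

text \<open>The part of \<open>R\<close> in block \<open>j\<close>, translated to block
  \<open>i\<close>: the effect on index sets of conjugation by the matrix unit with row
  \<open>i\<close> and column \<open>j\<close>.\<close>

definition shift :: "nat \<Rightarrow> nat \<Rightarrow> nat \<Rightarrow> nat set \<Rightarrow> nat set" where
  "shift r i j R = {p. p div r = i \<and> j * r + p mod r \<in> R}"

lemma shift_shift: "0 < r \<Longrightarrow> R \<subseteq> {p. p div r = i} \<Longrightarrow> shift r i j (shift r j i R) = R"
  by (auto simp: shift_def)

text \<open>At stage \<open>n\<close> the matrix unit is a partial permutation matrix that carries
  block \<open>j\<close> onto block \<open>i\<close> and preserves residues.\<close>

lemma unit_el_pr:
  assumes ij: "i < k 0" "j < k 0"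
  shows "unit_el i j \<otimes>\<^bsub>U\<^esub> pr n R = pr n (shift (k n div k 0) i j R) \<otimes>\<^bsub>U\<^esub> unit_el i j"
proof -
  let ?r = "k n div k 0"
  let ?M = "up 0 n (matrix_unit (k 0) i j)"
  have E: "matrix_unit (k 0) i j \<in> mats 0" by (simp add: matrix_unit_def)
  have M: "?M \<in> mats n" by (rule up_carrier[OF _ E]) simp
  have M_nth: "?M $$ (p, q) = (if p mod ?r = q mod ?r \<and> p div ?r = i \<and> q div ?r = j then 1 else 0)"
    if "p < k n" "q < k n" for p q
    using that refine_nth[OF E, of p ?r q] div_less_k[of 0 n p] div_less_k[of 0 n q]
    by (simp add: up_def k_mult matrix_unit_def)
  have "?M * dg (k n) R = dg (k n) (shift ?r i j R) * ?M"
  proof (rule eq_matI)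
    fix p q assume "p < dim_row (dg (k n) (shift ?r i j R) * ?M)" "q < dim_col (dg (k n) (shift ?r i j R) * ?M)"
    then have pq: "p < k n" "q < k n" using M by auto
    have "p mod ?r = q mod ?r \<Longrightarrow> q div ?r = j \<Longrightarrow> j * ?r + p mod ?r = q" by (metis div_mult_mod_eq)
    then show "(?M * dg (k n) R) $$ (p, q) = (dg (k n) (shift ?r i j R) * ?M) $$ (p, q)"
      unfolding mult_dg[OF M] dg_mult[OF M] using pq by (auto simp: M_nth shift_def)
  qed (use M in auto)
  then show ?thesis
    using M by (simp add: unit_el_def emb_up[of 0 n, OF _ E, symmetric] pr_def emb_mult)
qed

text \<open>Any index of \<open>p\<close> lies in block \<open>j\<close>, and its column in the
  product contains an entry 1.\<close>

lemma nrm_unit_el_pr: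
  assumes ij: "i < k 0" "j < k 0" and p: "proj p" "p \<otimes>\<^bsub>U\<^esub> pr 0 {j} = p" "p \<noteq> \<zero>\<^bsub>U\<^esub>"
  shows "1 \<le> nrm (unit_el i j \<otimes>\<^bsub>U\<^esub> p)"
proof -
  obtain n R where p_eq: "p = pr n R" using proj_imp_pr[OF p(1)] by blast
  let ?r = "k n div k 0"
  let ?M = "up 0 n (matrix_unit (k 0) i j)"
  have r: "0 < ?r" by (simp add: k_div_pos)
  have E: "matrix_unit (k 0) i j \<in> mats 0" by (simp add: matrix_unit_def)
  have M: "?M \<in> mats n" by (rule up_carrier[OF _ E]) simp
  obtain q where q: "q \<in> R" "q < k n" using p(3) by (auto simp: p_eq pr_eq_0_iff)
  have "R \<inter> {..<k n} \<subseteq> {p. p div ?r \<in> {j}}"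
    using p(2) unfolding p_eq pr_up[of 0 n "{j}", OF le0] pr_absorb_iff .
  then have qj: "q div ?r = j" using q by auto
  define p' where "p' = i * ?r + q mod ?r"
  have p': "p' div ?r = i" "p' mod ?r = q mod ?r" "p' < k n"
    using r mult_add_less[OF ij(1), of "q mod ?r" ?r] by (auto simp: p'_def k_mult)
  have "(?M * dg (k n) R) $$ (p', q) = 1"
    unfolding mult_dg[OF M] using p' q qj ij refine_nth[OF E, of p' ?r q]
    by (simp add: up_def k_mult matrix_unit_def)
  moreover have "unit_el i j \<otimes>\<^bsub>U\<^esub> p = emb n (?M * dg (k n) R)"
    using M by (simp add: p_eq unit_el_def emb_up[of 0 n, OF _ E, symmetric] pr_def emb_mult)
  ultimately show ?thesis
    using op_norm_entry[OF mult_carrier_mat[OF M dg_carrier(1)] p'(3) q(2), of R]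
      nrm_emb[OF mult_carrier_mat[OF M dg_carrier(1)], of R] by simp
qed

text \<open>Translated to block \<open>j\<close>, the projection can be moved to the other side of
  the matrix unit, where the preceding lemma applies.\<close>

lemma nrm_pr_unit_el:
  assumes ij: "i < k 0" "j < k 0" and p: "proj p" "p \<otimes>\<^bsub>U\<^esub> pr 0 {i} = p" "p \<noteq> \<zero>\<^bsub>U\<^esub>"
  shows "1 \<le> nrm (p \<otimes>\<^bsub>U\<^esub> unit_el i j)"
proof -
  obtain n R where p_eq: "p = pr n R" using proj_imp_pr[OF p(1)] by blast
  let ?r = "k n div k 0"
  have r: "0 < ?r" by (simp add: k_div_pos)
  define R' where "R' = R \<inter> {..<k n}"
  have p_eq': "p = pr n R'" unfolding p_eq R'_def by (rule pr_cong) auto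
  have "R \<inter> {..<k n} \<subseteq> {p. p div ?r \<in> {i}}"
    using p(2) unfolding p_eq pr_up[of 0 n "{i}", OF le0] pr_absorb_iff .
  then have Ri: "R' \<subseteq> {p. p div ?r = i}" by (auto simp: R'_def)
  let ?q = "pr n (shift ?r j i R')"
  have eq: "unit_el i j \<otimes>\<^bsub>U\<^esub> ?q = p \<otimes>\<^bsub>U\<^esub> unit_el i j"
    unfolding unit_el_pr[OF ij] shift_shift[OF r Ri] p_eq' ..
  obtain q where q: "q \<in> R'" using p(3) by (auto simp: p_eq pr_eq_0_iff R'_def)
  then have "i * ?r + q mod ?r = q" using Ri by (metis (mono_tags) div_mult_mod_eq mem_Collect_eq subsetD)
  then have "j * ?r + q mod ?r \<in> shift ?r j i R'" using r q by (auto simp: shift_def)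
  moreover have "j * ?r + q mod ?r < k n" using mult_add_less[OF ij(2), of "q mod ?r" ?r] r by (simp add: k_mult)
  ultimately have "?q \<noteq> \<zero>\<^bsub>U\<^esub>" by (auto simp: pr_eq_0_iff)
  moreover have "?q \<otimes>\<^bsub>U\<^esub> pr 0 {j} = ?q"
    unfolding pr_up[of 0 n "{j}", OF le0] pr_absorb_iff by (auto simp: shift_def)
  ultimately show ?thesis using nrm_unit_el_pr[OF ij proj_pr, of n "shift ?r j i R'"] eq by simp
qed

text \<open>Relations with both matrix units are recorded because, for distinct \<open>i\<close> and
  \<open>j\<close>, at most one of the two lies in the algebra, and which one depends on how
  \<open>i\<close> and \<open>j\<close> compare.\<close>

lemma orthogonal_family_shift:
  assumes ij: "i < k 0" "j < k 0" and I: "finite I"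
    and \<phi>: "\<And>s. s \<in> I \<Longrightarrow> proj (\<phi> s)" "\<And>s. s \<in> I \<Longrightarrow> \<phi> s \<otimes>\<^bsub>U\<^esub> pr 0 {j} = \<phi> s"
    and orth: "\<And>s t. s \<in> I \<Longrightarrow> t \<in> I \<Longrightarrow> s \<noteq> t \<Longrightarrow> \<phi> s \<otimes>\<^bsub>U\<^esub> \<phi> t = \<zero>\<^bsub>U\<^esub>"
  obtains \<psi> where "\<And>s. s \<in> I \<Longrightarrow> proj (\<psi> s)" "\<And>s. s \<in> I \<Longrightarrow> \<psi> s \<otimes>\<^bsub>U\<^esub> pr 0 {i} = \<psi> s"
    "\<And>s t. s \<in> I \<Longrightarrow> t \<in> I \<Longrightarrow> s \<noteq> t \<Longrightarrow> \<psi> s \<otimes>\<^bsub>U\<^esub> \<psi> t = \<zero>\<^bsub>U\<^esub>"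
    "\<And>s. s \<in> I \<Longrightarrow> unit_el i j \<otimes>\<^bsub>U\<^esub> \<phi> s = \<psi> s \<otimes>\<^bsub>U\<^esub> unit_el i j"
    "\<And>s. s \<in> I \<Longrightarrow> unit_el j i \<otimes>\<^bsub>U\<^esub> \<psi> s = \<phi> s \<otimes>\<^bsub>U\<^esub> unit_el j i"
proof -
  obtain n where n: "\<And>s. s \<in> I \<Longrightarrow> \<exists>S. S \<subseteq> {..<k n} \<and> \<phi> s = pr n S"
    using common_level[OF I, of \<phi>] proj_imp_pr \<phi>(1) by blast
  then obtain R where R: "\<And>s. s \<in> I \<Longrightarrow> R s \<subseteq> {..<k n}" "\<And>s. s \<in> I \<Longrightarrow> \<phi> s = pr n (R s)" by metis
  let ?r = "k n div k 0"
  have r: "0 < ?r" by (simp add: k_div_pos)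
  have Rj: "R s \<subseteq> {p. p div ?r = j}" if "s \<in> I" for s
  proof -
    have "R s \<inter> {..<k n} \<subseteq> {p. p div ?r \<in> {j}}"
      using \<phi>(2)[OF that] unfolding R(2)[OF that] pr_up[of 0 n "{j}", OF le0] pr_absorb_iff .
    then show ?thesis using R(1)[OF that] by auto
  qed
  define \<psi> where "\<psi> s = pr n (shift ?r i j (R s))" for s
  show thesis
  proof (rule that[of \<psi>])
    fix s assume s: "s \<in> I"
    show "proj (\<psi> s)" by (simp add: \<psi>_def proj_pr)
    show "\<psi> s \<otimes>\<^bsub>U\<^esub> pr 0 {i} = \<psi> s"
      unfolding \<psi>_def pr_up[of 0 n "{i}", OF le0] pr_absorb_iff by (auto simp: shift_def)
    show "unit_el i j \<otimes>\<^bsub>U\<^esub> \<phi> s = \<psi> s \<otimes>\<^bsub>U\<^esub> unit_el i j"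
      unfolding R(2)[OF s] \<psi>_def by (rule unit_el_pr[OF ij])
    show "unit_el j i \<otimes>\<^bsub>U\<^esub> \<psi> s = \<phi> s \<otimes>\<^bsub>U\<^esub> unit_el j i"
      unfolding R(2)[OF s] \<psi>_def unit_el_pr[OF ij(2,1)] shift_shift[OF r Rj[OF s]] ..
    fix t assume t: "t \<in> I" "s \<noteq> t"
    have "R s \<inter> R t \<inter> {..<k n} = {}"
      using orth[OF s t] unfolding R(2)[OF s] R(2)[OF t(1)] pr_orth_iff .
    then have "R s \<inter> R t = {}" using R(1)[OF s] by blast
    then show "\<psi> s \<otimes>\<^bsub>U\<^esub> \<psi> t = \<zero>\<^bsub>U\<^esub>"
      unfolding \<psi>_def pr_orth_iff by (auto simp: shift_def)
  qed
qed

end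

section \<open>An isometric isomorphism determines the tree\<close>

locale tree_algebra_iso = A: tree_algebra k G leq + B: tree_algebra l H leq'
  for k :: "nat \<Rightarrow> nat" and G leq and l :: "nat \<Rightarrow> nat" and H leq' +
  fixes \<Phi> :: "uhf_element \<Rightarrow> uhf_element"
  assumes bij: "bij_betw \<Phi> A.T B.T"
    and \<Phi>_mult: "x \<in> A.T \<Longrightarrow> y \<in> A.T \<Longrightarrow> \<Phi> (x \<otimes>\<^bsub>A.U\<^esub> y) = \<Phi> x \<otimes>\<^bsub>B.U\<^esub> \<Phi> y"
    and \<Phi>_zero: "\<Phi> \<zero>\<^bsub>A.U\<^esub> = \<zero>\<^bsub>B.U\<^esub>"
    and \<Phi>_norm: "x \<in> A.T \<Longrightarrow> B.nrm (\<Phi> x) = A.nrm x"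
begin

definition \<Psi> :: "uhf_element \<Rightarrow> uhf_element" where
  "\<Psi> = inv_into A.T \<Phi>"

lemma \<Phi>_T: "x \<in> A.T \<Longrightarrow> \<Phi> x \<in> B.T"
  using bij by (auto simp: bij_betw_def)

lemma \<Psi>_T: "y \<in> B.T \<Longrightarrow> \<Psi> y \<in> A.T"
  unfolding \<Psi>_def using bij_betw_inv_into[OF bij] by (auto simp: bij_betw_def)

lemma \<Phi>_\<Psi>: "y \<in> B.T \<Longrightarrow> \<Phi> (\<Psi> y) = y"
  unfolding \<Psi>_def using bij by (simp add: bij_betw_inv_into_right)

lemma \<Psi>_\<Phi>: "x \<in> A.T \<Longrightarrow> \<Psi> (\<Phi> x) = x"
  unfolding \<Psi>_def using bij by (simp add: bij_betw_inv_into_left)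

lemma \<Psi>_mult: "x \<in> B.T \<Longrightarrow> y \<in> B.T \<Longrightarrow> \<Psi> (x \<otimes>\<^bsub>B.U\<^esub> y) = \<Psi> x \<otimes>\<^bsub>A.U\<^esub> \<Psi> y"
  using \<Psi>_\<Phi>[OF A.T_mult[OF \<Psi>_T \<Psi>_T]] \<Phi>_mult[OF \<Psi>_T \<Psi>_T] \<Phi>_\<Psi> by simp

lemma zero_T: "\<zero>\<^bsub>A.U\<^esub> \<in> A.T" "\<zero>\<^bsub>B.U\<^esub> \<in> B.T"
  using A.pr_T[of 0 "{}"] B.pr_T[of 0 "{}"] A.pr_eq_0_iff[of 0 "{}"] B.pr_eq_0_iff[of 0 "{}"] by simp_all

lemma \<Psi>_zero: "\<Psi> \<zero>\<^bsub>B.U\<^esub> = \<zero>\<^bsub>A.U\<^esub>"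
  using \<Psi>_\<Phi>[OF zero_T(1)] \<Phi>_zero by simp

lemma \<Psi>_eq_0: "y \<in> B.T \<Longrightarrow> \<Psi> y = \<zero>\<^bsub>A.U\<^esub> \<longleftrightarrow> y = \<zero>\<^bsub>B.U\<^esub>"
  using \<Phi>_\<Psi>[of y] \<Phi>_zero \<Psi>_zero by metis

lemma \<Phi>_eq_0: "x \<in> A.T \<Longrightarrow> \<Phi> x = \<zero>\<^bsub>B.U\<^esub> \<longleftrightarrow> x = \<zero>\<^bsub>A.U\<^esub>"
  using \<Psi>_\<Phi>[of x] \<Phi>_zero \<Psi>_zero by metis

lemma \<Phi>_proj: "A.proj p \<Longrightarrow> B.proj (\<Phi> p)"
  unfolding A.proj_def B.proj_def using \<Phi>_T \<Phi>_mult \<Phi>_norm by metis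

lemma \<Psi>_norm: "y \<in> B.T \<Longrightarrow> A.nrm (\<Psi> y) = B.nrm y"
  using \<Phi>_norm[OF \<Psi>_T] \<Phi>_\<Psi> by metis

lemma \<Psi>_proj: "B.proj p \<Longrightarrow> A.proj (\<Psi> p)"
  unfolding A.proj_def B.proj_def using \<Psi>_T \<Psi>_mult \<Psi>_norm by metis

lemma proj_T: "A.proj p \<Longrightarrow> p \<in> A.T" "B.proj q \<Longrightarrow> q \<in> B.T"
  by (simp_all add: A.proj_def B.proj_def)

definition vertex_el :: "nat \<Rightarrow> uhf_element" where
  "vertex_el v = \<Phi> (A.pr 0 {v})"

lemma vertex_el_proj: "B.proj (vertex_el v)"
  unfolding vertex_el_def by (intro \<Phi>_proj A.proj_pr)

lemma \<Psi>_vertex_el: "\<Psi> (vertex_el v) = A.pr 0 {v}"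
  unfolding vertex_el_def by (intro \<Psi>_\<Phi> A.pr_T)

text \<open>
  The image of a matrix unit intertwines the two diagonal corners.  Replacing it by a nearby element
  of a finite stage, each atom of one corner is matched, at a later stage, with an atom of the other.
\<close>

lemma card_le_intertwine:
  assumes ij: "i < k 0" "j < k 0"
    and S: "S \<subseteq> {..<l N}" "vertex_el j = B.pr N S"
    and S': "S' \<subseteq> {..<l N}" "vertex_el i = B.pr N S'"
    and cnd: "(leq j i \<and> V = \<Phi> (A.unit_el i j)) \<or> (leq i j \<and> V = \<Phi> (A.unit_el j i))"
    and M: "M \<in> B.mats N" "B.nrm (V \<ominus>\<^bsub>B.U\<^esub> B.emb N M) < 1"
  shows "card S \<le> card S'"
proof -
  have fS: "finite S" "finite S'" using S(1) S'(1) finite_subset by blast+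
  \<comment> \<open>The atoms \<open>f s\<close> of the corner of \<open>j\<close> are pulled back
    to \<open>\<phi> s\<close>, translated by the matrix unit to \<open>\<psi> s\<close> under
    vertex \<open>i\<close>, and mapped forward to \<open>E s\<close>, which lie in the corner of
    \<open>i\<close> but at an unknown stage.\<close>
  define f where "f s = B.pr N {s}" for s
  define \<phi> where "\<phi> s = \<Psi> (f s)" for s
  have f_T: "f s \<in> B.T" for s by (simp add: f_def B.pr_T)
  have \<phi>_proj: "A.proj (\<phi> s)" for s unfolding \<phi>_def f_def by (intro \<Psi>_proj B.proj_pr)
  have \<phi>_j: "\<phi> s \<otimes>\<^bsub>A.U\<^esub> A.pr 0 {j} = \<phi> s" if "s \<in> S" for s
  proof -
    have "f s \<otimes>\<^bsub>B.U\<^esub> vertex_el j = f s"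
      unfolding f_def S(2) B.pr_absorb_iff using that by auto
    then show ?thesis
      using \<Psi>_mult[OF f_T[of s] proj_T(2)[OF vertex_el_proj[of j]]] unfolding \<phi>_def \<Psi>_vertex_el by simp
  qed
  have \<phi>_orth: "\<phi> s \<otimes>\<^bsub>A.U\<^esub> \<phi> t = \<zero>\<^bsub>A.U\<^esub>" if "s \<noteq> t" for s t
  proof -
    have "f s \<otimes>\<^bsub>B.U\<^esub> f t = \<zero>\<^bsub>B.U\<^esub>" unfolding f_def B.pr_orth_iff using that by auto
    then show ?thesis using \<Psi>_mult[OF f_T f_T] \<Psi>_zero by (metis \<phi>_def)
  qed
  obtain \<psi> where \<psi>: "\<And>s. s \<in> S \<Longrightarrow> A.proj (\<psi> s)" "\<And>s. s \<in> S \<Longrightarrow> \<psi> s \<otimes>\<^bsub>A.U\<^esub> A.pr 0 {i} = \<psi> s"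
    "\<And>s t. s \<in> S \<Longrightarrow> t \<in> S \<Longrightarrow> s \<noteq> t \<Longrightarrow> \<psi> s \<otimes>\<^bsub>A.U\<^esub> \<psi> t = \<zero>\<^bsub>A.U\<^esub>"
    "\<And>s. s \<in> S \<Longrightarrow> A.unit_el i j \<otimes>\<^bsub>A.U\<^esub> \<phi> s = \<psi> s \<otimes>\<^bsub>A.U\<^esub> A.unit_el i j"
    "\<And>s. s \<in> S \<Longrightarrow> A.unit_el j i \<otimes>\<^bsub>A.U\<^esub> \<psi> s = \<phi> s \<otimes>\<^bsub>A.U\<^esub> A.unit_el j i"
    using A.orthogonal_family_shift[OF ij(1,2) fS(1), of \<phi>, OF \<phi>_proj \<phi>_j \<phi>_orth] by blast
  define E where "E s = \<Phi> (\<psi> s)" for s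
  have E_T: "E s \<in> B.T" if "s \<in> S" for s unfolding E_def by (intro \<Phi>_T proj_T \<psi>(1) that)
  have "\<exists>n R. E s = B.pr n R" if "s \<in> S" for s
    unfolding E_def by (intro B.proj_imp_pr \<Phi>_proj \<psi>(1) that)
  then obtain N0 where N0: "\<And>n s. N0 \<le> n \<Longrightarrow> s \<in> S \<Longrightarrow> \<exists>R. R \<subseteq> {..<l n} \<and> E s = B.pr n R"
    using B.common_level[OF fS(1), of E] by blast
  \<comment> \<open>All \<open>E s\<close> live at stage \<open>n\<close>, while \<open>S\<close>,
    \<open>S'\<close> and \<open>M\<close> belong to stage \<open>N\<close>; the excess of
    \<open>n\<close> over \<open>N\<close> is absorbed by the residues modulo
    \<open>?r\<close>.\<close>
  define n where "n = max N N0"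
  have n: "N \<le> n" by (simp add: n_def)
  obtain R where R: "\<And>s. s \<in> S \<Longrightarrow> R s \<subseteq> {..<l n}" "\<And>s. s \<in> S \<Longrightarrow> E s = B.pr n (R s)"
    using N0[of n] unfolding n_def by (metis max.cobounded2)
  let ?r = "l n div l N"
  have r: "0 < ?r" by (rule B.k_div_pos[OF n])
  have VT: "V \<in> B.T" using cnd A.unit_el_T \<Phi>_T by blast
  have VU: "V \<in> carrier B.U" using VT by (rule B.T_carrier)
  have MU: "B.emb N M \<in> carrier B.U" by (rule B.emb_carrier[OF M(1)])
  show ?thesis
  proof (rule card_le_of_disjoint_transversals[OF fS(2) r])
    fix s assume s: "s \<in> S"
    show "R s \<subseteq> {p. p div ?r \<in> S'}"
    proof -
      have "E s \<otimes>\<^bsub>B.U\<^esub> vertex_el i = E s"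
        unfolding E_def vertex_el_def using \<Phi>_mult[OF proj_T(1)[OF \<psi>(1)[OF s]] A.pr_T] \<psi>(2)[OF s] by metis
      then have "R s \<inter> {..<l n} \<subseteq> {p. p div ?r \<in> S'}"
        unfolding R(2)[OF s] S'(2) B.pr_up[OF n] B.pr_absorb_iff .
      then show ?thesis using R(1)[OF s] by blast
    qed
    show "R s \<inter> R t = {}" if t: "t \<in> S" "s \<noteq> t" for t
    proof -
      have "E s \<otimes>\<^bsub>B.U\<^esub> E t = \<zero>\<^bsub>B.U\<^esub>"
        unfolding E_def using \<Phi>_mult[OF proj_T(1)[OF \<psi>(1)[OF s]] proj_T(1)[OF \<psi>(1)[OF t(1)]]]
          \<psi>(3)[OF s t] \<Phi>_zero by metis
      then show ?thesis unfolding R(2)[OF s] R(2)[OF t(1)] B.pr_orth_iff using R(1)[OF s] by blast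
    qed
    fix \<sigma> assume \<sigma>: "\<sigma> < ?r"
    \<comment> \<open>The atom of stage \<open>n\<close> inside \<open>f s\<close> whose residue is
      \<open>\<sigma>\<close>; it is the test element that produces an index of residue
      \<open>\<sigma>\<close> in \<open>R s\<close>.\<close>
    define g where "g = B.pr n {s * ?r + \<sigma>}"
    have sN: "s < l N" using s S(1) by auto
    have g_lt: "s * ?r + \<sigma> < l n" using mult_add_less[OF sN \<sigma>] by (simp add: B.k_mult[OF n])
    have gT: "g \<in> B.T" by (simp add: g_def B.pr_T)
    have gU: "g \<in> carrier B.U" using gT by (rule B.T_carrier)
    have gnz: "g \<noteq> \<zero>\<^bsub>B.U\<^esub>" using g_lt by (simp add: g_def B.pr_eq_0_iff)
    have gf: "g \<otimes>\<^bsub>B.U\<^esub> f s = g" "f s \<otimes>\<^bsub>B.U\<^esub> g = g"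
      using \<sigma> unfolding g_def f_def B.pr_up[OF n] B.pr_mult_pr B.pr_eq_iff by auto
    define \<gamma> where "\<gamma> = \<Psi> g"
    have \<gamma>T: "\<gamma> \<in> A.T" unfolding \<gamma>_def by (rule \<Psi>_T[OF gT])
    have \<gamma>: "A.proj \<gamma>" "\<gamma> \<noteq> \<zero>\<^bsub>A.U\<^esub>"
      unfolding \<gamma>_def using \<Psi>_proj[OF B.proj_pr] \<Psi>_eq_0[OF gT] gnz by (simp_all add: g_def)
    have \<gamma>\<phi>: "\<gamma> \<otimes>\<^bsub>A.U\<^esub> \<phi> s = \<gamma>" unfolding \<gamma>_def \<phi>_def using \<Psi>_mult[OF gT f_T] gf by metis
    have U4: "\<gamma> \<in> carrier A.U" "\<phi> s \<in> carrier A.U" "A.pr 0 {j} \<in> carrier A.U"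
      using \<gamma>T proj_T(1)[OF \<phi>_proj] by (auto intro: A.T_carrier)
    have \<gamma>j: "\<gamma> \<otimes>\<^bsub>A.U\<^esub> A.pr 0 {j} = \<gamma>"
      using A.U.m_assoc[OF U4] \<phi>_j[OF s] \<gamma>\<phi> by simp
    have EU: "E s \<in> carrier B.U" and fU: "f s \<in> carrier B.U"
      using E_T[OF s] f_T by (auto intro: B.T_carrier)
    have nE: "B.nrm (E s) \<le> 1" unfolding R(2)[OF s] by (rule B.nrm_pr)
    have ng: "B.nrm g \<le> 1" unfolding g_def by (rule B.nrm_pr)
    from cnd show "\<exists>p\<in>R s. p mod ?r = \<sigma>"
    proof
      assume c: "leq j i \<and> V = \<Phi> (A.unit_el i j)"
      have uT: "A.unit_el i j \<in> A.T" using c A.unit_el_T by blast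
      have "V \<otimes>\<^bsub>B.U\<^esub> f s = E s \<otimes>\<^bsub>B.U\<^esub> V"
        using \<Phi>_mult[OF uT proj_T(1)[OF \<phi>_proj[of s]]] \<Phi>_mult[OF proj_T(1)[OF \<psi>(1)[OF s]] uT]
          \<psi>(4)[OF s] c \<Phi>_\<Psi>[OF f_T[of s]] by (simp add: E_def \<phi>_def)
      then have Vg: "V \<otimes>\<^bsub>B.U\<^esub> g = E s \<otimes>\<^bsub>B.U\<^esub> V \<otimes>\<^bsub>B.U\<^esub> g"
        using gf(2) VU fU gU by (metis B.U.m_assoc)
      have "1 \<le> B.nrm (V \<otimes>\<^bsub>B.U\<^esub> g)"
        using A.nrm_unit_el_pr[OF ij(1,2) \<gamma>(1) \<gamma>j \<gamma>(2)] \<Phi>_norm[OF A.T_mult[OF uT \<gamma>T]]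
          \<Phi>_mult[OF uT \<gamma>T] c \<Phi>_\<Psi>[OF gT] by (simp add: \<gamma>_def)
      then have big: "1 \<le> B.nrm (E s \<otimes>\<^bsub>B.U\<^esub> V \<otimes>\<^bsub>B.U\<^esub> g)" by (simp only: Vg)
      \<comment> \<open>Replacing \<open>V\<close> by the matrix \<open>M\<close> changes the
        compression by less than 1, which cannot annihilate an element of norm at least 1.\<close>
      have "B.pr n (R s) \<otimes>\<^bsub>B.U\<^esub> B.emb N M \<otimes>\<^bsub>B.U\<^esub> B.pr n {s * ?r + \<sigma>} \<noteq> \<zero>\<^bsub>B.U\<^esub>"
        using B.compression_approx[OF VU MU, of n "R s" "{s * ?r + \<sigma>}"] big M(2)
        by (auto simp: R(2)[OF s] g_def B.nrm_zero)
      then obtain p q where "p \<in> R s" "q \<in> {s * ?r + \<sigma>}" "p mod ?r = q mod ?r"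
        by (rule B.support_mod[OF M(1) n])
      then show ?thesis using \<sigma> by auto
    next
      \<comment> \<open>The mirror image: the available matrix unit goes from \<open>i\<close> to
        \<open>j\<close>, so the intertwining relation is read from the left.\<close>
      assume c: "leq i j \<and> V = \<Phi> (A.unit_el j i)"
      have uT: "A.unit_el j i \<in> A.T" using c A.unit_el_T by blast
      have "f s \<otimes>\<^bsub>B.U\<^esub> V = V \<otimes>\<^bsub>B.U\<^esub> E s"
        using \<Phi>_mult[OF uT proj_T(1)[OF \<psi>(1)[OF s]]] \<Phi>_mult[OF proj_T(1)[OF \<phi>_proj[of s]] uT]
          \<psi>(5)[OF s] c \<Phi>_\<Psi>[OF f_T[of s]] by (simp add: E_def \<phi>_def)
      then have Vg: "g \<otimes>\<^bsub>B.U\<^esub> V = g \<otimes>\<^bsub>B.U\<^esub> V \<otimes>\<^bsub>B.U\<^esub> E s"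
        using gf(1) VU fU gU EU by (metis B.U.m_assoc)
      have "1 \<le> B.nrm (g \<otimes>\<^bsub>B.U\<^esub> V)"
        using A.nrm_pr_unit_el[OF ij(2,1) \<gamma>(1) \<gamma>j \<gamma>(2)] \<Phi>_norm[OF A.T_mult[OF \<gamma>T uT]]
          \<Phi>_mult[OF \<gamma>T uT] c \<Phi>_\<Psi>[OF gT] by (simp add: \<gamma>_def)
      then have big: "1 \<le> B.nrm (g \<otimes>\<^bsub>B.U\<^esub> V \<otimes>\<^bsub>B.U\<^esub> E s)" by (simp only: Vg[symmetric])
      have "B.pr n {s * ?r + \<sigma>} \<otimes>\<^bsub>B.U\<^esub> B.emb N M \<otimes>\<^bsub>B.U\<^esub> B.pr n (R s) \<noteq> \<zero>\<^bsub>B.U\<^esub>"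
        using B.compression_approx[OF VU MU, of n "{s * ?r + \<sigma>}" "R s"] big M(2)
        by (auto simp: R(2)[OF s] g_def B.nrm_zero)
      then obtain p q where "p \<in> {s * ?r + \<sigma>}" "q \<in> R s" "p mod ?r = q mod ?r"
        by (rule B.support_mod[OF M(1) n])
      then show ?thesis using \<sigma> by auto
    qed
  qed
qed

text \<open>For comparable vertices one matrix unit gives both inequalities, since it intertwines
  the two corners from either side. Every vertex is comparable with the root, so all sizes
  agree.\<close>

lemma vertex_el_levels:
  obtains N S where "\<And>v. v < k 0 \<Longrightarrow> S v \<subseteq> {..<l N}" "\<And>v. v < k 0 \<Longrightarrow> vertex_el v = B.pr N (S v)"
    "\<And>v w. v < k 0 \<Longrightarrow> w < k 0 \<Longrightarrow> card (S v) = card (S w)"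
proof -
  have "\<exists>n R. vertex_el v = B.pr n R" for v by (rule B.proj_imp_pr[OF vertex_el_proj])
  then have "\<exists>N. \<forall>n\<ge>N. \<forall>v\<in>{..<k 0}. \<exists>R. R \<subseteq> {..<l n} \<and> vertex_el v = B.pr n R"
    by (intro B.common_level finite_lessThan)
  then obtain N0 where "\<forall>n\<ge>N0. \<forall>v\<in>{..<k 0}. \<exists>R. R \<subseteq> {..<l n} \<and> vertex_el v = B.pr n R" by blast
  then have N0: "\<exists>R. R \<subseteq> {..<l n} \<and> vertex_el v = B.pr n R" if "N0 \<le> n" "v < k 0" for n v
    using that by simp
  define good where "good i j n \<longleftrightarrow> (\<exists>M\<in>B.mats n. B.nrm (\<Phi> (A.unit_el i j) \<ominus>\<^bsub>B.U\<^esub> B.emb n M) < 1)" for i j n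
  have "\<exists>N. leq j i \<longrightarrow> (\<forall>n\<ge>N. good i j n)" for i j
  proof (cases "leq j i")
    case True
    obtain N where "\<And>n. N \<le> n \<Longrightarrow> \<exists>M\<in>B.mats n. B.nrm (\<Phi> (A.unit_el i j) \<ominus>\<^bsub>B.U\<^esub> B.emb n M) < 1"
      by (rule B.emb_dense[OF B.T_carrier[OF \<Phi>_T[OF A.unit_el_T[OF True]]], of 1]) auto
    then show ?thesis by (auto simp: good_def)
  qed auto
  then have "\<forall>i. \<exists>f. \<forall>j. leq j i \<longrightarrow> (\<forall>n\<ge>f j. good i j n)" by (intro allI choice)
  then obtain N1 where "\<forall>i j. leq j i \<longrightarrow> (\<forall>n\<ge>N1 i j. good i j n)" by (rule choice[THEN exE])
  then have N1: "\<exists>M\<in>B.mats n. B.nrm (\<Phi> (A.unit_el i j) \<ominus>\<^bsub>B.U\<^esub> B.emb n M) < 1"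
    if "leq j i" "N1 i j \<le> n" for i j n
    using that unfolding good_def by blast
  \<comment> \<open>One stage at which all vertex images are diagonal and the images of all matrix
    units of the algebra at stage 0 have approximants within distance 1.\<close>
  define N where "N = Max (insert N0 ((\<lambda>(i, j). N1 i j) ` ({..<k 0} \<times> {..<k 0})))"
  have N: "N0 \<le> N" "\<And>i j. i < k 0 \<Longrightarrow> j < k 0 \<Longrightarrow> N1 i j \<le> N"
    by (auto simp: N_def intro!: Max_ge)
  obtain S where S: "\<And>v. v < k 0 \<Longrightarrow> S v \<subseteq> {..<l N}" "\<And>v. v < k 0 \<Longrightarrow> vertex_el v = B.pr N (S v)"
    using N0[OF N(1)] by metis
  have eq: "card (S i) = card (S j)" if ij: "i < k 0" "j < k 0" "leq j i" for i j
  proof -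
    obtain M where M: "M \<in> B.mats N" "B.nrm (\<Phi> (A.unit_el i j) \<ominus>\<^bsub>B.U\<^esub> B.emb N M) < 1"
      using N1[OF ij(3) N(2)[OF ij(1,2)]] by blast
    have "card (S j) \<le> card (S i)"
      by (rule card_le_intertwine[OF ij(1,2) S(1)[OF ij(2)] S(2)[OF ij(2)] S(1)[OF ij(1)] S(2)[OF ij(1)] _ M])
        (use ij(3) in auto)
    moreover have "card (S i) \<le> card (S j)"
      by (rule card_le_intertwine[OF ij(2,1) S(1)[OF ij(1)] S(2)[OF ij(1)] S(1)[OF ij(2)] S(2)[OF ij(2)] _ M])
        (use ij(3) in auto)
    ultimately show ?thesis by simp
  qed
  interpret A0: tree_order "{..<k 0}" leq using A.tree_order_lev[of 0] by (simp add: A.lev_0)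
  obtain p where "p < k 0" "\<And>q. q < k 0 \<Longrightarrow> leq p q" using A0.root by auto
  then have "card (S v) = card (S w)" if "v < k 0" "w < k 0" for v w using eq that by metis
  with S show thesis using that by blast
qed

end

lemma card_div_vimage:
  fixes D :: "nat set"
  assumes "0 < r" "finite D"
  shows "card {u. u div r \<in> D} = r * card D"
proof -
  have "bij_betw (\<lambda>(d, s). d * r + s) (D \<times> {..<r}) {u. u div r \<in> D}"
    by (rule bij_betw_byWitness[where f' = "\<lambda>u. (u div r, u mod r)"]) (use assms in auto)
  then show ?thesis using bij_betw_same_card card_cartesian_product by (metis card_lessThan mult.commute)
qed

context tree_algebra
begin

text \<open>Refinement creates no leaves: a leaf lies in the block of a leaf, and two leaves in one
  block would be comparable.\<close>

lemma card_leaves_lev_le: "card (tree_order.leaves {..<k n} (lev n)) \<le> card (tree_order.leaves {..<k 0} leq)"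
proof -
  interpret A0: tree_order "{..<k 0}" leq using tree_order_lev[of 0] by (simp add: lev_0)
  interpret An: tree_order "{..<k n}" "lev n" by (rule tree_order_lev)
  let ?r = "k n div k 0"
  have r: "0 < ?r" by (simp add: k_div_pos)
  have lev: "lev n x y \<longleftrightarrow> leq (x div ?r) (y div ?r) \<and> (x div ?r = y div ?r \<longrightarrow> x \<le> y)" for x y
    by (simp add: lev_def amp_le_def)
  have "b div ?r \<in> A0.leaves" if b: "b \<in> An.leaves" for b
  proof -
    have bV: "b div ?r < k 0" using b div_less_k[of 0 n b] by (auto simp: An.leaves_def)
    have "y = b div ?r" if "leq (b div ?r) y" for y
    proof (rule ccontr)
      assume ne: "y \<noteq> b div ?r"
      have y: "(y * ?r) div ?r = y" using r by simp
      then have "lev n b (y * ?r)" using that ne by (auto simp: lev)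
      then have "y * ?r = b" using b by (auto simp: An.leaves_def)
      then show False using ne y by simp
    qed
    then show ?thesis using bV by (simp add: A0.leaves_def)
  qed
  moreover have "inj_on (\<lambda>b. b div ?r) An.leaves"
  proof (rule inj_onI)
    fix b c assume bc: "b \<in> An.leaves" "c \<in> An.leaves" "b div ?r = c div ?r"
    have "leq (b div ?r) (b div ?r)"
      using bc(1) div_less_k[of 0 n b] by (intro A0.le_refl) (auto simp: An.leaves_def)
    then have "lev n b c \<or> lev n c b" using bc(3) by (auto simp: lev)
    then show "b = c" using bc(1,2) by (auto simp: An.leaves_def)
  qed
  ultimately show ?thesis by (intro card_inj_on_le[of "\<lambda>b. b div ?r"]) auto
qed

end

context tree_algebra_iso
begin

text \<open>As \<open>\<Phi>\<close> maps onto the second algebra, the middle factor on that side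
  can be taken to be an image.\<close>

lemma block_transfer:
  assumes x: "x \<in> A.T" and y: "y \<in> A.T"
  shows "(\<exists>a\<in>A.T. x \<otimes>\<^bsub>A.U\<^esub> a \<otimes>\<^bsub>A.U\<^esub> y \<noteq> \<zero>\<^bsub>A.U\<^esub>) \<longleftrightarrow>
    (\<exists>b\<in>B.T. \<Phi> x \<otimes>\<^bsub>B.U\<^esub> b \<otimes>\<^bsub>B.U\<^esub> \<Phi> y \<noteq> \<zero>\<^bsub>B.U\<^esub>)"
proof -
  have eq: "\<Phi> (x \<otimes>\<^bsub>A.U\<^esub> a \<otimes>\<^bsub>A.U\<^esub> y) = \<Phi> x \<otimes>\<^bsub>B.U\<^esub> \<Phi> a \<otimes>\<^bsub>B.U\<^esub> \<Phi> y" if "a \<in> A.T" for a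
    using \<Phi>_mult[OF A.T_mult[OF x that] y] \<Phi>_mult[OF x that] by simp
  have iff: "x \<otimes>\<^bsub>A.U\<^esub> a \<otimes>\<^bsub>A.U\<^esub> y = \<zero>\<^bsub>A.U\<^esub> \<longleftrightarrow> \<Phi> x \<otimes>\<^bsub>B.U\<^esub> \<Phi> a \<otimes>\<^bsub>B.U\<^esub> \<Phi> y = \<zero>\<^bsub>B.U\<^esub>" if "a \<in> A.T" for a
    using \<Phi>_eq_0[OF A.T_mult[OF A.T_mult[OF x that] y]] eq[OF that] by simp
  have "B.T = \<Phi> ` A.T" using bij by (simp add: bij_betw_def)
  then show ?thesis using iff by auto
qed

text \<open>The sets \<open>S v\<close> partition the indices of stage \<open>N\<close> into classes
  of equal size \<open>r\<close>, which defines a map \<open>\<pi>\<close> to the vertices of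
  \<open>G\<close>. All that is known about the order is \<open>below_iff\<close>. It suffices to
  match leaves and to count common ancestors, and the counts agree with those in the
  \<open>r\<close>-fold ampliation of \<open>G\<close>.\<close>

lemma ampliations_isomorphic:
  "\<exists>r N. k 0 * r = l N \<and> digraph_iso (with_proj (ampliation r G)) (with_proj (ampliation (l N div l 0) H))"
proof -
  obtain N S where S: "\<And>v. v < k 0 \<Longrightarrow> S v \<subseteq> {..<l N}" "\<And>v. v < k 0 \<Longrightarrow> vertex_el v = B.pr N (S v)"
    and S_card: "\<And>v w. v < k 0 \<Longrightarrow> w < k 0 \<Longrightarrow> card (S v) = card (S w)"
  proof (rule vertex_el_levels)
    fix N S
    assume "\<And>v. v < k 0 \<Longrightarrow> S v \<subseteq> {..<l N}" "\<And>v. v < k 0 \<Longrightarrow> vertex_el v = B.pr N (S v)"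
      "\<And>v w. v < k 0 \<Longrightarrow> w < k 0 \<Longrightarrow> card (S v) = card (S w)"
    then show thesis by (rule that)
  qed
  interpret A0: tree_order "{..<k 0}" leq using A.tree_order_lev[of 0] by (simp add: A.lev_0)
  interpret BN: tree_order "{..<l N}" "B.lev N" by (rule B.tree_order_lev)
  define r where "r = card (S 0)"
  have k0: "0 < k 0" by (rule A.k_pos)
  have card_S: "card (S v) = r" if "v < k 0" for v using S_card[OF that k0] by (simp add: r_def)
  have fin_S: "finite (S v)" if "v < k 0" for v using S(1)[OF that] finite_subset by blast
  have disj: "S v \<inter> S w = {}" if "v < k 0" "w < k 0" "v \<noteq> w" for v w
  proof -
    have "A.pr 0 {v} \<otimes>\<^bsub>A.U\<^esub> A.pr 0 {w} = \<zero>\<^bsub>A.U\<^esub>" unfolding A.pr_orth_iff using that by auto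
    then have "vertex_el v \<otimes>\<^bsub>B.U\<^esub> vertex_el w = \<zero>\<^bsub>B.U\<^esub>"
      unfolding vertex_el_def using \<Phi>_mult[OF A.pr_T A.pr_T] \<Phi>_zero by metis
    then have "S v \<inter> S w \<inter> {..<l N} = {}" unfolding S(2)[OF that(1)] S(2)[OF that(2)] B.pr_orth_iff .
    then show ?thesis using S(1)[OF that(1)] by blast
  qed
  define atom where "atom x = \<Psi> (B.pr N {x})" for x
  have atom_T: "atom x \<in> A.T" for x unfolding atom_def by (intro \<Psi>_T B.pr_T)
  have \<Phi>_atom: "\<Phi> (atom x) = B.pr N {x}" for x unfolding atom_def by (intro \<Phi>_\<Psi> B.pr_T)
  have atom_nz: "atom x \<noteq> \<zero>\<^bsub>A.U\<^esub>" if "x < l N" for x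
    unfolding atom_def using that by (simp add: \<Psi>_eq_0[OF B.pr_T] B.pr_eq_0_iff)
  have atom_vertex: "atom x \<otimes>\<^bsub>A.U\<^esub> A.pr 0 {v} = \<Psi> (B.pr N ({x} \<inter> S v))" if "v < k 0" for x v
  proof -
    have "\<Psi> (B.pr N {x} \<otimes>\<^bsub>B.U\<^esub> vertex_el v) = atom x \<otimes>\<^bsub>A.U\<^esub> A.pr 0 {v}"
      using \<Psi>_mult[OF B.pr_T[of N "{x}"] proj_T(2)[OF vertex_el_proj[of v]]]
      unfolding \<Psi>_vertex_el atom_def .
    then show ?thesis unfolding S(2)[OF that] B.pr_mult_pr ..
  qed
  \<comment> \<open>An atom outside all \<open>S v\<close> would pull back to an element orthogonal
    to every vertex projection, hence to 0.\<close>
  have "\<exists>v<k 0. x \<in> S v" if x: "x < l N" for x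
  proof (rule ccontr)
    assume no: "\<not> (\<exists>v<k 0. x \<in> S v)"
    have "atom x = \<zero>\<^bsub>A.U\<^esub>"
    proof (rule A.atoms_zero[of _ 0])
      fix v assume v: "v < k 0"
      then have "{x} \<inter> S v = {}" using no by blast
      then have "B.pr N ({x} \<inter> S v) = \<zero>\<^bsub>B.U\<^esub>" by (simp add: B.pr_eq_0_iff)
      then show "atom x \<otimes>\<^bsub>A.U\<^esub> A.pr 0 {v} = \<zero>\<^bsub>A.U\<^esub>" using atom_vertex[OF v, of x] \<Psi>_zero by metis
    qed (rule A.T_carrier[OF atom_T])
    then show False using atom_nz[OF x] by simp
  qed
  then obtain \<pi> where \<pi>: "\<And>x. x < l N \<Longrightarrow> \<pi> x < k 0" "\<And>x. x < l N \<Longrightarrow> x \<in> S (\<pi> x)" by metis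
  have \<pi>_eq: "\<pi> x = v \<longleftrightarrow> x \<in> S v" if "x < l N" "v < k 0" for x v
    using disj[OF \<pi>(1)[OF that(1)] that(2)] \<pi>(2)[OF that(1)] by blast
  have "\<exists>n R. atom x = A.pr n R" for x
    unfolding atom_def by (intro A.proj_imp_pr \<Psi>_proj B.proj_pr)
  then have "\<exists>n0. \<forall>n\<ge>n0. \<forall>x\<in>{..<l N}. \<exists>R. R \<subseteq> {..<k n} \<and> atom x = A.pr n R"
    by (intro A.common_level) auto
  then obtain n where "\<forall>x\<in>{..<l N}. \<exists>R. R \<subseteq> {..<k n} \<and> atom x = A.pr n R" by blast
  then have "\<exists>R. R \<subseteq> {..<k n} \<and> atom x = A.pr n R" if "x < l N" for x using that by simp
  then obtain R where R: "\<And>x. x < l N \<Longrightarrow> R x \<subseteq> {..<k n}" "\<And>x. x < l N \<Longrightarrow> atom x = A.pr n (R x)"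
    by metis
  let ?q = "k n div k 0"
  have q: "0 < ?q" by (simp add: A.k_div_pos)
  have R_ne: "R x \<noteq> {}" if "x < l N" for x
    using atom_nz[OF that] unfolding R(2)[OF that] A.pr_eq_0_iff by blast
  have R_\<pi>: "j div ?q = \<pi> x" if "x < l N" "j \<in> R x" for x j
  proof -
    have "{x} \<inter> S (\<pi> x) = {x}" using \<pi>(2)[OF that(1)] by blast
    then have "atom x \<otimes>\<^bsub>A.U\<^esub> A.pr 0 {\<pi> x} = atom x"
      using atom_vertex[OF \<pi>(1)[OF that(1)], of x] by (simp add: atom_def)
    then have "R x \<inter> {..<k n} \<subseteq> {p. p div ?q \<in> {\<pi> x}}"
      unfolding R(2)[OF that(1)] A.pr_up[of 0 n "{\<pi> x}", OF le0] A.pr_absorb_iff .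
    then show ?thesis using R(1)[OF that(1)] that(2) by blast
  qed
  have lev: "A.lev n u v \<longleftrightarrow> leq (u div ?q) (v div ?q) \<and> (u div ?q = v div ?q \<longrightarrow> u \<le> v)" for u v
    by (simp add: A.lev_def amp_le_def)
  \<comment> \<open>Transport of the block relation between a vertex and an atom. In the first
    algebra the atom is a nonempty index set inside block \<open>\<pi> x\<close>, and whether
    something in block \<open>a\<close> lies above it depends on the two vertices only.\<close>
  have below_iff: "(\<exists>y\<in>S a. B.lev N x y) \<longleftrightarrow> leq (\<pi> x) a" if x: "x < l N" and a: "a < k 0" for x a
  proof -
    have "(\<exists>y\<in>S a. B.lev N x y) \<longleftrightarrow> (\<exists>b\<in>B.T. B.pr N (S a) \<otimes>\<^bsub>B.U\<^esub> b \<otimes>\<^bsub>B.U\<^esub> B.pr N {x} \<noteq> \<zero>\<^bsub>B.U\<^esub>)"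
      unfolding B.block_iff using x S(1)[OF a] by auto
    also have "\<dots> \<longleftrightarrow> (\<exists>b\<in>A.T. A.pr 0 {a} \<otimes>\<^bsub>A.U\<^esub> b \<otimes>\<^bsub>A.U\<^esub> atom x \<noteq> \<zero>\<^bsub>A.U\<^esub>)"
      using block_transfer[OF A.pr_T[of 0 "{a}"] atom_T[of x]]
      unfolding \<Phi>_atom vertex_el_def[symmetric] S(2)[OF a] by simp
    also have "\<dots> \<longleftrightarrow> (\<exists>i\<in>{p. p div ?q \<in> {a}} \<inter> {..<k n}. \<exists>j\<in>R x \<inter> {..<k n}. A.lev n j i)"
      unfolding R(2)[OF x] A.pr_up[of 0 n "{a}", OF le0] A.block_iff ..
    also have "\<dots> \<longleftrightarrow> leq (\<pi> x) a"
    proof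
      assume "\<exists>i\<in>{p. p div ?q \<in> {a}} \<inter> {..<k n}. \<exists>j\<in>R x \<inter> {..<k n}. A.lev n j i"
      then show "leq (\<pi> x) a" using R_\<pi>[OF x] by (auto simp: lev)
    next
      assume le: "leq (\<pi> x) a"
      obtain j where j: "j \<in> R x" "j < k n" using R_ne[OF x] R(1)[OF x] by blast
      \<comment> \<open>Within the same block \<open>j\<close> itself serves; otherwise any index of
        block \<open>a\<close> does, here its first.\<close>
      define i where "i = (if \<pi> x = a then j else a * ?q)"
      have "a * ?q < k n" using mult_add_less[OF a q] A.k_mult[of 0 n] by simp
      then have "i \<in> {p. p div ?q \<in> {a}} \<inter> {..<k n}" "A.lev n j i"
        using q R_\<pi>[OF x j(1)] le j by (auto simp: i_def lev)
      then show "\<exists>i\<in>{p. p div ?q \<in> {a}} \<inter> {..<k n}. \<exists>j\<in>R x \<inter> {..<k n}. A.lev n j i" using j by blast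
    qed
    finally show ?thesis .
  qed
  \<comment> \<open>Leaves of stage \<open>N\<close> pull back to index sets of the first tower. If
    two of these lay under a common leaf, they would contain comparable indices, and then the two
    original leaves would be comparable.\<close>
  have "card BN.leaves \<le> card A0.leaves"
  proof -
    interpret An: tree_order "{..<k n}" "A.lev n" by (rule A.tree_order_lev)
    have "\<exists>b. b \<in> An.leaves \<and> (\<exists>j\<in>R x. A.lev n j b)" if "x \<in> BN.leaves" for x
    proof -
      have x: "x < l N" using that by (simp add: BN.leaves_def)
      obtain j where j: "j \<in> R x" "j < k n" using R_ne[OF x] R(1)[OF x] by blast
      then obtain b where "b \<in> An.leaves" "A.lev n j b" using An.below_leaf[of j] by auto
      then show ?thesis using j by blast
    qed
    then obtain b where b: "\<And>x. x \<in> BN.leaves \<Longrightarrow> b x \<in> An.leaves"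
      "\<And>x. x \<in> BN.leaves \<Longrightarrow> \<exists>j\<in>R x. A.lev n j (b x)" by metis
    have R_rel: "B.lev N x y" if "x < l N" "y < l N" "i \<in> R y" "j \<in> R x" "A.lev n j i" for x y i j
    proof -
      have "\<exists>a\<in>A.T. atom y \<otimes>\<^bsub>A.U\<^esub> a \<otimes>\<^bsub>A.U\<^esub> atom x \<noteq> \<zero>\<^bsub>A.U\<^esub>"
        unfolding R(2)[OF that(1)] R(2)[OF that(2)] A.block_iff
        using that R(1)[OF that(1)] R(1)[OF that(2)] by blast
      then have "\<exists>a\<in>B.T. B.pr N {y} \<otimes>\<^bsub>B.U\<^esub> a \<otimes>\<^bsub>B.U\<^esub> B.pr N {x} \<noteq> \<zero>\<^bsub>B.U\<^esub>"
        unfolding block_transfer[OF atom_T atom_T] \<Phi>_atom .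
      then show ?thesis unfolding B.block_iff by blast
    qed
    have "inj_on b BN.leaves"
    proof (rule inj_onI)
      fix x y assume xy: "x \<in> BN.leaves" "y \<in> BN.leaves" "b x = b y"
      then have lt: "x < l N" "y < l N" by (simp_all add: BN.leaves_def)
      obtain i j where ij: "i \<in> R x" "A.lev n i (b x)" "j \<in> R y" "A.lev n j (b x)"
        using b(2)[OF xy(1)] b(2)[OF xy(2)] xy(3) by metis
      have "A.lev n i j \<or> A.lev n j i" using An.le_chain[OF ij(2,4)] .
      then have "B.lev N x y \<or> B.lev N y x" using R_rel lt ij by blast
      then show "x = y" using xy by (auto simp: BN.leaves_def)
    qed
    then have "card BN.leaves \<le> card An.leaves" using b(1) by (intro card_inj_on_le[of b]) auto
    then show ?thesis using A.card_leaves_lev_le[of n] by linarith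
  qed
  moreover
  have r_pos: "0 < r"
  proof -
    have "0 < l N" by (rule B.k_pos)
    then have "S (\<pi> 0) \<noteq> {}" using \<pi>(2) by blast
    then show ?thesis using card_S[OF \<pi>(1)] fin_S[OF \<pi>(1)] \<open>0 < l N\<close> by (metis card_gt_0_iff)
  qed
  have S_ne: "S a \<noteq> {}" if "a < k 0" for a using card_S[OF that] r_pos by auto
  have leaf_lt: "a < k 0" if "a \<in> A0.leaves" for a using that by (simp add: A0.leaves_def)
  have "\<exists>y\<in>BN.leaves. \<exists>x\<in>S a. B.lev N x y" if a: "a \<in> A0.leaves" for a
  proof -
    obtain x where x: "x \<in> S a" "x < l N" using S_ne[OF leaf_lt[OF a]] S(1)[OF leaf_lt[OF a]] by blast
    then obtain y where "y \<in> BN.leaves" "B.lev N x y" using BN.below_leaf[of x] by auto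
    then show ?thesis using x by blast
  qed
  then obtain \<beta> where \<beta>: "\<And>a. a \<in> A0.leaves \<Longrightarrow> \<beta> a \<in> BN.leaves"
    "\<And>a. a \<in> A0.leaves \<Longrightarrow> \<exists>x\<in>S a. B.lev N x (\<beta> a)" by metis
  \<comment> \<open>Two indices below a common one are comparable, and by \<open>below_iff\<close>
    comparable members of \<open>S a\<close> and \<open>S b\<close> make the leaves \<open>a\<close>
    and \<open>b\<close> comparable, hence equal.\<close>
  have sep: "a = b" if ab: "a \<in> A0.leaves" "b \<in> A0.leaves"
    and xy: "x \<in> S a" "y \<in> S b" "B.lev N x z" "B.lev N y z" for a b x y z
  proof -
    have one: "a = b" if ab: "a \<in> A0.leaves" "b \<in> A0.leaves" and xy: "x \<in> S a" "y \<in> S b" "B.lev N x y" for a b x y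
    proof -
      have x: "x < l N" using S(1)[OF leaf_lt[OF ab(1)]] xy by auto
      have "leq (\<pi> x) b" using below_iff[OF x leaf_lt[OF ab(2)]] xy by blast
      moreover have "\<pi> x = a" using \<pi>_eq[OF x leaf_lt[OF ab(1)]] xy by simp
      ultimately have "b = a" using ab(1) by (auto simp: A0.leaves_def)
      then show ?thesis ..
    qed
    have "B.lev N x y \<or> B.lev N y x" using BN.le_chain[OF xy(3,4)] .
    then show ?thesis using one[OF ab xy(1,2)] one[OF ab(2,1) xy(2,1)] by metis
  qed
  have \<beta>_inj: "inj_on \<beta> A0.leaves"
  proof (rule inj_onI)
    fix a b assume ab: "a \<in> A0.leaves" "b \<in> A0.leaves" "\<beta> a = \<beta> b"
    obtain x y where "x \<in> S a" "B.lev N x (\<beta> a)" "y \<in> S b" "B.lev N y (\<beta> a)"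
      using \<beta>(2)[OF ab(1)] \<beta>(2)[OF ab(2)] ab(3) by metis
    then show "a = b" using sep[OF ab(1,2)] by blast
  qed
  \<comment> \<open>The second tree has at most as many leaves as \<open>G\<close>, and
    \<open>\<beta>\<close> is injective.\<close>
  ultimately have \<beta>_surj: "\<beta> ` A0.leaves = BN.leaves"
    using \<beta>(1) by (intro card_seteq) (auto simp: card_image)
  have only: "y = \<beta> a" if h: "a \<in> A0.leaves" "y \<in> BN.leaves" "x \<in> S a" "B.lev N x y" for a x y
  proof -
    obtain b where b: "b \<in> A0.leaves" "y = \<beta> b" using h(2) \<beta>_surj by blast
    then obtain x' where "x' \<in> S b" "B.lev N x' y" using \<beta>(2) by blast
    then show ?thesis using sep[OF h(1) b(1) h(3)] h(4) b(2) by blast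
  qed
  \<comment> \<open>Some \<open>y\<close> of \<open>S a\<close> lies above \<open>x\<close>, and the
    only leaf that can lie above \<open>y\<close> is \<open>\<beta> a\<close>.\<close>
  have down_sub: "x \<in> BN.down (\<beta> a)" if a: "a \<in> A0.leaves" and x: "x < l N" and le: "leq (\<pi> x) a" for a x
  proof -
    obtain y where y: "y \<in> S a" "B.lev N x y" using below_iff[OF x leaf_lt[OF a]] le by blast
    have "y < l N" using y S(1)[OF leaf_lt[OF a]] by auto
    then obtain z where z: "z \<in> BN.leaves" "B.lev N y z" using BN.below_leaf[of y] by auto
    then have "z = \<beta> a" using only[OF a z(1) y(1)] by blast
    then show ?thesis using BN.le_trans[OF y(2) z(2)] by (simp add: BN.down_def)
  qed
  have card_vimage: "card {x. x < l N \<and> \<pi> x \<in> D} = r * card D" if D: "D \<subseteq> {..<k 0}" for D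
  proof -
    have "{x. x < l N \<and> \<pi> x \<in> D} = (\<Union>v\<in>D. S v)"
    proof (intro equalityI subsetI)
      fix x assume "x \<in> {x. x < l N \<and> \<pi> x \<in> D}"
      then show "x \<in> (\<Union>v\<in>D. S v)" using \<pi>(2) by blast
    next
      fix x assume "x \<in> (\<Union>v\<in>D. S v)"
      then obtain v where v: "v \<in> D" "x \<in> S v" by blast
      then have "v < k 0" "x < l N" using D S(1) by auto
      then show "x \<in> {x. x < l N \<and> \<pi> x \<in> D}" using \<pi>_eq[of x v] v by auto
    qed
    moreover have "card (\<Union>v\<in>D. S v) = (\<Sum>v\<in>D. card (S v))"
    proof (intro card_UN_disjoint ballI impI)
      show "finite D" using D finite_subset by blast
      show "finite (S v)" if "v \<in> D" for v using that D fin_S by blast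
      show "S v \<inter> S w = {}" if "v \<in> D" "w \<in> D" "v \<noteq> w" for v w
        by (rule disj) (use that D in auto)
    qed
    moreover have "(\<Sum>v\<in>D. card (S v)) = (\<Sum>v\<in>D. r)" using D card_S by (intro sum.cong) auto
    ultimately show ?thesis by simp
  qed
  have "{x. x < l N \<and> \<pi> x \<in> {..<k 0}} = {..<l N}" using \<pi>(1) by auto
  then have lN: "k 0 * r = l N" using card_vimage[of "{..<k 0}"] by simp
  have A0_down: "A0.down a \<subseteq> {..<k 0}" for a by (auto simp: A0.down_def dest: A0.le_in)
  let ?T = "ampliation r G"
  have hasse_T: "hasse ?T (amp_le r leq)" by (rule hasse_ampliation[OF A.hasse_G r_pos])
  have verts_T: "pverts ?T = {..<l N}"
    unfolding pverts_ampliation[OF r_pos] A.verts_G div_mem_lessThan[OF r_pos] lN ..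
  interpret T: tree_order "{..<l N}" "amp_le r leq" using hasse_T by (simp add: hasse_def verts_T)
  \<comment> \<open>The last index of block \<open>a\<close>; the ancestors of \<open>top a\<close>
    are the indices of all blocks of ancestors of \<open>a\<close>.\<close>
  define top where "top a = a * r + (r - 1)" for a
  have top_div: "top a div r = a" for a using mult_add_div[of "r - 1" r a] r_pos by (simp add: top_def)
  have le_top: "amp_le r leq u (top a) \<longleftrightarrow> leq (u div r) a" for u a
  proof -
    have "u \<le> top a" if "u div r = a"
    proof -
      have "u = a * r + u mod r" "u mod r \<le> r - 1" using that r_pos by auto (metis Suc_pred less_Suc_eq_le mod_less_divisor)
      then show ?thesis unfolding top_def by linarith
    qed
    then show ?thesis by (auto simp: amp_le_def top_div)
  qed
  have T_down: "T.down (top a) = {u. u div r \<in> A0.down a}" for a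
    by (auto simp: T.down_def A0.down_def le_top)
  have fin_sub: "finite D" if "D \<subseteq> {..<k 0}" for D using that finite_subset by blast
  obtain f where f: "bij_betw f {..<l N} {..<l N}"
    "\<And>x y. x \<in> {..<l N} \<Longrightarrow> y \<in> {..<l N} \<Longrightarrow> amp_le r leq x y \<longleftrightarrow> B.lev N (f x) (f y)"
  \<comment> \<open>The generating set consists of the last indices of the blocks over leaves of
    \<open>G\<close>, and \<open>u div r\<close> recovers the leaf.\<close>
  proof (rule tree_order_iso[OF T.tree_order_axioms BN.tree_order_axioms, of "top ` A0.leaves" "\<lambda>u. \<beta> (u div r)"])
    show "top ` A0.leaves \<subseteq> {..<l N}"
      using mult_add_less[of _ "k 0" "r - 1" r] r_pos lN leaf_lt by (auto simp: top_def)
    show "\<exists>a\<in>top ` A0.leaves. amp_le r leq x a" if "x \<in> {..<l N}" for x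
    proof -
      have "x div r \<in> {..<k 0}" using that lN by (simp add: less_mult_imp_div_less)
      then obtain a where "a \<in> A0.leaves" "leq (x div r) a" using A0.below_leaf by blast
      then show ?thesis by (auto simp: le_top)
    qed
    show "(\<lambda>u. \<beta> (u div r)) ` top ` A0.leaves \<subseteq> {..<l N}"
      using \<beta>(1) by (auto simp: top_div BN.leaves_def)
    show "card (T.down a \<inter> T.down b) = card (BN.down (\<beta> (a div r)) \<inter> BN.down (\<beta> (b div r)))"
      if h: "a \<in> top ` A0.leaves" "b \<in> top ` A0.leaves" "a \<noteq> b" for a b
    proof -
      obtain a' b' where ab: "a' \<in> A0.leaves" "b' \<in> A0.leaves" "a = top a'" "b = top b'" "a' \<noteq> b'"
        using h by blast
      have "BN.down (\<beta> a') \<inter> BN.down (\<beta> b') = {x. x < l N \<and> \<pi> x \<in> A0.down a' \<inter> A0.down b'}"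
      proof (intro equalityI subsetI)
        fix x assume "x \<in> BN.down (\<beta> a') \<inter> BN.down (\<beta> b')"
        then have xa: "B.lev N x (\<beta> a')" and xb: "B.lev N x (\<beta> b')" by (auto simp: BN.down_def)
        have x: "x < l N" using BN.le_in[OF xa] by simp
        \<comment> \<open>Take \<open>y\<close> in \<open>S c\<close> below
          \<open>\<beta> c\<close>. It cannot lie below \<open>x\<close>, since otherwise it would
          lie below \<open>\<beta> d\<close> too; being comparable with \<open>x\<close>, it lies
          above \<open>x\<close>, and \<open>below_iff\<close> applies. The presence of a second
          leaf \<open>d\<close> is essential to this argument.\<close>
        have "leq (\<pi> x) c" if c: "c \<in> A0.leaves" "B.lev N x (\<beta> c)" "d \<in> A0.leaves" "B.lev N x (\<beta> d)" "c \<noteq> d" for c d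
        proof -
          obtain y where y: "y \<in> S c" "B.lev N y (\<beta> c)" using \<beta>(2)[OF c(1)] by blast
          have "\<not> B.lev N y x"
          proof
            assume "B.lev N y x"
            then have "B.lev N y (\<beta> d)" using BN.le_trans c(4) by blast
            then have "\<beta> d = \<beta> c" using only[OF c(1) \<beta>(1)[OF c(3)] y(1)] by blast
            then show False using inj_onD[OF \<beta>_inj _ c(3,1)] c(5) by blast
          qed
          then have "B.lev N x y" using BN.le_chain[OF c(2) y(2)] by blast
          then show ?thesis using below_iff[OF x leaf_lt[OF c(1)]] y(1) by blast
        qed
        from this[OF ab(1) xa ab(2) xb ab(5)] this[OF ab(2) xb ab(1) xa ab(5)[symmetric]]
        show "x \<in> {x. x < l N \<and> \<pi> x \<in> A0.down a' \<inter> A0.down b'}" using x by (simp add: A0.down_def)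
      next
        fix x assume "x \<in> {x. x < l N \<and> \<pi> x \<in> A0.down a' \<inter> A0.down b'}"
        then show "x \<in> BN.down (\<beta> a') \<inter> BN.down (\<beta> b')"
          using down_sub[OF ab(1)] down_sub[OF ab(2)] by (simp add: A0.down_def)
      qed
      moreover have "A0.down a' \<inter> A0.down b' \<subseteq> {..<k 0}" using A0_down by blast
      ultimately have "card (BN.down (\<beta> a') \<inter> BN.down (\<beta> b')) = r * card (A0.down a' \<inter> A0.down b')"
        using card_vimage by (simp only:)
      moreover have "T.down a \<inter> T.down b = {u. u div r \<in> A0.down a' \<inter> A0.down b'}"
        unfolding ab T_down by blast
      ultimately show ?thesis
        using card_div_vimage[OF r_pos, of "A0.down a' \<inter> A0.down b'"] by (simp add: ab top_div)
    qed
    show "card (T.down a) \<le> card (BN.down (\<beta> (a div r)))" if h: "a \<in> top ` A0.leaves" for a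
    proof -
      obtain a' where a: "a' \<in> A0.leaves" "a = top a'" using h by blast
      \<comment> \<open>For a single leaf the inclusion \<open>down_sub\<close> gives the inequality
        of heights required by \<open>tree_order_iso\<close>.\<close>
      have "card (T.down a) = card {x. x < l N \<and> \<pi> x \<in> A0.down a'}"
        unfolding a T_down card_div_vimage[OF r_pos A0.finite_down] card_vimage[OF A0_down] ..
      also have "\<dots> \<le> card (BN.down (\<beta> a'))"
        using down_sub[OF a(1)] by (intro card_mono BN.finite_down) (auto simp: A0.down_def)
      finally show ?thesis by (simp add: a top_div)
    qed
  qed auto
  let ?q' = "l N div l 0"
  have q': "0 < ?q'" by (simp add: B.k_div_pos)
  have "pverts (ampliation ?q' H) = {..<l N}"
    unfolding pverts_ampliation[OF q'] B.verts_G div_mem_lessThan[OF q'] B.k_mult[OF le0] ..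
  moreover have "hasse (ampliation ?q' H) (B.lev N)"
    unfolding B.lev_def by (rule hasse_ampliation[OF B.hasse_G q'])
  ultimately have "digraph_iso (with_proj ?T) (with_proj (ampliation ?q' H))"
    using f by (intro order_iso_imp_digraph_iso[OF hasse_T, of _ "B.lev N" f]) (simp_all add: verts_T)
  then show ?thesis using lN by blast
qed

end

section \<open>A tree isomorphism induces an isometric isomorphism\<close>

text \<open>The matrix unit at \<open>(\<eta> i, \<eta> j)\<close> goes to the one at \<open>(i, j)\<close>, so \<open>\<eta>\<close> runs against the map of matrices.\<close>

definition perm :: "(nat \<Rightarrow> nat) \<Rightarrow> complex mat \<Rightarrow> complex mat" where
  "perm \<eta> A = mat (dim_row A) (dim_col A) (\<lambda>(i, j). A $$ (\<eta> i, \<eta> j))"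

text \<open>The permutation that \<open>\<eta>\<close> induces after refinement by \<open>r\<close>:
  blocks are permuted, positions inside a block are kept.\<close>

definition lift :: "nat \<Rightarrow> (nat \<Rightarrow> nat) \<Rightarrow> nat \<Rightarrow> nat" where
  "lift r \<eta> x = \<eta> (x div r) * r + x mod r"

lemma perm_carrier: "A \<in> carrier_mat n m \<Longrightarrow> perm \<eta> A \<in> carrier_mat n m"
  unfolding perm_def by auto

lemma perm_nth: "A \<in> carrier_mat n m \<Longrightarrow> i < n \<Longrightarrow> j < m \<Longrightarrow> perm \<eta> A $$ (i, j) = A $$ (\<eta> i, \<eta> j)"
  by (simp add: perm_def)

lemma perm_add:
  assumes "bij_betw \<eta> {..<n} {..<n}" "A \<in> carrier_mat n n" "B \<in> carrier_mat n n"
  shows "perm \<eta> (A + B) = perm \<eta> A + perm \<eta> B"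
proof -
  have "\<eta> i < n" if "i < n" for i using assms(1) that by (auto simp: bij_betw_def)
  then show ?thesis using assms(2,3) by (intro eq_matI) (auto simp: perm_def)
qed

lemma perm_minus:
  assumes "bij_betw \<eta> {..<n} {..<n}" "A \<in> carrier_mat n n" "B \<in> carrier_mat n n"
  shows "perm \<eta> (A - B) = perm \<eta> A - perm \<eta> B"
proof -
  have "\<eta> i < n" if "i < n" for i using assms(1) that by (auto simp: bij_betw_def)
  then show ?thesis using assms(2,3) by (intro eq_matI) (auto simp: perm_def)
qed

lemma perm_smult:
  assumes "bij_betw \<eta> {..<n} {..<n}" "A \<in> carrier_mat n n"
  shows "perm \<eta> (c \<cdot>\<^sub>m A) = c \<cdot>\<^sub>m perm \<eta> A"
proof -
  have "\<eta> i < n" if "i < n" for i using assms(1) that by (auto simp: bij_betw_def)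
  then show ?thesis using assms(2) by (intro eq_matI) (auto simp: perm_def)
qed

lemma perm_one:
  assumes "bij_betw \<eta> {..<n} {..<n}"
  shows "perm \<eta> (1\<^sub>m n) = 1\<^sub>m n"
proof -
  have "\<eta> i < n" if "i < n" for i using assms that by (auto simp: bij_betw_def)
  moreover have "\<eta> i = \<eta> j \<longleftrightarrow> i = j" if "i < n" "j < n" for i j
    using assms that by (auto simp: bij_betw_def inj_on_def)
  ultimately show ?thesis by (intro eq_matI) (auto simp: perm_def)
qed

lemma perm_mult:
  assumes \<eta>: "bij_betw \<eta> {..<n} {..<n}" and A: "A \<in> carrier_mat n n" and B: "B \<in> carrier_mat n n"
  shows "perm \<eta> (A * B) = perm \<eta> A * perm \<eta> B"
proof (rule eq_matI)
  fix i j assume "i < dim_row (perm \<eta> A * perm \<eta> B)" "j < dim_col (perm \<eta> A * perm \<eta> B)"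
  then have ij: "i < n" "j < n" using A B by (auto simp: perm_def)
  then have \<eta>ij: "\<eta> i < n" "\<eta> j < n" using \<eta> by (auto simp: bij_betw_def)
  have "(perm \<eta> A * perm \<eta> B) $$ (i, j) = (\<Sum>t<n. A $$ (\<eta> i, \<eta> t) * B $$ (\<eta> t, \<eta> j))"
    unfolding mult_mat_nth[OF perm_carrier[OF A] perm_carrier[OF B] ij]
    using ij by (intro sum.cong) (auto simp: perm_nth[OF A] perm_nth[OF B])
  also have "\<dots> = (\<Sum>t<n. A $$ (\<eta> i, t) * B $$ (t, \<eta> j))"
    by (rule sum.reindex_bij_betw[OF \<eta>])
  also have "\<dots> = (A * B) $$ (\<eta> i, \<eta> j)" by (rule mult_mat_nth[OF A B \<eta>ij, symmetric])
  also have "\<dots> = perm \<eta> (A * B) $$ (i, j)" by (rule perm_nth[OF mult_carrier_mat[OF A B] ij, symmetric])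
  finally show "perm \<eta> (A * B) $$ (i, j) = (perm \<eta> A * perm \<eta> B) $$ (i, j)" ..
qed (use A B in \<open>auto simp: perm_def\<close>)

text \<open>Permuting rows and columns is conjugation by a permutation matrix, which preserves the
  norms of vectors.\<close>

lemma op_norm_perm_le:
  assumes \<eta>: "bij_betw \<eta> {..<n} {..<n}" and A: "A \<in> carrier_mat n n"
  shows "op_norm (perm \<eta> A) \<le> op_norm A"
proof (rule op_norm_le[OF perm_carrier[OF A] op_norm_nonneg])
  fix v :: "complex vec" assume v: "v \<in> carrier_vec n"
  define \<theta> where "\<theta> = inv_into {..<n} \<eta>"
  have \<theta>: "bij_betw \<theta> {..<n} {..<n}" unfolding \<theta>_def by (rule bij_betw_inv_into[OF \<eta>])
  have \<theta>\<eta>: "\<theta> (\<eta> t) = t" if "t < n" for t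
    unfolding \<theta>_def using \<eta> that by (simp add: bij_betw_inv_into_left)
  define w where "w = vec n (\<lambda>t. v $ (\<theta> t))"
  have w: "w \<in> carrier_vec n" by (simp add: w_def)
  have nw: "vec_norm2 w = vec_norm2 v"
  proof -
    have "(vec_norm2 w)\<^sup>2 = (\<Sum>t<n. (cmod (v $ \<theta> t))\<^sup>2)" by (simp add: vec_norm2_sq w_def)
    also have "\<dots> = (\<Sum>t<n. (cmod (v $ t))\<^sup>2)" by (rule sum.reindex_bij_betw[OF \<theta>])
    also have "\<dots> = (vec_norm2 v)\<^sup>2" using v by (simp add: vec_norm2_sq)
    finally show ?thesis by (simp add: power2_eq_iff_nonneg)
  qed
  have nth: "(perm \<eta> A *\<^sub>v v) $ i = (A *\<^sub>v w) $ \<eta> i" if i: "i < n" for i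
  proof -
    have \<eta>i: "\<eta> i < n" using \<eta> i by (auto simp: bij_betw_def)
    have "(perm \<eta> A *\<^sub>v v) $ i = (\<Sum>t<n. A $$ (\<eta> i, \<eta> t) * w $ \<eta> t)"
      unfolding mult_mat_vec_nth[OF perm_carrier[OF A] v i]
    proof (intro sum.cong refl)
      fix t assume "t \<in> {..<n}"
      then have "t < n" "\<eta> t < n" using \<eta> by (auto simp: bij_betw_def)
      then show "perm \<eta> A $$ (i, t) * v $ t = A $$ (\<eta> i, \<eta> t) * w $ \<eta> t"
        using i by (simp add: perm_nth[OF A] w_def \<theta>\<eta>)
    qed
    also have "\<dots> = (\<Sum>t<n. A $$ (\<eta> i, t) * w $ t)" by (rule sum.reindex_bij_betw[OF \<eta>])
    also have "\<dots> = (A *\<^sub>v w) $ \<eta> i" by (rule mult_mat_vec_nth[OF A w \<eta>i, symmetric])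
    finally show ?thesis .
  qed
  have dims: "dim_vec (perm \<eta> A *\<^sub>v v) = n" "dim_vec (A *\<^sub>v w) = n" using A by (simp_all add: perm_def)
  have "(vec_norm2 (perm \<eta> A *\<^sub>v v))\<^sup>2 = (\<Sum>i<n. (cmod ((A *\<^sub>v w) $ \<eta> i))\<^sup>2)"
    unfolding vec_norm2_sq dims by (intro sum.cong refl) (simp add: nth del: index_mult_mat_vec)
  also have "\<dots> = (\<Sum>i<n. (cmod ((A *\<^sub>v w) $ i))\<^sup>2)" by (rule sum.reindex_bij_betw[OF \<eta>])
  also have "\<dots> = (vec_norm2 (A *\<^sub>v w))\<^sup>2" unfolding vec_norm2_sq dims ..
  finally have "vec_norm2 (perm \<eta> A *\<^sub>v v) = vec_norm2 (A *\<^sub>v w)" by (simp add: power2_eq_iff_nonneg)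
  then show "vec_norm2 (perm \<eta> A *\<^sub>v v) \<le> op_norm A * vec_norm2 v"
    using op_norm_bound[OF A w] nw by simp
qed

lemma perm_perm:
  assumes \<eta>: "\<And>i. i < n \<Longrightarrow> \<eta> i < n" "\<And>i. i < n \<Longrightarrow> \<theta> (\<eta> i) = i" and A: "A \<in> carrier_mat n n"
  shows "perm \<eta> (perm \<theta> A) = A"
  using assms by (intro eq_matI) (auto simp: perm_def)

lemma op_norm_perm:
  assumes \<eta>: "bij_betw \<eta> {..<n} {..<n}" and A: "A \<in> carrier_mat n n"
  shows "op_norm (perm \<eta> A) = op_norm A"
proof (rule antisym[OF op_norm_perm_le[OF assms]])
  define \<theta> where "\<theta> = inv_into {..<n} \<eta>"
  have \<theta>: "bij_betw \<theta> {..<n} {..<n}" unfolding \<theta>_def by (rule bij_betw_inv_into[OF \<eta>])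
  have "perm \<theta> (perm \<eta> A) = A"
  proof (rule perm_perm[OF _ _ A])
    show "\<theta> i < n" if "i < n" for i using \<theta> that by (auto simp: bij_betw_def)
    show "\<eta> (\<theta> i) = i" if "i < n" for i
      unfolding \<theta>_def using \<eta> that by (simp add: bij_betw_inv_into_right)
  qed
  then show "op_norm A \<le> op_norm (perm \<eta> A)"
    using op_norm_perm_le[OF \<theta> perm_carrier[OF A, of \<eta>]] by simp
qed

lemma lift_div [simp]: "0 < r \<Longrightarrow> lift r \<eta> x div r = \<eta> (x div r)"
  and lift_mod [simp]: "lift r \<eta> x mod r = x mod r"
  by (simp_all add: lift_def)

lemma lift_bij:
  assumes \<eta>: "bij_betw \<eta> {..<K} {..<K}"
  shows "bij_betw (lift r \<eta>) {..<K * r} {..<K * r}"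
proof (rule bij_betw_imageI)
  have lt: "lift r \<eta> x < K * r" if "x < K * r" for x
  proof -
    have "0 < r" using that by (cases r) auto
    moreover have "\<eta> (x div r) < K" using \<eta> less_mult_imp_div_less[OF that] by (auto simp: bij_betw_def)
    ultimately show ?thesis unfolding lift_def by (intro mult_add_less) auto
  qed
  show inj: "inj_on (lift r \<eta>) {..<K * r}"
  proof (rule inj_onI)
    fix x y assume xy: "x \<in> {..<K * r}" "y \<in> {..<K * r}" "lift r \<eta> x = lift r \<eta> y"
    then have r: "0 < r" by (cases r) auto
    have "\<eta> (x div r) = \<eta> (y div r)" "x mod r = y mod r"
      using xy(3) lift_div[OF r] lift_mod by metis+
    moreover have "x div r < K" "y div r < K" using xy by (simp_all add: less_mult_imp_div_less)
    ultimately show "x = y" using \<eta> by (metis bij_betw_imp_inj_on div_mult_mod_eq inj_onD lessThan_iff)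
  qed
  show "lift r \<eta> ` {..<K * r} = {..<K * r}"
    by (rule endo_inj_surj[OF _ _ inj]) (use lt in auto)
qed

lemma refine_perm:
  assumes \<eta>: "bij_betw \<eta> {..<n} {..<n}" and A: "A \<in> carrier_mat n n"
  shows "refine r (perm \<eta> A) = perm (lift r \<eta>) (refine r A)"
proof (rule eq_matI)
  have R: "refine r A \<in> carrier_mat (n * r) (n * r)" by (rule refine_carrier[OF A])
  fix p q assume "p < dim_row (perm (lift r \<eta>) (refine r A))" "q < dim_col (perm (lift r \<eta>) (refine r A))"
  then have pq: "p < n * r" "q < n * r" using R by (auto simp: perm_def)
  then have r: "0 < r" by (cases r) auto
  have lpq: "lift r \<eta> p < n * r" "lift r \<eta> q < n * r"
    using lift_bij[OF \<eta>, of r] pq by (auto simp: bij_betw_def)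
  show "refine r (perm \<eta> A) $$ (p, q) = perm (lift r \<eta>) (refine r A) $$ (p, q)"
    unfolding perm_nth[OF R pq] refine_nth[OF perm_carrier[OF A] pq] refine_nth[OF A lpq]
    using pq r by (simp add: perm_nth[OF A] less_mult_imp_div_less)
qed (use A in \<open>auto simp: perm_def refine_def\<close>)

lemma lift_lift: "0 < r \<Longrightarrow> lift r' (lift r \<eta>) = lift (r * r') \<eta>"
proof
  fix x assume r: "0 < r"
  have "lift r' (lift r \<eta>) x = \<eta> (x div r' div r) * r * r' + ((x div r' mod r) * r' + x mod r')"
    by (simp add: lift_def algebra_simps)
  also have "x div r' div r = x div (r * r')" by (subst mult.commute) (rule div_mult2_eq[symmetric])
  also have "(x div r' mod r) * r' + x mod r' = x mod (r * r')"
    using mod_mult2_eq[of x r' r] by (simp add: mult.commute)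
  finally show "lift r' (lift r \<eta>) x = lift (r * r') \<eta> x" by (simp add: lift_def mult.assoc)
qed

text \<open>Positions inside blocks are untouched by \<open>lift\<close>, so only the comparison of
  blocks has to be transported.\<close>

lemma amp_le_lift:
  assumes \<eta>: "bij_betw \<eta> {..<K} {..<K}" and iff: "\<And>x y. x < K \<Longrightarrow> y < K \<Longrightarrow> leq (\<eta> x) (\<eta> y) \<longleftrightarrow> leq' x y"
    and xy: "x < K * r" "y < K * r"
  shows "amp_le r leq (lift r \<eta> x) (lift r \<eta> y) \<longleftrightarrow> amp_le r leq' x y"
proof -
  have r: "0 < r" using xy by (cases r) auto
  have lt: "x div r < K" "y div r < K" using xy by (simp_all add: less_mult_imp_div_less)
  have "\<eta> (x div r) = \<eta> (y div r) \<longleftrightarrow> x div r = y div r"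
    using \<eta> lt by (auto simp: bij_betw_def inj_on_def)
  moreover have "lift r \<eta> x \<le> lift r \<eta> y \<longleftrightarrow> x \<le> y" if eq: "x div r = y div r"
  proof -
    have "x = y div r * r + x mod r" "y = y div r * r + y mod r"
      using eq by (metis div_mult_mod_eq, simp)
    then have "x \<le> y \<longleftrightarrow> x mod r \<le> y mod r" by linarith
    then show ?thesis using eq by (simp add: lift_def)
  qed
  ultimately show ?thesis using iff[OF lt] r by (simp add: amp_le_def)
qed

lemma perm_tri:
  assumes \<eta>: "bij_betw \<eta> {..<K} {..<K}" and iff: "\<And>x y. x < K \<Longrightarrow> y < K \<Longrightarrow> leq (\<eta> x) (\<eta> y) \<Longrightarrow> leq' x y"
    and A: "A \<in> tri K leq"
  shows "perm \<eta> A \<in> tri K leq'"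
proof -
  have "leq' j i" if ij: "i < K" "j < K" "perm \<eta> A $$ (i, j) \<noteq> 0" for i j
  proof -
    have "\<eta> i < K" "\<eta> j < K" using \<eta> ij by (auto simp: bij_betw_def)
    moreover have "A $$ (\<eta> i, \<eta> j) \<noteq> 0" using ij perm_nth[OF tri_carrier[OF A] ij(1,2)] by simp
    ultimately have "leq (\<eta> j) (\<eta> i)" using A unfolding tri_def by blast
    then show ?thesis using iff ij by blast
  qed
  then show ?thesis using perm_carrier[OF tri_carrier[OF A]] unfolding tri_def by blast
qed

lemma div_mult_div_chain: "a dvd b \<Longrightarrow> b dvd c \<Longrightarrow> 0 < a \<Longrightarrow> (b div a) * (c div b) = c div a" for a b c :: nat
  by (auto elim!: dvdE)

lemma refine_up_refine:
  assumes "a dvd b" "b dvd c" "0 < a"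
  shows "refine (c div b) (refine (b div a) A) = refine (c div a) A"
  by (simp add: refine_refine div_mult_div_chain[OF assms])

text \<open>\<open>K\<close> is the common number of vertices of the two isomorphic ampliations. The
  two conditions turning size into divisibility hold for powers of 2 and let the towers interleave.
  The inverse isomorphism comes from a second instance with the towers exchanged.\<close>

locale uhf_transfer = A: supernatural k + B: supernatural l for k l :: "nat \<Rightarrow> nat" +
  fixes K :: nat and \<eta> :: "nat \<Rightarrow> nat"
  assumes k_dvd_l: "k m \<le> l n \<Longrightarrow> k m dvd l n" and K_dvd_l: "K \<le> l n \<Longrightarrow> K dvd l n"
    and k0_le_K: "k 0 \<le> K" and l_lim: "filterlim l at_top sequentially"
    and \<eta>: "bij_betw \<eta> {..<K} {..<K}"
begin

text \<open>The bound \<open>m \<le> n\<close> keeps the set finite, and \<open>k 0 \<le> K\<close>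
  keeps it nonempty once \<open>K \<le> l n\<close>.\<close>

definition idx :: "nat \<Rightarrow> nat" where
  "idx n = Max {m. m \<le> n \<and> k m \<le> l n}"

definition \<eta>n :: "nat \<Rightarrow> nat \<Rightarrow> nat" where
  "\<eta>n n = lift (l n div K) \<eta>"

definition move :: "nat \<Rightarrow> nat \<Rightarrow> complex mat \<Rightarrow> complex mat" where
  "move m n A = perm (\<eta>n n) (refine (l n div k m) A)"

text \<open>
  Stage \<open>n\<close> of the image is read off the latest stage \<open>m \<le> n\<close> that embeds into \<open>M\<^bsub>l n\<^esub>\<close>; the finitely
  many stages too small to carry the permutation \<open>\<eta>\<close> of the common size \<open>K\<close> are set to zero.
\<close>

definition trans_seq :: "(nat \<Rightarrow> complex mat) \<Rightarrow> nat \<Rightarrow> complex mat" where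
  "trans_seq X n = (if l n < K then 0\<^sub>m (l n) (l n) else move (idx n) n (X (idx n)))"

lemma K_pos: "0 < K"
  using k0_le_K A.k_pos[of 0] by linarith

lemma idx:
  assumes "K \<le> l n"
  shows "idx n \<le> n" "k (idx n) \<le> l n" "\<And>m. m \<le> n \<Longrightarrow> k m \<le> l n \<Longrightarrow> m \<le> idx n"
proof -
  have fin: "finite {m. m \<le> n \<and> k m \<le> l n}" by (rule finite_subset[of _ "{..n}"]) auto
  have "0 \<in> {m. m \<le> n \<and> k m \<le> l n}" using assms k0_le_K by simp
  then have "idx n \<in> {m. m \<le> n \<and> k m \<le> l n}" unfolding idx_def using Max_in[OF fin] by blast
  then show "idx n \<le> n" "k (idx n) \<le> l n" by auto
  show "m \<le> idx n" if "m \<le> n" "k m \<le> l n" for m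
    unfolding idx_def using that by (intro Max_ge fin) simp
qed

lemma l_mono: "m \<le> n \<Longrightarrow> l m \<le> l n"
  using B.k_dvd B.k_pos dvd_imp_le by blast

lemma idx_mono: "K \<le> l m \<Longrightarrow> m \<le> n \<Longrightarrow> idx m \<le> idx n"
  using idx[of m] idx(3)[of n "idx m"] l_mono[of m n] by linarith

lemma l_large: "\<exists>N. \<forall>n\<ge>N. c \<le> l n"
  using l_lim by (simp add: filterlim_at_top eventually_sequentially)

text \<open>Each fixed stage \<open>M\<close> of the first tower eventually embeds, because
  \<open>l\<close> is unbounded; hence \<open>idx\<close> tends to infinity.\<close>

lemma good_large: "\<exists>N\<ge>M. \<forall>n\<ge>N. K \<le> l n \<and> M \<le> idx n"
proof -
  obtain N1 N2 where N: "\<And>n. N1 \<le> n \<Longrightarrow> K \<le> l n" "\<And>n. N2 \<le> n \<Longrightarrow> k M \<le> l n"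
    using l_large[of K] l_large[of "k M"] by blast
  have "K \<le> l n \<and> M \<le> idx n" if "max M (max N1 N2) \<le> n" for n
    using that N[of n] idx(3)[of n M] by simp
  then show ?thesis by (intro exI[of _ "max M (max N1 N2)"]) auto
qed

lemma idx_lim: "filterlim idx at_top sequentially"
  unfolding filterlim_at_top eventually_sequentially using good_large by blast

lemma \<eta>n_bij: "K \<le> l n \<Longrightarrow> bij_betw (\<eta>n n) {..<l n} {..<l n}"
  using lift_bij[OF \<eta>, of "l n div K"] K_dvd_l[of n] by (simp add: \<eta>n_def)

lemma refine_to_l: "k m \<le> l n \<Longrightarrow> A \<in> A.mats m \<Longrightarrow> refine (l n div k m) A \<in> B.mats n"
  using refine_carrier[of A "k m" "k m" "l n div k m"] k_dvd_l[of m n] by simp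

lemma move_carrier: "k m \<le> l n \<Longrightarrow> A \<in> A.mats m \<Longrightarrow> move m n A \<in> B.mats n"
  unfolding move_def by (intro perm_carrier refine_to_l)

lemma l_div_pos: "k m \<le> l n \<Longrightarrow> 0 < l n div k m"
  using A.k_pos by (simp add: div_greater_zero_iff)

lemma op_norm_move:
  assumes "K \<le> l n" "k m \<le> l n" "A \<in> A.mats m"
  shows "op_norm (move m n A) = op_norm A"
  unfolding move_def op_norm_perm[OF \<eta>n_bij[OF assms(1)] refine_to_l[OF assms(2,3)]]
  by (rule op_norm_refine[OF assms(3) l_div_pos[OF assms(2)]])

lemma move_mult:
  assumes "K \<le> l n" "k m \<le> l n" "A \<in> A.mats m" "B \<in> A.mats m"
  shows "move m n (A * B) = move m n A * move m n B"
  unfolding move_def refine_mult[OF assms(3,4)]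
  by (rule perm_mult[OF \<eta>n_bij[OF assms(1)] refine_to_l[OF assms(2,3)] refine_to_l[OF assms(2,4)]])

lemma move_add:
  assumes "K \<le> l n" "k m \<le> l n" "A \<in> A.mats m" "B \<in> A.mats m"
  shows "move m n (A + B) = move m n A + move m n B"
  unfolding move_def refine_add[OF assms(3,4)]
  by (rule perm_add[OF \<eta>n_bij[OF assms(1)] refine_to_l[OF assms(2,3)] refine_to_l[OF assms(2,4)]])

lemma move_minus:
  assumes "K \<le> l n" "k m \<le> l n" "A \<in> A.mats m" "B \<in> A.mats m"
  shows "move m n (A - B) = move m n A - move m n B"
  unfolding move_def refine_minus[OF assms(3,4)]
  by (rule perm_minus[OF \<eta>n_bij[OF assms(1)] refine_to_l[OF assms(2,3)] refine_to_l[OF assms(2,4)]])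

lemma move_smult:
  assumes "K \<le> l n" "k m \<le> l n" "A \<in> A.mats m"
  shows "move m n (c \<cdot>\<^sub>m A) = c \<cdot>\<^sub>m move m n A"
  unfolding move_def refine_smult
  by (rule perm_smult[OF \<eta>n_bij[OF assms(1)] refine_to_l[OF assms(2,3)]])

lemma move_one:
  assumes "K \<le> l n" "k m \<le> l n"
  shows "move m n (1\<^sub>m (k m)) = 1\<^sub>m (l n)"
  unfolding move_def refine_one using k_dvd_l[OF assms(2)] perm_one[OF \<eta>n_bij[OF assms(1)]] by simp

text \<open>With \<open>up_move\<close>, this says that the maps \<open>move\<close> commute with
  the connecting maps of both towers, so that they induce a map of the limits.\<close>

lemma move_up:
  assumes "m \<le> m'" "k m' \<le> l n"
  shows "move m' n (A.up m m' A) = move m n A"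
  unfolding move_def A.up_def
  using refine_up_refine[OF A.k_dvd[OF assms(1)] k_dvd_l[OF assms(2)] A.k_pos] by simp

lemma up_move:
  assumes K: "K \<le> l n" and n: "n \<le> n'" and m: "k m \<le> l n" and A: "A \<in> A.mats m"
  shows "B.up n n' (move m n A) = move m n' A"
proof -
  have "B.up n n' (move m n A) = perm (lift (l n' div l n) (\<eta>n n)) (refine (l n' div l n) (refine (l n div k m) A))"
    unfolding B.up_def move_def by (rule refine_perm[OF \<eta>n_bij[OF K] refine_to_l[OF m A]])
  also have "lift (l n' div l n) (\<eta>n n) = \<eta>n n'"
  proof -
    have "0 < l n div K" using K K_pos by (simp add: div_greater_zero_iff)
    moreover have "(l n div K) * (l n' div l n) = l n' div K"
      using K_dvd_l[OF K] B.k_dvd[OF n] K_pos by (auto elim!: dvdE)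
    ultimately show ?thesis by (simp add: \<eta>n_def lift_lift)
  qed
  also have "refine (l n' div l n) (refine (l n div k m) A) = refine (l n' div k m) A"
    by (rule refine_up_refine[OF k_dvd_l[OF m] B.k_dvd[OF n] A.k_pos])
  finally show ?thesis by (simp add: move_def)
qed

lemma trans_seq_carrier:
  assumes X: "X \<in> uhf_seqs k"
  shows "trans_seq X n \<in> B.mats n"
  using move_carrier[OF idx(2) A.seqs_carrier[OF X], of n] by (auto simp: trans_seq_def)

text \<open>Brought to stage \<open>n'\<close> by the compatibility of \<open>move\<close>, a
  difference of two terms is the isometric image of a difference of terms of \<open>X\<close>; and
  \<open>idx\<close> tends to infinity.\<close>

lemma trans_seq_seqs:
  assumes X: "X \<in> uhf_seqs k"
  shows "trans_seq X \<in> uhf_seqs l"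
proof (rule B.seqsI)
  show "trans_seq X n \<in> B.mats n" for n by (rule trans_seq_carrier[OF X])
  fix e :: real assume e: "0 < e"
  obtain M where M: "\<And>m n. M \<le> m \<Longrightarrow> m \<le> n \<Longrightarrow> op_norm (X n - A.up m n (X m)) < e"
    using A.seqs_cauchy[OF X e] by blast
  obtain N where N: "\<And>n. N \<le> n \<Longrightarrow> K \<le> l n \<and> M \<le> idx n" using good_large[of M] by blast
  have "op_norm (trans_seq X n' - B.up n n' (trans_seq X n)) < e" if nn: "N \<le> n" "n \<le> n'" for n n'
  proof -
    have K: "K \<le> l n" "K \<le> l n'" using N nn by auto
    note i = idx[OF K(1)] and i' = idx[OF K(2)]
    have ii: "idx n \<le> idx n'" by (rule idx_mono[OF K(1) nn(2)])
    have k': "k (idx n) \<le> l n'" using i(2) l_mono[OF nn(2)] by linarith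
    have u: "A.up (idx n) (idx n') (X (idx n)) \<in> A.mats (idx n')" by (rule A.up_carrier[OF ii A.seqs_carrier[OF X]])
    have "B.up n n' (trans_seq X n) = move (idx n) n' (X (idx n))"
      using K up_move[OF K(1) nn(2) i(2) A.seqs_carrier[OF X]] by (simp add: trans_seq_def)
    also have "\<dots> = move (idx n') n' (A.up (idx n) (idx n') (X (idx n)))"
      by (rule move_up[OF ii i'(2), symmetric])
    finally have "trans_seq X n' - B.up n n' (trans_seq X n) =
        move (idx n') n' (X (idx n') - A.up (idx n) (idx n') (X (idx n)))"
      using K move_minus[OF K(2) i'(2) A.seqs_carrier[OF X] u] by (simp add: trans_seq_def)
    then have "op_norm (trans_seq X n' - B.up n n' (trans_seq X n)) =
        op_norm (X (idx n') - A.up (idx n) (idx n') (X (idx n)))"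
      using op_norm_move[OF K(2) i'(2) minus_carrier_mat[OF u]] by simp
    then show ?thesis using M[OF _ ii] N[OF nn(1)] by simp
  qed
  then show "\<exists>N. \<forall>m\<ge>N. \<forall>n\<ge>m. op_norm (trans_seq X n - B.up m n (trans_seq X m)) < e" by blast
qed

lemma eventually_good: "eventually (\<lambda>n. K \<le> l n) sequentially"
  unfolding eventually_sequentially by (rule l_large)

lemma trans_seq_diff_lim:
  assumes X: "X \<in> uhf_seqs k" and Y: "Y \<in> uhf_seqs k" and lim: "(\<lambda>n. op_norm (X n - Y n)) \<longlonglongrightarrow> r"
  shows "(\<lambda>n. op_norm (trans_seq X n - trans_seq Y n)) \<longlonglongrightarrow> r"
proof -
  have "(\<lambda>n. op_norm (X (idx n) - Y (idx n))) \<longlonglongrightarrow> r"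
    by (rule filterlim_compose[OF lim idx_lim])
  moreover have "eventually (\<lambda>n. op_norm (X (idx n) - Y (idx n)) = op_norm (trans_seq X n - trans_seq Y n)) sequentially"
    using eventually_good
  proof eventually_elim
    case (elim n)
    show ?case
    proof -
      have "op_norm (X (idx n) - Y (idx n)) = op_norm (move (idx n) n (X (idx n) - Y (idx n)))"
        by (rule op_norm_move[OF elim idx(2)[OF elim] minus_carrier_mat[OF A.seqs_carrier[OF Y]], symmetric])
      also have "\<dots> = op_norm (trans_seq X n - trans_seq Y n)"
        using elim move_minus[OF elim idx(2)[OF elim] A.seqs_carrier[OF X] A.seqs_carrier[OF Y]]
        by (simp add: trans_seq_def)
      finally show ?thesis .
    qed
  qed
  ultimately show ?thesis by (rule Lim_transform_eventually)
qed

text \<open>The choice of a representative is harmless, as \<open>\<Theta>_cls\<close> shows; the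
  union form used for the operations of \<open>uhf_algebra\<close> is avoided.\<close>

definition \<Theta> :: "uhf_element \<Rightarrow> uhf_element" where
  "\<Theta> x = B.cls (trans_seq (SOME X. X \<in> uhf_seqs k \<and> x = A.cls X))"

lemma \<Theta>_cls:
  assumes X: "X \<in> uhf_seqs k"
  shows "\<Theta> (A.cls X) = B.cls (trans_seq X)"
proof -
  define Y where "Y = (SOME Y. Y \<in> uhf_seqs k \<and> A.cls X = A.cls Y)"
  have Y: "Y \<in> uhf_seqs k \<and> A.cls X = A.cls Y"
    unfolding Y_def by (rule someI[of _ X]) (simp add: X)
  then have "(\<lambda>n. op_norm (Y n - X n)) \<longlonglongrightarrow> 0" using A.cls_eq_iff[of Y X] X by simp
  then have "B.cls (trans_seq Y) = B.cls (trans_seq X)"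
    using Y X by (intro B.cls_eqI trans_seq_seqs trans_seq_diff_lim) auto
  then show ?thesis by (simp add: \<Theta>_def Y_def)
qed

lemma trans_seq_cong:
  assumes "X' \<in> uhf_seqs l" "X \<in> uhf_seqs k" "\<And>n. K \<le> l n \<Longrightarrow> X' n = move (idx n) n (X (idx n))"
  shows "B.cls X' = \<Theta> (A.cls X)"
proof -
  obtain N where N: "\<And>n. N \<le> n \<Longrightarrow> K \<le> l n" using l_large[of K] by blast
  show ?thesis unfolding \<Theta>_cls[OF assms(2)]
  proof (rule B.cls_eventually_eqI[OF assms(1) trans_seq_seqs[OF assms(2)], of N])
    fix n assume "N \<le> n"
    then show "X' n = trans_seq X n" using N[of n] assms(3)[of n] by (simp add: trans_seq_def)
  qed
qed

lemma \<Theta>_carrier: "x \<in> carrier A.U \<Longrightarrow> \<Theta> x \<in> carrier B.U"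
  by (erule A.carrierE) (simp add: \<Theta>_cls B.cls_in_carrier trans_seq_seqs)

lemma \<Theta>_mult:
  assumes "x \<in> carrier A.U" "y \<in> carrier A.U"
  shows "\<Theta> (x \<otimes>\<^bsub>A.U\<^esub> y) = \<Theta> x \<otimes>\<^bsub>B.U\<^esub> \<Theta> y"
proof -
  obtain X Y where XY: "X \<in> uhf_seqs k" "x = A.cls X" "Y \<in> uhf_seqs k" "y = A.cls Y"
    by (rule A.carrierE[OF assms(1)], rule A.carrierE[OF assms(2)])
  show ?thesis
    unfolding XY A.mult_cls[OF XY(1,3)] \<Theta>_cls[OF XY(1)] \<Theta>_cls[OF XY(3)]
      B.mult_cls[OF trans_seq_seqs[OF XY(1)] trans_seq_seqs[OF XY(3)]]
    by (rule trans_seq_cong[symmetric, OF B.seqs_mult[OF trans_seq_seqs[OF XY(1)] trans_seq_seqs[OF XY(3)]]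
        A.seqs_mult[OF XY(1,3)]])
      (simp add: trans_seq_def move_mult[OF _ idx(2) A.seqs_carrier[OF XY(1)] A.seqs_carrier[OF XY(3)]])
qed

lemma \<Theta>_add:
  assumes "x \<in> carrier A.U" "y \<in> carrier A.U"
  shows "\<Theta> (x \<oplus>\<^bsub>A.U\<^esub> y) = \<Theta> x \<oplus>\<^bsub>B.U\<^esub> \<Theta> y"
proof -
  obtain X Y where XY: "X \<in> uhf_seqs k" "x = A.cls X" "Y \<in> uhf_seqs k" "y = A.cls Y"
    by (rule A.carrierE[OF assms(1)], rule A.carrierE[OF assms(2)])
  show ?thesis
    unfolding XY A.add_cls[OF XY(1,3)] \<Theta>_cls[OF XY(1)] \<Theta>_cls[OF XY(3)]
      B.add_cls[OF trans_seq_seqs[OF XY(1)] trans_seq_seqs[OF XY(3)]]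
    by (rule trans_seq_cong[symmetric, OF B.seqs_add[OF trans_seq_seqs[OF XY(1)] trans_seq_seqs[OF XY(3)]]
        A.seqs_add[OF XY(1,3)]])
      (simp add: trans_seq_def move_add[OF _ idx(2) A.seqs_carrier[OF XY(1)] A.seqs_carrier[OF XY(3)]])
qed

lemma \<Theta>_smult:
  assumes "x \<in> carrier A.U"
  shows "\<Theta> (c \<odot>\<^bsub>A.U\<^esub> x) = c \<odot>\<^bsub>B.U\<^esub> \<Theta> x"
proof -
  obtain X where X: "X \<in> uhf_seqs k" "x = A.cls X" by (rule A.carrierE[OF assms])
  show ?thesis
    unfolding X A.smult_cls[OF X(1)] \<Theta>_cls[OF X(1)] B.smult_cls[OF trans_seq_seqs[OF X(1)]]
    by (rule trans_seq_cong[symmetric, OF B.seqs_smult[OF trans_seq_seqs[OF X(1)]] A.seqs_smult[OF X(1)]])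
      (simp add: trans_seq_def move_smult[OF _ idx(2) A.seqs_carrier[OF X(1)]])
qed

lemma \<Theta>_one: "\<Theta> \<one>\<^bsub>A.U\<^esub> = \<one>\<^bsub>B.U\<^esub>"
  unfolding A.one_cls B.one_cls
  by (rule trans_seq_cong[symmetric, OF B.seqs_one A.seqs_one]) (simp add: move_one[OF _ idx(2)])

lemma nrm_\<Theta>_minus:
  assumes "x \<in> carrier A.U" "y \<in> carrier A.U"
  shows "B.nrm (\<Theta> x \<ominus>\<^bsub>B.U\<^esub> \<Theta> y) = A.nrm (x \<ominus>\<^bsub>A.U\<^esub> y)"
proof -
  obtain X Y where XY: "X \<in> uhf_seqs k" "x = A.cls X" "Y \<in> uhf_seqs k" "y = A.cls Y"
    by (rule A.carrierE[OF assms(1)], rule A.carrierE[OF assms(2)])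
  show ?thesis
    unfolding XY A.minus_cls[OF XY(1,3)] \<Theta>_cls[OF XY(1)] \<Theta>_cls[OF XY(3)]
      B.minus_cls[OF trans_seq_seqs[OF XY(1)] trans_seq_seqs[OF XY(3)]]
    by (intro B.nrm_eqI B.seqs_minus trans_seq_seqs XY trans_seq_diff_lim A.nrm_cls A.seqs_minus)
qed

text \<open>Identifies the image of an element of a finite stage, which is what is needed to see
  that triangular elements go to triangular ones.\<close>

lemma \<Theta>_emb:
  assumes A: "A \<in> A.mats m" and K: "K \<le> l n" and m: "k m \<le> l n" "m \<le> n"
  shows "\<Theta> (A.emb m A) = B.emb n (move m n A)"
proof -
  have M: "move m n A \<in> B.mats n" by (rule move_carrier[OF m(1) A])
  show ?thesis
    unfolding A.emb_def B.emb_def \<Theta>_cls[OF A.seqs_emb[OF A]]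
  proof (rule B.cls_eventually_eqI[OF trans_seq_seqs[OF A.seqs_emb[OF A]] B.seqs_emb[OF M], of n])
    fix n' assume n': "n \<le> n'"
    have K': "K \<le> l n'" using K l_mono[OF n'] by linarith
    have mi: "m \<le> idx n'" using idx(3)[OF K', of m] m n' l_mono[OF n'] by linarith
    have "trans_seq (A.emb_seq m A) n' = move m n' A"
      using K' mi move_up[OF mi idx(2)[OF K']] by (simp add: trans_seq_def A.emb_seq_def)
    also have "\<dots> = B.emb_seq n (move m n A) n'"
      using up_move[OF K n' m(1) A] n' by (simp add: B.emb_seq_def)
    finally show "trans_seq (A.emb_seq m A) n' = B.emb_seq n (move m n A) n'" .
  qed
qed

end

text \<open>The round trip does not return \<open>X\<close> itself: its term at stage
  \<open>n\<close> is an earlier term of \<open>X\<close> embedded into stage \<open>n\<close>, the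
  two permutations having cancelled. By the Cauchy property the difference from \<open>X\<close>
  tends to 0.\<close>

lemma \<Theta>_inverse:
  assumes t: "uhf_transfer k l K \<eta>" and t': "uhf_transfer l k K \<theta>"
    and inv: "\<And>x. x < K \<Longrightarrow> \<eta> (\<theta> x) = x" and x: "x \<in> carrier (uhf_algebra k)"
  shows "uhf_transfer.\<Theta> l k K \<theta> (uhf_transfer.\<Theta> k l K \<eta> x) = x"
proof -
  interpret t: uhf_transfer k l K \<eta> by fact
  interpret t': uhf_transfer l k K \<theta> by fact
  obtain X where X: "X \<in> uhf_seqs k" "x = t.A.cls X" by (rule t.A.carrierE[OF x])
  have seqs: "t.trans_seq X \<in> uhf_seqs l" "t'.trans_seq (t.trans_seq X) \<in> uhf_seqs k"
    by (intro t.trans_seq_seqs t'.trans_seq_seqs X)+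
  have eq: "t'.trans_seq (t.trans_seq X) n = t.A.up (t.idx (t'.idx n)) n (X (t.idx (t'.idx n)))"
    and le: "t.idx (t'.idx n) \<le> n"
    if K: "K \<le> k n" "K \<le> l (t'.idx n)" for n
  proof -
    define i j where "i = t'.idx n" and "j = t.idx i"
    have i: "i \<le> n" "l i \<le> k n" using t'.idx[OF K(1)] by (auto simp: i_def)
    have Ki: "K \<le> l i" using K(2) by (simp add: i_def)
    have j: "j \<le> i" "k j \<le> l i" using t.idx[OF Ki] by (auto simp: j_def)
    then show "t.idx (t'.idx n) \<le> n" using i by (simp add: i_def j_def)
    have Xj: "X j \<in> t.A.mats j" by (rule t.A.seqs_carrier[OF X(1)])
    let ?q = "k n div l i"
    have "t'.trans_seq (t.trans_seq X) n = t'.move i n (t.move j i (X j))"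
      using K Ki by (simp add: t'.trans_seq_def t.trans_seq_def i_def j_def)
    also have "\<dots> = perm (t'.\<eta>n n) (perm (lift ?q (t.\<eta>n i)) (refine ?q (refine (l i div k j) (X j))))"
      unfolding t'.move_def t.move_def refine_perm[OF t.\<eta>n_bij[OF Ki] t.refine_to_l[OF j(2) Xj]] ..
    also have "refine ?q (refine (l i div k j) (X j)) = t.A.up j n (X j)"
      unfolding t.A.up_def by (rule refine_up_refine[OF t.k_dvd_l[OF j(2)] t'.k_dvd_l[OF i(2)] t.A.k_pos])
    also have "lift ?q (t.\<eta>n i) = lift (k n div K) \<eta>"
    proof -
      have "0 < l i div K" using Ki t.K_pos by (simp add: div_greater_zero_iff)
      moreover have "(l i div K) * ?q = k n div K"
by (intro div_mult_div_chain t.K_dvd_l[OF Ki] t'.k_dvd_l[OF i(2)] t.K_pos)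
      ultimately show ?thesis by (simp add: t.\<eta>n_def lift_lift)
    qed
    also have "perm (t'.\<eta>n n) (perm (lift (k n div K) \<eta>) (t.A.up j n (X j))) = t.A.up j n (X j)"
    proof (rule perm_perm)
      show "t.A.up j n (X j) \<in> carrier_mat (k n) (k n)" using j i by (intro t.A.up_carrier Xj) simp
      fix p assume p: "p < k n"
      show "t'.\<eta>n n p < k n" using t'.\<eta>n_bij[OF K(1)] p by (auto simp: bij_betw_def)
      let ?r = "k n div K"
      have r: "0 < ?r" using K(1) t.K_pos by (simp add: div_greater_zero_iff)
      have "K * ?r = k n" using t'.K_dvd_l[OF K(1)] by simp
      then have "p div ?r < K" using p by (simp add: less_mult_imp_div_less)
      then show "lift ?r \<eta> (t'.\<eta>n n p) = p"
        unfolding t'.\<eta>n_def lift_def[of ?r \<eta>] using r inv[of "p div ?r"] by (simp add: div_mult_mod_eq)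
    qed
    finally show "t'.trans_seq (t.trans_seq X) n = t.A.up (t.idx (t'.idx n)) n (X (t.idx (t'.idx n)))"
      by (simp add: i_def j_def)
  qed
  have "t.A.cls (t'.trans_seq (t.trans_seq X)) = t.A.cls X"
  proof (rule t.A.cls_eqI[OF seqs(2) X(1)], rule LIMSEQ_I)
    fix e :: real assume e: "0 < e"
    obtain M where M: "\<And>m n. M \<le> m \<Longrightarrow> m \<le> n \<Longrightarrow> op_norm (X n - t.A.up m n (X m)) < e"
      using t.A.seqs_cauchy[OF X(1) e] by blast
    obtain N where N: "\<And>n. N \<le> n \<Longrightarrow> K \<le> l n \<and> M \<le> t.idx n" using t.good_large[of M] by blast
    obtain N' where N': "\<And>n. N' \<le> n \<Longrightarrow> K \<le> k n \<and> N \<le> t'.idx n" using t'.good_large[of N] by blast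
    have "norm (op_norm (t'.trans_seq (t.trans_seq X) n - X n) - 0) < e" if "N' \<le> n" for n
    proof -
      have K: "K \<le> k n" "K \<le> l (t'.idx n)" "M \<le> t.idx (t'.idx n)" using N'[OF that] N by auto
      let ?j = "t.idx (t'.idx n)"
      have "op_norm (t'.trans_seq (t.trans_seq X) n - X n) = op_norm (X n - t.A.up ?j n (X ?j))"
        unfolding eq[OF K(1,2)]
        by (rule op_norm_minus_commute[OF t.A.up_carrier[OF le[OF K(1,2)] t.A.seqs_carrier[OF X(1)]] t.A.seqs_carrier[OF X(1)]])
      then show ?thesis using M[OF K(3) le[OF K(1,2)]] by simp
    qed
    then show "\<exists>N. \<forall>n\<ge>N. norm (op_norm (t'.trans_seq (t.trans_seq X) n - X n) - 0) < e" by blast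
  qed
  then show ?thesis unfolding X(2) t.\<Theta>_cls[OF X(1)] t'.\<Theta>_cls[OF seqs(1)] .
qed

text \<open>The permutation takes indices of the second tree to indices of the first, against the
  direction of \<open>\<Theta>\<close>.\<close>

locale tree_transfer = uhf_transfer k l K \<eta> + A: tree_algebra k G leq + B: tree_algebra l H leq'
  for k l :: "nat \<Rightarrow> nat" and K :: nat and \<eta> :: "nat \<Rightarrow> nat" and G leq H leq' +
  assumes k0_dvd_K: "k 0 dvd K" and l0_dvd_K: "l 0 dvd K"
    and \<eta>_order: "\<And>x y. x < K \<Longrightarrow> y < K \<Longrightarrow>
      amp_le (K div k 0) leq (\<eta> x) (\<eta> y) \<longleftrightarrow> amp_le (K div l 0) leq' x y"
begin

text \<open>At stages beyond \<open>K\<close> both orders are ampliations, by the same factor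
  \<open>l n div K\<close>, of orders on \<open>K\<close> indices that \<open>\<eta>\<close>
  identifies.\<close>

lemma move_tris:
  assumes A: "A \<in> A.tris m" and K: "K \<le> l n" and m: "k m \<le> l n"
  shows "move m n A \<in> B.tris n"
  unfolding move_def
proof (rule perm_tri[OF \<eta>n_bij[OF K]])
  let ?r = "l n div K"
  have Kr: "K * ?r = l n" using K_dvd_l[OF K] by simp
  have p: "(K div k 0) * ?r = l n div k 0" and q: "(K div l 0) * ?r = l n div l 0"
    by (intro div_mult_div_chain k0_dvd_K l0_dvd_K K_dvd_l[OF K] A.k_pos B.k_pos)+
  show "refine (l n div k m) A \<in> tri (l n) (amp_le ?r (amp_le (K div k 0) leq))"
  proof -
    have "(k m div k 0) * (l n div k m) = l n div k 0"
      by (intro div_mult_div_chain A.k_dvd k_dvd_l[OF m] A.k_pos) simp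
    then show ?thesis
      using refine_tri[OF A, of "l n div k m"] A.lev_refl k_dvd_l[OF m]
      by (simp add: A.lev_def amp_le_amp_le p)
  qed
  fix x y assume xy: "x < l n" "y < l n"
    and le: "amp_le ?r (amp_le (K div k 0) leq) (\<eta>n n x) (\<eta>n n y)"
  have "amp_le ?r (amp_le (K div l 0) leq') x y"
    using amp_le_lift[where leq = "amp_le (K div k 0) leq" and leq' = "amp_le (K div l 0) leq'"
        and x = x and y = y and r = ?r, OF \<eta> \<eta>_order] xy le Kr by (simp add: \<eta>n_def)
  then show "B.lev n x y" by (simp add: B.lev_def amp_le_amp_le q)
qed

lemma \<Theta>_T:
  assumes x: "x \<in> A.T"
  shows "\<Theta> x \<in> B.T"
  unfolding B.T_iff
proof (intro conjI allI impI)
  have xU: "x \<in> carrier A.U" by (rule A.T_carrier[OF x])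
  show "\<Theta> x \<in> carrier B.U" by (rule \<Theta>_carrier[OF xU])
  fix e :: real assume "0 < e"
  then obtain m A where A: "A \<in> A.tris m" "A.nrm (x \<ominus>\<^bsub>A.U\<^esub> A.emb m A) < e"
    using x unfolding A.T_iff by blast
  have Ac: "A \<in> A.mats m" using A(1) by (rule tri_carrier)
  obtain n where n: "m \<le> n" "K \<le> l n" "k m \<le> l n"
  proof -
    obtain N where "\<forall>n\<ge>N. K \<le> l n \<and> m \<le> idx n" using good_large[of m] by blast
    then have "K \<le> l (max N m)" by simp
    moreover obtain N' where "\<forall>n\<ge>N'. k m \<le> l n" using l_large by blast
    ultimately have "K \<le> l (max N (max m N'))" "k m \<le> l (max N (max m N'))"
      using \<open>\<forall>n\<ge>N. K \<le> l n \<and> m \<le> idx n\<close> by auto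
    then show thesis by (intro that[of "max N (max m N')"]) auto
  qed
  have "B.nrm (\<Theta> x \<ominus>\<^bsub>B.U\<^esub> B.emb n (move m n A)) < e"
    using nrm_\<Theta>_minus[OF xU A.emb_carrier[OF Ac]] A(2) unfolding \<Theta>_emb[OF Ac n(2,3,1)] by simp
  then show "\<exists>n. \<exists>A\<in>B.tris n. B.nrm (\<Theta> x \<ominus>\<^bsub>B.U\<^esub> B.emb n A) < e"
    using move_tris[OF A(1) n(2,3)] by blast
qed

end

text \<open>An additive map sends zero to an element equal to its own double; this is how zero is
  seen to be preserved.\<close>

lemma (in supernatural) add_idem_zero:
  assumes x: "x \<in> carrier U" and xx: "x \<oplus>\<^bsub>U\<^esub> x = x"
  shows "x = \<zero>\<^bsub>U\<^esub>"
proof -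
  have "x = \<ominus>\<^bsub>U\<^esub> x \<oplus>\<^bsub>U\<^esub> (x \<oplus>\<^bsub>U\<^esub> x)" using x by (simp add: U.r_neg1)
  also have "\<dots> = \<zero>\<^bsub>U\<^esub>" unfolding xx using x by (rule U.l_neg)
  finally show ?thesis .
qed

lemma (in uhf_transfer) nrm_\<Theta>:
  assumes x: "x \<in> carrier A.U"
  shows "B.nrm (\<Theta> x) = A.nrm x"
proof -
  have "\<Theta> \<zero>\<^bsub>A.U\<^esub> = \<zero>\<^bsub>B.U\<^esub>"
    using \<Theta>_add[of "\<zero>\<^bsub>A.U\<^esub>" "\<zero>\<^bsub>A.U\<^esub>"] by (intro B.add_idem_zero \<Theta>_carrier) simp_all
  then show ?thesis using nrm_\<Theta>_minus[OF x, of "\<zero>\<^bsub>A.U\<^esub>"] x \<Theta>_carrier[OF x] by simp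
qed

lemma tree_transfer_isometrically_isomorphic:
  assumes t: "tree_transfer k l K \<eta> G leq H leq'" and t': "tree_transfer l k K \<theta> H leq' G leq"
    and inv: "\<And>x. x < K \<Longrightarrow> \<eta> (\<theta> x) = x" "\<And>x. x < K \<Longrightarrow> \<theta> (\<eta> x) = x"
  shows "isometrically_isomorphic (tree_refinement_algebra G k) (tree_refinement_algebra H l)"
proof -
  interpret t: tree_transfer k l K \<eta> G leq H leq' by fact
  interpret t': tree_transfer l k K \<theta> H leq' G leq by fact
  have "t.\<Theta> \<in> Ring.ring_hom t.A.TR t.B.TR"
    by (rule ring_hom_memI) (simp_all add: t.\<Theta>_T t.\<Theta>_mult t.\<Theta>_add t.\<Theta>_one t.A.T_carrier)
  moreover have "bij_betw t.\<Theta> t.A.T t.B.T"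
  proof (rule bij_betw_byWitness[where f' = t'.\<Theta>])
    show "\<forall>x\<in>t.A.T. t'.\<Theta> (t.\<Theta> x) = x"
      using \<Theta>_inverse[OF t.uhf_transfer_axioms t'.uhf_transfer_axioms inv(1)] t.A.T_carrier by blast
    show "\<forall>x\<in>t.B.T. t.\<Theta> (t'.\<Theta> x) = x"
      using \<Theta>_inverse[OF t'.uhf_transfer_axioms t.uhf_transfer_axioms inv(2)] t.B.T_carrier by blast
    show "t.\<Theta> ` t.A.T \<subseteq> t.B.T" using t.\<Theta>_T by blast
    show "t'.\<Theta> ` t.B.T \<subseteq> t.A.T" using t'.\<Theta>_T by blast
  qed
  ultimately have "t.\<Theta> \<in> ring_iso t.A.TR t.B.TR" by (simp add: ring_iso_def)
  then show ?thesis
    unfolding isometrically_isomorphic_def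
    by (rule bexI[rotated]) (simp add: t.\<Theta>_smult t.nrm_\<Theta> t.A.T_carrier)
qed

lemma isometrically_isomorphic_imp_ampliations:
  assumes A: "tree_algebra k G leq" and B: "tree_algebra l H leq'"
    and iso: "isometrically_isomorphic (tree_refinement_algebra G k) (tree_refinement_algebra H l)"
  shows "\<exists>r N. k 0 * r = l N \<and> digraph_iso (with_proj (ampliation r G)) (with_proj (ampliation (l N div l 0) H))"
proof -
  interpret A: tree_algebra k G leq by fact
  interpret B: tree_algebra l H leq' by fact
  obtain \<phi> where \<phi>: "\<phi> \<in> ring_iso A.TR B.TR" "\<And>x. x \<in> A.T \<Longrightarrow> B.nrm (\<phi> x) = A.nrm x"
    using iso unfolding isometrically_isomorphic_def by auto
  have hom: "\<phi> \<in> Ring.ring_hom A.TR B.TR" and bij: "bij_betw \<phi> A.T B.T" using \<phi>(1) by (auto simp: ring_iso_def)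
  have zero: "\<phi> \<zero>\<^bsub>A.U\<^esub> = \<zero>\<^bsub>B.U\<^esub>"
  proof -
    have z: "\<zero>\<^bsub>A.U\<^esub> \<in> A.T" using A.pr_T[of 0 "{}"] A.pr_eq_0_iff[of 0 "{}"] by simp
    then have "\<phi> \<zero>\<^bsub>A.U\<^esub> \<in> carrier B.U" using bij by (intro B.T_carrier) (auto simp: bij_betw_def)
    then show ?thesis using ring_hom_add[OF hom z z] by (intro B.add_idem_zero) simp_all
  qed
  interpret tree_algebra_iso k G leq l H leq' \<phi>
    by unfold_locales (use bij zero \<phi>(2) ring_hom_mult[OF hom] in auto)
  show ?thesis by (rule ampliations_isomorphic)
qed

section \<open>Powers of 2 and the equivalence\<close>

lemma power2_le_imp_dvd:
  fixes a b :: nat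
  assumes "\<exists>e. a = 2 ^ e" "\<exists>e. b = 2 ^ e" "a \<le> b"
  shows "a dvd b"
  using assms by (auto intro: le_imp_power_dvd)

lemma dvd_power2:
  fixes a b :: nat
  assumes "a dvd b" "\<exists>e. b = 2 ^ e"
  shows "\<exists>e. a = 2 ^ e"
  using assms divides_primepow_nat[OF two_is_prime_nat] by blast

theorem theorem5p4:
  fixes G H :: "nat pair_pre_digraph" and k l :: "nat \<Rightarrow> nat"
  assumes "out_tree G" and "out_tree H"
    and "pverts G = {..<k 0}" and "pverts H = {..<l 0}"
    and "\<And>n. \<exists>e. k n = 2 ^ e" and "\<And>n. \<exists>e. l n = 2 ^ e"
    and "\<And>n. k n dvd k (Suc n)" and "\<And>n. l n dvd l (Suc n)"
    and "filterlim k at_top sequentially" and "filterlim l at_top sequentially"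
  shows "isometrically_isomorphic (tree_refinement_algebra G k) (tree_refinement_algebra H l) \<longleftrightarrow>
    (\<exists>a b. digraph_iso (with_proj (ampliation (2 ^ a) G)) (with_proj (ampliation (2 ^ b) H)))"
proof -
  define leq leq' where "leq u v \<longleftrightarrow> u \<rightarrow>\<^sup>*\<^bsub>with_proj G\<^esub> v" and "leq' u v \<longleftrightarrow> u \<rightarrow>\<^sup>*\<^bsub>with_proj H\<^esub> v" for u v
  have hasse: "hasse G leq" "hasse H leq'"
    using out_tree_hasse[OF assms(1)] out_tree_hasse[OF assms(2)] by (simp_all add: leq_def[abs_def] leq'_def[abs_def])
  have pos: "0 < k n" "0 < l n" for n using assms(5)[of n] assms(6)[of n] by auto
  have A: "tree_algebra k G leq" using pos(1) assms(3,7) hasse(1) by unfold_locales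
  have B: "tree_algebra l H leq'" using pos(2) assms(4,8) hasse(2) by unfold_locales
  interpret A: tree_algebra k G leq by (rule A)
  interpret B: tree_algebra l H leq' by (rule B)
  show ?thesis
  proof
    assume "isometrically_isomorphic (tree_refinement_algebra G k) (tree_refinement_algebra H l)"
    then obtain r N where r: "k 0 * r = l N"
      "digraph_iso (with_proj (ampliation r G)) (with_proj (ampliation (l N div l 0) H))"
      using isometrically_isomorphic_imp_ampliations[OF A B] by blast
    \<comment> \<open>Both multiplicities divide the size \<open>l N\<close>, a power of 2, so they
      are powers of 2 themselves.\<close>
    have "r dvd l N" "l N div l 0 dvd l N"
      using r(1) B.k_mult[of 0 N] by (metis dvd_triv_right, metis dvd_triv_right le0)
    then obtain a b where "r = 2 ^ a" "l N div l 0 = 2 ^ b" using dvd_power2 assms(6)[of N] by metis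
    then show "\<exists>a b. digraph_iso (with_proj (ampliation (2 ^ a) G)) (with_proj (ampliation (2 ^ b) H))"
      using r(2) by metis
  next
    assume "\<exists>a b. digraph_iso (with_proj (ampliation (2 ^ a) G)) (with_proj (ampliation (2 ^ b) H))"
    then obtain a b where iso: "digraph_iso (with_proj (ampliation (2 ^ a) G)) (with_proj (ampliation (2 ^ b) H))"
      by blast
    define K where "K = k 0 * 2 ^ a"
    have verts: "pverts (ampliation (2 ^ a) G) = {..<K}" "pverts (ampliation (2 ^ b) H) = {..<l 0 * 2 ^ b}"
      by (simp_all only: pverts_ampliation zero_less_power zero_less_numeral assms(3,4) div_mem_lessThan K_def)
    obtain f where f: "bij_betw f {..<K} {..<l 0 * 2 ^ b}"
      "\<And>x y. x \<in> {..<K} \<Longrightarrow> y \<in> {..<K} \<Longrightarrow> amp_le (2 ^ a) leq x y \<longleftrightarrow> amp_le (2 ^ b) leq' (f x) (f y)"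
      using digraph_iso_imp_order_iso[OF hasse_ampliation[OF hasse(1)] hasse_ampliation[OF hasse(2)] iso]
      unfolding verts by auto
    have K': "K = l 0 * 2 ^ b" using bij_betw_same_card[OF f(1)] by simp
    have f_bij: "bij_betw f {..<K} {..<K}" using f(1) K' by simp
    \<comment> \<open>Since permutations run against the maps of matrices, the inverse
      \<open>g\<close> serves the map from the first algebra to the second, and \<open>f\<close>
      serves the map back.\<close>
    define g where "g = inv_into {..<K} f"
    have g_bij: "bij_betw g {..<K} {..<K}" unfolding g_def by (rule bij_betw_inv_into[OF f_bij])
    have fg: "f (g x) = x" "g (f x) = x" if "x < K" for x
      unfolding g_def using f_bij that by (simp_all add: bij_betw_inv_into_right bij_betw_inv_into_left)
    have g_lt: "g x < K" if "x < K" for x using g_bij that by (auto simp: bij_betw_def)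
    have K_pow: "\<exists>e. K = 2 ^ e"
    proof -
      obtain e where "k 0 = 2 ^ e" using assms(5)[of 0] by blast
      then have "K = 2 ^ (e + a)" by (simp add: K_def power_add)
      then show ?thesis by blast
    qed
    have K_div: "K div k 0 = 2 ^ a" "K div l 0 = 2 ^ b"
      using pos[of 0] by (simp_all add: K_def[symmetric] K') (simp add: K'[symmetric] K_def)
    \<comment> \<open>The comparisons between \<open>k\<close>, \<open>l\<close> and
      \<open>K\<close> for both directions: among powers of 2 the smaller divides the
      larger.\<close>
    note dvd = power2_le_imp_dvd[OF assms(5) assms(6)] power2_le_imp_dvd[OF assms(6) assms(5)]
      power2_le_imp_dvd[OF K_pow assms(5)] power2_le_imp_dvd[OF K_pow assms(6)]
    have le: "k 0 \<le> K" "l 0 \<le> K" unfolding K_def by simp (simp add: K_def[symmetric] K')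
    have dvd0: "k 0 dvd K" "l 0 dvd K" unfolding K_def by simp (simp add: K_def[symmetric] K')
    have "tree_transfer k l K g G leq H leq'"
      by unfold_locales
        (use dvd le dvd0 g_bij assms(10) f(2)[OF lessThan_iff[THEN iffD2] lessThan_iff[THEN iffD2]] g_lt fg K_div in auto)
    moreover have "tree_transfer l k K f H leq' G leq"
      by unfold_locales (use dvd le dvd0 f_bij assms(9) f(2) K_div in auto)
    ultimately show "isometrically_isomorphic (tree_refinement_algebra G k) (tree_refinement_algebra H l)"
      by (rule tree_transfer_isometrically_isomorphic) (use fg in auto)
  qed
qed

end
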